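(* Let $\Omega\subset X$ be a nonempty bounded open set with $P(\Omega,X)<\infty$ such that for every $u\in \mathrm{BV}(\Omega)$ the trace $Tu(x)$ exists for $\mathcal H$-a.e. $x\in\partial^*\Omega$. Let $f\in L^1(\partial^*\Omega,P(\Omega,\cdot))$ satisfy $\int_{\partial^*\Omega} f\,dP(\Omega,\cdot)=0$. Let $u\in \mathrm{BV}(\Omega)$ with $-1\le u\le 1$. Then there exist disjoint $\mu$-measurable sets $E_1,E_2\subset\Omega$ such that $$I(\chi_{E_1}-\chi_{E_2})\le I(u).$$ Furthermore, if $u$ is a solution to the restricted Neumann problem with boundary data $f$, then for $\mathcal L^1$-a.e. $t_1,t_2\in(0,1)$ the sets $E_1:=\{x\in\Omega: u(x)>t_1\}$ and $E_2:=\{x\in\Omega: u(x)<-t_2\}$ give a solution $\chi_{E_1}-\chi_{E_2}$ to the same restricted Neumann problem.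
   Context: Setting. $(X,d,\mu)$ is a complete metric space with at least two points, with a Borel regular outer measure $\mu$ that is doubling: there is $C_d\ge 1$ with $0<\mu(B(x,2r))\le C_d\,\mu(B(x,r))<\infty$ for all balls. A Borel function $g\ge 0$ is an upper gradient of $u$ if $|u(x)-u(y)|\le\int_\gamma g\,ds$ for every nonconstant rectifiable curve $\gamma$ with end points $x,y$ (the left side is $\infty$ if $u(x)$ or $u(y)$ is infinite); for functions on an open set $U$ only curves in $U$ are considered. $X$ supports a $(1,1)$-Poincaré inequality: there are $C_P>0$, $\lambda\ge 1$ such that for all balls $B(x,r)$, all locally integrable $u$ on $X$ and all upper gradients $g$ of $u$, $\frac1{\mu(B(x,r))}\int_{B(x,r)}|u-u_{B(x,r)}|\,d\mu\le \frac{C_P r}{\mu(B(x,\lambda r))}\int_{B(x,\lambda r)}g\,d\mu$, where $u_{B}$ is the mean of $u$ over $B$. BV functions. For $U\subset X$ open and $u\in L^1_{\rm loc}(U)$, $\|Du\|(U)=\inf\{\liminf_i\int_U g_{u_i}\,d\mu\}$, the infimum over $u_i\in \mathrm{Lip}_{\rm loc}(U)$ (Lipschitz on every open $U'$ with $\overline{U'}$ compact in $U$) with $u_i\to u$ in $L^1_{\rm loc}(U)$ and $g_{u_i}$ an upper gradient of $u_i$ in $U$; for arbitrary $A$, $\|Du\|(A)=\inf\{\|Du\|(U):U\supset A\text{ open}\}$. $u\in\mathrm{BV}(U)$ means $u\in L^1(U)$ and $\|Du\|(U)<\infty$. For $\mu$-measurable $E$, $P(E,A)=\|D\chi_E\|(A)$.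 $\mathcal H$ is the codimension 1 Hausdorff measure: $\mathcal H(A)=\lim_{R\to0}\inf\{\sum_i \mu(B(x_i,r_i))/r_i: A\subset\bigcup_i B(x_i,r_i),\ r_i\le R\}$. The measure theoretic boundary $\partial^*E$ is the set of $x\in X$ with $\limsup_{r\to0}\mu(B(x,r)\cap E)/\mu(B(x,r))>0$ and $\limsup_{r\to 0}\mu(B(x,r)\setminus E)/\mu(B(x,r))>0$. For $u$ on $\Omega$ and $x\in\partial\Omega$, the number $Tu(x)$ is the trace of $u$ at $x$ if $\lim_{r\to0}\frac{1}{\mu(B(x,r)\cap\Omega)}\int_{B(x,r)\cap\Omega}|u-Tu(x)|\,d\mu=0$. Functional: $I(u)=\|Du\|(\Omega)+\int_{\partial^*\Omega}Tu\,f\,dP(\Omega,\cdot)$ for $u\in\mathrm{BV}(\Omega)$. A function $u\in \mathrm{BV}(\Omega)$ solves the restricted Neumann problem with boundary data $f$ if $-1\le u\le1$ and $I(u)\le I(v)$ for all $v\in\mathrm{BV}(\Omega)$ with $-1\le v\le 1$. $\mathcal L^1$ is Lebesgue measure on $\mathbb R$. *)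

theory Defs
  imports "HOL-Analysis.Analysis"
begin

section \<open>Metric measure spaces\<close>

text \<open>
  The underlying space is the whole of a type of class \<^class>\<open>complete_space\<close>.  Outer measures are
  defined on all sets, and integration takes place with respect to the measure on their
  Caratheodory measurable sets.
\<close>

definition caratheodory_measure :: "('a set \<Rightarrow> ennreal) \<Rightarrow> 'a measure" where
  "caratheodory_measure m = measure_of UNIV (lambda_system UNIV UNIV m) m"

lemma
  assumes "outer_measure_space UNIV m"
  shows space_caratheodory_measure: "space (caratheodory_measure m) = UNIV"
    and sets_caratheodory_measure: "sets (caratheodory_measure m) = lambda_system UNIV UNIV m"
    and emeasure_caratheodory_measure:
      "A \<in> lambda_system UNIV UNIV m \<Longrightarrow> emeasure (caratheodory_measure m) A = m A"
proof -
  interpret sigma_algebra "UNIV :: 'a set" UNIV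
    using sigma_algebra_Pow[of UNIV] by simp
  have *: "measure_space UNIV (lambda_system UNIV UNIV m) m"
    by (rule caratheodory_lemma[OF assms])
  then have **: "sigma_algebra UNIV (lambda_system UNIV UNIV m)"
    by (simp add: measure_space_def)
  show "space (caratheodory_measure m) = UNIV"
    by (simp add: caratheodory_measure_def)
  show "sets (caratheodory_measure m) = lambda_system UNIV UNIV m"
    using ** by (simp add: caratheodory_measure_def sigma_algebra.sigma_sets_eq)
  show "emeasure (caratheodory_measure m) A = m A" if "A \<in> lambda_system UNIV UNIV m"
    unfolding caratheodory_measure_def using * ** that
    by (intro emeasure_measure_of_sigma) (auto simp: measure_space_def)
qed

text \<open>
  In \<^const>\<open>outer_measure_space\<close>, countable subadditivity is required for disjoint families only;
  with monotonicity on all sets this gives it for arbitrary families.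
\<close>

definition borel_regular_outer_measure :: "('a::topological_space set \<Rightarrow> ennreal) \<Rightarrow> bool" where
  "borel_regular_outer_measure \<mu> \<longleftrightarrow>
     outer_measure_space UNIV \<mu> \<and>
     sets borel \<subseteq> lambda_system UNIV UNIV \<mu> \<and>
     (\<forall>A. \<exists>B\<in>sets borel. A \<subseteq> B \<and> \<mu> B = \<mu> A)"

definition doubling :: "('a::metric_space set \<Rightarrow> ennreal) \<Rightarrow> bool" where
  "doubling \<mu> \<longleftrightarrow>
     (\<exists>C\<^sub>d::real. C\<^sub>d \<ge> 1 \<and>
        (\<forall>x r. r > 0 \<longrightarrow>
           0 < \<mu> (ball x (2 * r)) \<and>
           \<mu> (ball x (2 * r)) \<le> ennreal C\<^sub>d * \<mu> (ball x r) \<and>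
           ennreal C\<^sub>d * \<mu> (ball x r) < \<infinity>))"


section \<open>Curves and upper gradients\<close>

text \<open>
  Up to an affine change of parameter, every curve is a \<^const>\<open>path\<close>, with parameter interval
  \<open>{0..1}\<close>.
\<close>

definition curve_length :: "(real \<Rightarrow> 'a::metric_space) \<Rightarrow> real \<Rightarrow> real \<Rightarrow> ennreal" where
  "curve_length \<gamma> a b =
     (SUP ts\<in>{ts. sorted ts \<and> set ts \<subseteq> {a..b}}.
        \<Sum>i<length ts - 1. ennreal (dist (\<gamma> (ts ! i)) (\<gamma> (ts ! Suc i))))"

definition rectifiable_curve :: "(real \<Rightarrow> 'a::metric_space) \<Rightarrow> bool" where
  "rectifiable_curve \<gamma> \<longleftrightarrow> path \<gamma> \<and> curve_length \<gamma> 0 1 < \<infinity>"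

text \<open>
  The arc length parametrization; the choice of \<open>t\<close> is immaterial, because \<open>\<gamma>\<close> is constant between
  any two candidates.
\<close>

definition arclength_param :: "(real \<Rightarrow> 'a::metric_space) \<Rightarrow> real \<Rightarrow> 'a" where
  "arclength_param \<gamma> s = \<gamma> (SOME t. t \<in> {0..1} \<and> curve_length \<gamma> 0 t = ennreal s)"

definition curve_integral :: "(real \<Rightarrow> 'a::metric_space) \<Rightarrow> ('a \<Rightarrow> ennreal) \<Rightarrow> ennreal" where
  "curve_integral \<gamma> g =
     (\<integral>\<^sup>+s\<in>{0..enn2real (curve_length \<gamma> 0 1)}. g (arclength_param \<gamma> s) \<partial>lborel)"

text \<open>Only the values of \<open>u\<close> and \<open>g\<close> on \<open>U\<close> matter.\<close>

definition upper_gradient ::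
  "'a::metric_space set \<Rightarrow> ('a \<Rightarrow> ereal) \<Rightarrow> ('a \<Rightarrow> ennreal) \<Rightarrow> bool" where
  "upper_gradient U u g \<longleftrightarrow>
     g \<in> borel_measurable (restrict_space borel U) \<and>
     (\<forall>\<gamma>. rectifiable_curve \<gamma> \<and> (\<exists>t\<in>{0..1}. \<gamma> t \<noteq> \<gamma> 0) \<and> path_image \<gamma> \<subseteq> U \<longrightarrow>
        (let x = pathstart \<gamma>; y = pathfinish \<gamma> in
           (if \<bar>u x\<bar> = \<infinity> \<or> \<bar>u y\<bar> = \<infinity> then \<infinity> else e2ennreal \<bar>u x - u y\<bar>)
             \<le> curve_integral \<gamma> g))"


section \<open>Local function spaces and the Poincare inequality\<close>

definition compactly_inside :: "'a::topological_space set \<Rightarrow> 'a set \<Rightarrow> bool" where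
  "compactly_inside V U \<longleftrightarrow> open V \<and> compact (closure V) \<and> closure V \<subseteq> U"

definition lip_loc :: "'a::metric_space set \<Rightarrow> ('a \<Rightarrow> real) \<Rightarrow> bool" where
  "lip_loc U u \<longleftrightarrow> (\<forall>V. compactly_inside V U \<longrightarrow> (\<exists>L. lipschitz_on L V u))"

definition locally_integrable ::
  "('a::metric_space set \<Rightarrow> ennreal) \<Rightarrow> 'a set \<Rightarrow> ('a \<Rightarrow> ereal) \<Rightarrow> bool" where
  "locally_integrable \<mu> U u \<longleftrightarrow>
     u \<in> borel_measurable (restrict_space (caratheodory_measure \<mu>) U) \<and>
     (\<forall>V. compactly_inside V U \<longrightarrow>
        (\<integral>\<^sup>+x\<in>V. e2ennreal \<bar>u x\<bar> \<partial>caratheodory_measure \<mu>) < \<infinity>)"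

definition converges_L1_loc ::
  "('a::metric_space set \<Rightarrow> ennreal) \<Rightarrow> 'a set \<Rightarrow> (nat \<Rightarrow> 'a \<Rightarrow> real) \<Rightarrow> ('a \<Rightarrow> real) \<Rightarrow> bool" where
  "converges_L1_loc \<mu> U v u \<longleftrightarrow>
     (\<forall>V. compactly_inside V U \<longrightarrow>
        (\<lambda>i. \<integral>\<^sup>+x\<in>V. ennreal \<bar>v i x - u x\<bar> \<partial>caratheodory_measure \<mu>) \<longlonglongrightarrow> 0)"

definition ball_mean ::
  "('a::metric_space set \<Rightarrow> ennreal) \<Rightarrow> 'a \<Rightarrow> real \<Rightarrow> ('a \<Rightarrow> ereal) \<Rightarrow> real" where
  "ball_mean \<mu> x r u =
     (LINT y:ball x r|caratheodory_measure \<mu>. real_of_ereal (u y)) / enn2real (\<mu> (ball x r))"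

definition poincare_1_1 :: "('a::metric_space set \<Rightarrow> ennreal) \<Rightarrow> bool" where
  "poincare_1_1 \<mu> \<longleftrightarrow>
     (\<exists>C\<^sub>P \<Lambda>::real. C\<^sub>P > 0 \<and> \<Lambda> \<ge> 1 \<and>
        (\<forall>x r u g. r > 0 \<and> locally_integrable \<mu> UNIV u \<and> upper_gradient UNIV u g \<longrightarrow>
           (\<integral>\<^sup>+y\<in>ball x r. e2ennreal \<bar>u y - ereal (ball_mean \<mu> x r u)\<bar> \<partial>caratheodory_measure \<mu>)
               / \<mu> (ball x r)
             \<le> ennreal (C\<^sub>P * r) / \<mu> (ball x (\<Lambda> * r))
               * (\<integral>\<^sup>+y\<in>ball x (\<Lambda> * r). g y \<partial>caratheodory_measure \<mu>)))"


section \<open>Total variation, BV functions and sets of finite perimeter\<close>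

text \<open>The total variation of \<open>u\<close> on an open set \<open>U\<close>; only the values of \<open>u\<close> on \<open>U\<close> matter.\<close>

definition total_variation_open ::
  "('a::metric_space set \<Rightarrow> ennreal) \<Rightarrow> ('a \<Rightarrow> real) \<Rightarrow> 'a set \<Rightarrow> ennreal" where
  "total_variation_open \<mu> u U =
     Inf {liminf (\<lambda>i. \<integral>\<^sup>+x\<in>U. g i x \<partial>caratheodory_measure \<mu>) | v g.
            (\<forall>i. lip_loc U (v i)) \<and> converges_L1_loc \<mu> U v u \<and>
            (\<forall>i. upper_gradient U (\<lambda>x. ereal (v i x)) (g i))}"

definition total_variation ::
  "('a::metric_space set \<Rightarrow> ennreal) \<Rightarrow> ('a \<Rightarrow> real) \<Rightarrow> 'a set \<Rightarrow> ennreal" where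
  "total_variation \<mu> u A = (INF U\<in>{U. open U \<and> A \<subseteq> U}. total_variation_open \<mu> u U)"

definition BV :: "('a::metric_space set \<Rightarrow> ennreal) \<Rightarrow> 'a set \<Rightarrow> ('a \<Rightarrow> real) set" where
  "BV \<mu> U =
     {u. set_integrable (caratheodory_measure \<mu>) U u \<and> total_variation_open \<mu> u U < \<infinity>}"

definition perimeter ::
  "('a::metric_space set \<Rightarrow> ennreal) \<Rightarrow> 'a set \<Rightarrow> 'a set \<Rightarrow> ennreal" where
  "perimeter \<mu> E A = total_variation \<mu> (indicator E) A"

definition perimeter_measure ::
  "('a::metric_space set \<Rightarrow> ennreal) \<Rightarrow> 'a set \<Rightarrow> 'a measure" where
  "perimeter_measure \<mu> E = caratheodory_measure (perimeter \<mu> E)"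

text \<open>
  Coverings by countably many balls, given by the countable set \<open>\<B>\<close> of their centres and radii.
  This allows finite coverings, which an infinite sequence of balls of positive radius would not.
\<close>

definition codim1_hausdorff_content ::
  "('a::metric_space set \<Rightarrow> ennreal) \<Rightarrow> real \<Rightarrow> 'a set \<Rightarrow> ennreal" where
  "codim1_hausdorff_content \<mu> R A =
     (INF \<B>\<in>{\<B> :: ('a \<times> real) set.
               countable \<B> \<and> (\<forall>(x, r)\<in>\<B>. 0 < r \<and> r \<le> R) \<and> A \<subseteq> (\<Union>(x, r)\<in>\<B>. ball x r)}.
        \<Sum>\<^sub>\<infinity>(x, r)\<in>\<B>. \<mu> (ball x r) / ennreal r)"

definition codim1_hausdorff ::
  "('a::metric_space set \<Rightarrow> ennreal) \<Rightarrow> 'a set \<Rightarrow> ennreal" where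
  "codim1_hausdorff \<mu> A = Lim (at_right 0) (\<lambda>R. codim1_hausdorff_content \<mu> R A)"

definition measure_theoretic_boundary ::
  "('a::metric_space set \<Rightarrow> ennreal) \<Rightarrow> 'a set \<Rightarrow> 'a set" where
  "measure_theoretic_boundary \<mu> E =
     {x. Limsup (at_right 0) (\<lambda>r. \<mu> (ball x r \<inter> E) / \<mu> (ball x r)) > 0 \<and>
         Limsup (at_right 0) (\<lambda>r. \<mu> (ball x r - E) / \<mu> (ball x r)) > 0}"


section \<open>Traces and the restricted Neumann problem\<close>

definition is_trace ::
  "('a::metric_space set \<Rightarrow> ennreal) \<Rightarrow> 'a set \<Rightarrow> ('a \<Rightarrow> real) \<Rightarrow> 'a \<Rightarrow> real \<Rightarrow> bool" where
  "is_trace \<mu> \<Omega> u x c \<longleftrightarrow>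
     x \<in> frontier \<Omega> \<and>
     ((\<lambda>r. (\<integral>\<^sup>+y\<in>ball x r \<inter> \<Omega>. ennreal \<bar>u y - c\<bar> \<partial>caratheodory_measure \<mu>)
             / \<mu> (ball x r \<inter> \<Omega>)) \<longlongrightarrow> 0) (at_right 0)"

definition bv_trace ::
  "('a::metric_space set \<Rightarrow> ennreal) \<Rightarrow> 'a set \<Rightarrow> ('a \<Rightarrow> real) \<Rightarrow> 'a \<Rightarrow> real" where
  "bv_trace \<mu> \<Omega> u x = (THE c. is_trace \<mu> \<Omega> u x c)"

text \<open>
  The value is extended real, so that it is \<open>\<infinity>\<close> rather than a junk number if the total variation is
  infinite.  The boundary integral is only meaningful if its integrand is integrable, as is the case
  for bounded \<open>u\<close> in \<open>BV \<mu> \<Omega>\<close>; it is used for such \<open>u\<close> only.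
\<close>

definition neumann_functional ::
  "('a::metric_space set \<Rightarrow> ennreal) \<Rightarrow> 'a set \<Rightarrow> ('a \<Rightarrow> real) \<Rightarrow> ('a \<Rightarrow> real) \<Rightarrow> ereal" where
  "neumann_functional \<mu> \<Omega> f u =
     enn2ereal (total_variation_open \<mu> u \<Omega>) +
     ereal (LINT x:measure_theoretic_boundary \<mu> \<Omega>|perimeter_measure \<mu> \<Omega>. bv_trace \<mu> \<Omega> u x * f x)"

text \<open>BV functions are determined up to null sets, so \<open>-1 \<le> u \<le> 1\<close> means almost everywhere.\<close>

definition restricted_BV ::
  "('a::metric_space set \<Rightarrow> ennreal) \<Rightarrow> 'a set \<Rightarrow> ('a \<Rightarrow> real) set" where
  "restricted_BV \<mu> \<Omega> =
     {u \<in> BV \<mu> \<Omega>. AE x\<in>\<Omega> in caratheodory_measure \<mu>. -1 \<le> u x \<and> u x \<le> 1}"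

definition solves_restricted_neumann ::
  "('a::metric_space set \<Rightarrow> ennreal) \<Rightarrow> 'a set \<Rightarrow> ('a \<Rightarrow> real) \<Rightarrow> ('a \<Rightarrow> real) \<Rightarrow> bool" where
  "solves_restricted_neumann \<mu> \<Omega> f u \<longleftrightarrow>
     u \<in> restricted_BV \<mu> \<Omega> \<and>
     (\<forall>v\<in>restricted_BV \<mu> \<Omega>. neumann_functional \<mu> \<Omega> f u \<le> neumann_functional \<mu> \<Omega> f v)"

end

theory Submission
  imports Defs
begin

text \<open>
  Write \<open>\<tau>\<close> for the trace of \<open>u\<close>.  By the coarea inequality, the functions
  \<open>\<phi>(t) = P({u > t}, \<Omega>) + \<integral> 1\<^bsub>{\<tau> > t}\<^esub> f dP(\<Omega>, \<cdot>)\<close> and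
  \<open>\<psi>(t) = P({u < -t}, \<Omega>) - \<integral> 1\<^bsub>{\<tau> < -t}\<^esub> f dP(\<Omega>, \<cdot>)\<close> have integrals over \<open>(0, 1)\<close> that add up to
  at most \<open>I(u)\<close>, while \<open>I(\<chi>\<^bsub>{u > t\<^sub>1}\<^esub> - \<chi>\<^bsub>{u < -t\<^sub>2}\<^esub>) \<le> \<phi>(t\<^sub>1) + \<psi>(t\<^sub>2)\<close> for all but countably many \<open>t\<^sub>1\<close> and
  \<open>t\<^sub>2\<close>.  So suitable levels do not increase \<open>I\<close>, and if \<open>u\<close> is a minimizer then \<open>\<phi>\<close> and \<open>\<psi>\<close> are almost
  everywhere equal to their means.

  For the boundary integrals to make sense, \<open>P(\<Omega>, \<cdot>)\<close> must be a Borel measure that vanishes on sets of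
  zero codimension one Hausdorff measure.  Both facts rest on gluing approximations \<open>v\<close> and \<open>w\<close> with a
  cutoff \<open>\<eta>\<close>: besides the upper gradients of \<open>v\<close> and \<open>w\<close> this costs \<open>\<bar>v - w\<bar>\<close> times an upper gradient of \<open>\<eta>\<close>.
\<close>

section \<open>Arc length\<close>

text \<open>Since the bound for the competitor is a sum of a term in \<open>t1\<close> and a term in
  \<open>t2\<close>, minimality can be tested with one level frozen: against a level with
  \<open>\<psi> s2 \<le> B\<close> it forces \<open>A \<le> \<phi>\<close> almost everywhere. So one
  null set of levels serves both variables, not merely a null set of pairs. Only upper bounds for
  the mean energies enter, hence coarea as an inequality.

  The definition of total variation gives approximants that converge, and are Lipschitz, only on
  relatively compact open subsets. Doubling and completeness make closed bounded sets compact, so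
  every open set is exhausted by such subsets, and infinitely many approximants have to be glued
  with summable errors. The resulting inner regularity yields subadditivity and the Caratheodory
  measurability of open sets.

  The upper gradient condition speaks of whole curves, while gluing needs a local condition.
  Additivity of integrals along arc length bridges the two, which is why arc length comes first.

  A thresholded function is known to have a trace only where \<open>\<tau>\<close> avoids the level;
  levels that \<open>\<tau>\<close> takes with positive perimeter measure are the countable
  exception.\<close>

fun chain_length :: "(real \<Rightarrow> 'a::metric_space) \<Rightarrow> real list \<Rightarrow> ennreal" where
  "chain_length \<gamma> (x # y # zs) = ennreal (dist (\<gamma> x) (\<gamma> y)) + chain_length \<gamma> (y # zs)"
| "chain_length \<gamma> _ = 0"

lemma chain_length_eq_sum:
  "chain_length \<gamma> ts = (\<Sum>i<length ts - 1. ennreal (dist (\<gamma> (ts ! i)) (\<gamma> (ts ! Suc i))))"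
  by (induction \<gamma> ts rule: chain_length.induct) (simp_all add: sum.lessThan_Suc_shift del: sum.lessThan_Suc sum_ennreal)

lemma curve_length_eq_chain:
  "curve_length \<gamma> a b = (SUP ts\<in>{ts. sorted ts \<and> set ts \<subseteq> {a..b}}. chain_length \<gamma> ts)"
  unfolding curve_length_def chain_length_eq_sum ..

lemma chain_length_append:
  "chain_length \<gamma> (xs @ b # ys) = chain_length \<gamma> (xs @ [b]) + chain_length \<gamma> (b # ys)"
  by (induction \<gamma> xs rule: chain_length.induct) (simp_all add: add.assoc)

lemma chain_length_Cons_le: "chain_length \<gamma> xs \<le> chain_length \<gamma> (b # xs)"
  by (cases xs) auto

lemma chain_length_skip:
  "chain_length \<gamma> (x # ys) \<le> ennreal (dist (\<gamma> x) (\<gamma> b)) + chain_length \<gamma> (b # ys)"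
proof (cases ys)
  case (Cons y zs)
  have "ennreal (dist (\<gamma> x) (\<gamma> y)) \<le> ennreal (dist (\<gamma> x) (\<gamma> b)) + ennreal (dist (\<gamma> b) (\<gamma> y))"
    by (simp add: dist_triangle flip: ennreal_plus)
  then show ?thesis using Cons by (simp add: add.assoc[symmetric] add_right_mono)
qed simp

text \<open>The triangle inequality at the inserted point; at an end of the list a nonnegative term
  is added.\<close>

lemma chain_length_insert: "chain_length \<gamma> (xs @ ys) \<le> chain_length \<gamma> (xs @ b # ys)"
proof (induction \<gamma> xs rule: chain_length.induct)
  case (1 \<gamma> x y zs)
  then show ?case by (simp add: add_left_mono)
next
  case ("2_1" \<gamma>)
  then show ?case by (simp add: chain_length_Cons_le)
next
  case ("2_2" \<gamma> v)
  then show ?case by (simp add: chain_length_skip)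
qed

lemma chain_length_le_curve_length:
  "sorted ts \<Longrightarrow> set ts \<subseteq> {a..b} \<Longrightarrow> chain_length \<gamma> ts \<le> curve_length \<gamma> a b"
  unfolding curve_length_eq_chain by (rule SUP_upper) auto

text \<open>In a sorted list the two filters are a prefix and a suffix, so \<open>b\<close> can be
  inserted between them and the chain cut there.\<close>

lemma chain_length_split:
  assumes "sorted ts"
  shows "chain_length \<gamma> ts \<le> chain_length \<gamma> (filter (\<lambda>t. t \<le> b) ts @ [b])
           + chain_length \<gamma> (b # filter (\<lambda>t. \<not> t \<le> b) ts)"
proof -
  have "ts = filter (\<lambda>t. t \<le> b) ts @ filter (\<lambda>t. \<not> t \<le> b) ts"
    using assms
  proof (induction ts)
    case (Cons x xs)
    show ?case
    proof (cases "x \<le> b")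
      case False
      then have "filter (\<lambda>t. t \<le> b) xs = []" "filter (\<lambda>t. \<not> t \<le> b) xs = xs"
        using Cons.prems by (auto simp: filter_empty_conv filter_id_conv)
      then show ?thesis using False by simp
    qed (use Cons in simp)
  qed simp
  then show ?thesis
    by (metis chain_length_append chain_length_insert)
qed

text \<open>Chains on \<open>{a..c}\<close> are cut at \<open>b\<close> for one direction and joined
  through \<open>b\<close> for the other. The suprema are added one at a time, which needs nonempty
  index sets; \<open>[]\<close> is always a member.\<close>

lemma curve_length_add:
  assumes "a \<le> b" "b \<le> c"
  shows "curve_length \<gamma> a c = curve_length \<gamma> a b + curve_length \<gamma> b c"
proof (rule antisym)
  show "curve_length \<gamma> a c \<le> curve_length \<gamma> a b + curve_length \<gamma> b c"
    unfolding curve_length_eq_chain[of _ a c]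
  proof (rule SUP_least, clarify)
    fix ts assume ts: "sorted ts" "set ts \<subseteq> {a..c}"
    show "chain_length \<gamma> ts \<le> curve_length \<gamma> a b + curve_length \<gamma> b c"
      by (rule order_trans[OF chain_length_split[OF ts(1), of \<gamma> b] add_mono];
          rule chain_length_le_curve_length)
         (use ts assms in \<open>auto simp: sorted_append sorted_wrt_filter\<close>)
  qed
  show "curve_length \<gamma> a b + curve_length \<gamma> b c \<le> curve_length \<gamma> a c"
  proof -
    let ?S = "\<lambda>a b. {ts. sorted ts \<and> set ts \<subseteq> {a..b::real}}"
    have ne: "?S x y \<noteq> {}" for x y
      by (rule ex_in_conv[THEN iffD1], rule exI[of _ "[]"]) simp
    have "chain_length \<gamma> xs + chain_length \<gamma> ys \<le> curve_length \<gamma> a c"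
      if "xs \<in> ?S a b" "ys \<in> ?S b c" for xs ys
    proof -
      have "chain_length \<gamma> xs + chain_length \<gamma> ys \<le> chain_length \<gamma> (xs @ b # ys)"
        using chain_length_insert[of \<gamma> xs "[]" b] chain_length_Cons_le[of \<gamma> ys b]
        unfolding chain_length_append[of \<gamma> xs b ys] by (simp add: add_mono)
      also have "\<dots> \<le> curve_length \<gamma> a c"
      proof (rule chain_length_le_curve_length)
        have *: "\<forall>x\<in>set xs. a \<le> x \<and> x \<le> b" "\<forall>y\<in>set ys. b \<le> y \<and> y \<le> c"
          using that by auto
        then have "\<forall>x\<in>set xs. \<forall>y\<in>set ys. x \<le> y" by force
        with * show "sorted (xs @ b # ys)"
          using that by (simp add: sorted_append)
        show "set (xs @ b # ys) \<subseteq> {a..c}"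
          using * assms by force
      qed
      finally show ?thesis .
    qed
    then have "chain_length \<gamma> xs + curve_length \<gamma> b c \<le> curve_length \<gamma> a c" if "xs \<in> ?S a b" for xs
      unfolding curve_length_eq_chain[of _ b c] ennreal_SUP_add_right[OF ne]
      using that by (intro SUP_least) auto
    then show ?thesis
      unfolding curve_length_eq_chain[of _ a b] ennreal_SUP_add_left[OF ne, symmetric]
      by (intro SUP_least) auto
  qed
qed

lemma dist_le_curve_length: "a \<le> b \<Longrightarrow> ennreal (dist (\<gamma> a) (\<gamma> b)) \<le> curve_length \<gamma> a b"
  using chain_length_le_curve_length[of "[a, b]" a b \<gamma>] by simp

lemma curve_length_mono:
  assumes "a \<le> a'" "b' \<le> b"
  shows "curve_length \<gamma> a' b' \<le> curve_length \<gamma> a b"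
  unfolding curve_length_eq_chain by (rule SUP_subset_mono) (use assms in auto)

text \<open>For \<open>c > 0\<close> the affine map is a bijection between the sorted lists in the
  two intervals. The case \<open>c = 0\<close> is kept because \<open>subcurve a b\<close> is also
  used with \<open>a = b\<close>.\<close>

lemma curve_length_affine:
  assumes "0 \<le> c"
  shows "curve_length (\<lambda>t. \<gamma> (a + c * t)) s t = curve_length \<gamma> (a + c * s) (a + c * t)"
proof (cases "c = 0")
  case True
  have "chain_length (\<lambda>t. \<gamma> (a + c * t)) ts = 0" for ts
    by (induction ts rule: induct_list012) (simp_all add: True)
  moreover have "chain_length \<gamma> ts = 0" if "set ts \<subseteq> {a}" for ts
    using that by (induction ts rule: induct_list012) simp_all
  moreover have "(SUP ts\<in>S. 0::ennreal) = 0" for S :: "real list set"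
    by (rule antisym[OF SUP_least]) simp_all
  ultimately show ?thesis
    unfolding curve_length_eq_chain by (simp add: True)
next
  case False
  then have c: "c > 0" using assms by simp
  have *: "chain_length (\<lambda>t. \<gamma> (a + c * t)) ts = chain_length \<gamma> (map (\<lambda>t. a + c * t) ts)" for ts
    by (induction ts rule: induct_list012) simp_all
  have "(\<lambda>ts. map (\<lambda>t. a + c * t) ts) ` {ts. sorted ts \<and> set ts \<subseteq> {s..t}} =
        {ts. sorted ts \<and> set ts \<subseteq> {a + c * s..a + c * t}}" (is "?f ` ?A = ?B")
  proof (intro equalityI subsetI)
    fix ts assume "ts \<in> ?B"
    moreover have "ts = ?f (map (\<lambda>t. (t - a) / c) ts)"
      using c by (simp add: map_idI)
    moreover have "map (\<lambda>t. (t - a) / c) ts \<in> ?A" if "ts \<in> ?B"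
      using that c by (auto simp: sorted_map field_simps elim!: sorted_wrt_mono_rel[rotated]
          intro: divide_right_mono)
    ultimately show "ts \<in> ?f ` ?A" by blast
  next
    fix us assume "us \<in> ?f ` ?A"
    then obtain ts where ts: "us = ?f ts" "sorted ts" "set ts \<subseteq> {s..t}" by blast
    then show "us \<in> ?B"
      using c by (auto simp: sorted_map elim!: sorted_wrt_mono_rel[rotated])
  qed
  then show ?thesis
    unfolding curve_length_eq_chain * by (metis (no_types, lifting) image_image SUP_cong)
qed

text \<open>Counting \<open>length ts\<close> steps instead of one fewer wastes one
  \<open>\<eta>\<close> but avoids subtraction of natural numbers. Serves the continuity of
  \<open>len\<close>.\<close>

lemma chain_length_small:
  assumes "\<And>s t. s \<in> set ts \<Longrightarrow> t \<in> set ts \<Longrightarrow> dist (\<gamma> s) (\<gamma> t) \<le> \<eta>" "0 \<le> \<eta>"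
  shows "chain_length \<gamma> ts \<le> ennreal (real (length ts) * \<eta>)"
  using assms
proof (induction \<gamma> ts rule: chain_length.induct)
  case (1 \<gamma> x y zs)
  have "chain_length \<gamma> (x # y # zs) \<le> ennreal \<eta> + ennreal (length (y # zs) * \<eta>)"
    using 1 by (auto intro!: add_mono ennreal_leI simp del: length_Cons)
  also have "\<dots> = ennreal (length (x # y # zs) * \<eta>)"
    using 1(3) by (simp add: algebra_simps flip: ennreal_plus)
  finally show ?case .
qed simp_all

locale rectifiable =
  fixes \<gamma> :: "real \<Rightarrow> 'a::metric_space"
  assumes rect: "rectifiable_curve \<gamma>"
begin

lemma continuous_curve: "continuous_on {0..1} \<gamma>"
  using rect by (simp add: rectifiable_curve_def path_def)

definition len :: "real \<Rightarrow> real" where "len t = enn2real (curve_length \<gamma> 0 t)"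

lemma curve_length_finite: "0 \<le> a \<Longrightarrow> b \<le> 1 \<Longrightarrow> curve_length \<gamma> a b < \<infinity>"
  using curve_length_mono[of 0 a b 1 \<gamma>] rect unfolding rectifiable_curve_def
  by (auto intro: le_less_trans)

lemma ennreal_len: "0 \<le> t \<Longrightarrow> t \<le> 1 \<Longrightarrow> ennreal (len t) = curve_length \<gamma> 0 t"
  unfolding len_def using curve_length_finite[of 0 t] by simp

lemma len_nonneg: "0 \<le> len t"
  by (simp add: len_def)

lemma curve_length_eq_len_diff:
  assumes "0 \<le> a" "a \<le> b" "b \<le> 1"
  shows "curve_length \<gamma> a b = ennreal (len b - len a)" "len a \<le> len b"
proof -
  have *: "ennreal (len b) = ennreal (len a) + curve_length \<gamma> a b"
    using assms curve_length_add[of 0 a b \<gamma>] by (simp add: ennreal_len)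
  then have "ennreal (len a) \<le> ennreal (len b)" by simp
  then show "len a \<le> len b" by (simp add: ennreal_le_iff len_nonneg)
  show "curve_length \<gamma> a b = ennreal (len b - len a)"
    using * len_nonneg[of a] by (simp flip: ennreal_minus)
qed

lemma dist_le_len:
  assumes "0 \<le> a" "a \<le> b" "b \<le> 1"
  shows "dist (\<gamma> a) (\<gamma> b) \<le> len b - len a"
  using dist_le_curve_length[of a b \<gamma>] curve_length_eq_len_diff[OF assms] assms
  by (simp add: ennreal_le_iff)

lemma dist_le_abs_len:
  assumes "s \<in> {0..1}" "t \<in> {0..1}"
  shows "dist (\<gamma> s) (\<gamma> t) \<le> \<bar>len s - len t\<bar>"
proof (cases s t rule: linorder_le_cases)
  case le
  then show ?thesis using dist_le_len[of s t] assms by force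
next
  case ge
  then have "dist (\<gamma> t) (\<gamma> s) \<le> len s - len t" using dist_le_len[of t s] assms by force
  then show ?thesis by (simp add: dist_commute)
qed

lemma len_0: "len 0 = 0"
proof -
  have "chain_length \<gamma> ts = 0" if "set ts \<subseteq> {0}" for ts
    using that by (induction ts rule: induct_list012) simp_all
  then have "curve_length \<gamma> 0 0 \<le> 0"
    unfolding curve_length_eq_chain by (intro SUP_least) auto
  then show ?thesis by (simp add: len_def)
qed

text \<open>
  A near-optimal chain for the whole curve, refined by \<open>a\<close> and \<open>b\<close>, is near-optimal on \<open>{a..b}\<close>;
  there it has boundedly many steps, each of them small.
\<close>

lemma continuous_len: "continuous_on {0..1} len"
proof (rule continuous_on_iff[THEN iffD2], intro ballI allI impI)
  fix x e :: real assume x: "x \<in> {0..1}" and e: "0 < e"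
  have "curve_length \<gamma> 0 1 < \<infinity>" by (rule curve_length_finite) auto
  moreover define e' where "e' = e / 2"
  have e': "0 < e'" using e by (simp add: e'_def)
  have "\<exists>ts. (sorted ts \<and> set ts \<subseteq> {0..1}) \<and> curve_length \<gamma> 0 1 \<le> chain_length \<gamma> ts + e'"
  proof (cases "curve_length \<gamma> 0 1 = 0")
    case True
    then show ?thesis by (intro exI[of _ "[]"]) simp
  next
    case False
    then have "curve_length \<gamma> 0 1 - ennreal e' < curve_length \<gamma> 0 1"
      using e' calculation by (intro ennreal_between) (auto simp: zero_less_iff_neq_zero)
    then obtain ts where "sorted ts" "set ts \<subseteq> {0..1}" "curve_length \<gamma> 0 1 - ennreal e' < chain_length \<gamma> ts"
      unfolding curve_length_eq_chain[of \<gamma> 0 1] less_SUP_iff by blast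
    then show ?thesis
      by (metis ennreal_minus_le_iff order.strict_implies_order add.commute)
  qed
  then obtain ts where ts: "sorted ts" "set ts \<subseteq> {0..1}" "curve_length \<gamma> 0 1 \<le> chain_length \<gamma> ts + e'"
    by blast
  \<comment> \<open>The chain \<open>zs\<close> below consists of points of \<open>ts\<close>
    together with \<open>a\<close> and \<open>b\<close>, so \<open>n\<close> bounds its length
    whatever \<open>a\<close> and \<open>b\<close> are, and \<open>\<eta>\<close> can be fixed
    before them.\<close>
  define n where "n = length ts + 2"
  define \<eta> where "\<eta> = e' / (2 * n)"
  have \<eta>: "\<eta> > 0" using e' by (simp add: \<eta>_def n_def)
  have "uniformly_continuous_on {0..1} \<gamma>"
    by (rule compact_uniformly_continuous[OF continuous_curve]) simp
  then obtain d where d: "d > 0" "\<And>s t. s \<in> {0..1} \<Longrightarrow> t \<in> {0..1} \<Longrightarrow> dist t s < d \<Longrightarrow> dist (\<gamma> t) (\<gamma> s) < \<eta>"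
    unfolding uniformly_continuous_on_def using \<eta> by metis
  have small: "len b - len a < e" if ab: "0 \<le> a" "a \<le> b" "b \<le> 1" "b - a < d" for a b
  proof -
    define ys where "ys = filter (\<lambda>t. \<not> t \<le> a) ts"
    define zs where "zs = a # filter (\<lambda>t. t \<le> b) ys @ [b]"
    have ys: "sorted ys" "set ys \<subseteq> {a..1}" using ts(1,2) by (auto simp: ys_def sorted_wrt_filter)
    have "chain_length \<gamma> ts \<le> curve_length \<gamma> 0 a + chain_length \<gamma> (a # ys)"
      using chain_length_split[OF ts(1), of \<gamma> a] ts(1,2) ab
      unfolding ys_def[symmetric]
      by (elim order_trans, intro add_mono chain_length_le_curve_length)
         (auto simp: sorted_append sorted_wrt_filter)
    moreover have "chain_length \<gamma> (a # ys) \<le> chain_length \<gamma> zs + curve_length \<gamma> b 1"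
    proof -
      have "sorted (a # ys)" using ys by auto
      then have "chain_length \<gamma> (a # ys) \<le> chain_length \<gamma> (filter (\<lambda>t. t \<le> b) (a # ys) @ [b])
          + chain_length \<gamma> (b # filter (\<lambda>t. \<not> t \<le> b) (a # ys))"
        by (rule chain_length_split)
      also have "\<dots> \<le> chain_length \<gamma> (filter (\<lambda>t. t \<le> b) (a # ys) @ [b]) + curve_length \<gamma> b 1"
        by (intro add_left_mono chain_length_le_curve_length)
           (use ys ab in \<open>auto simp: sorted_wrt_filter\<close>)
      finally show ?thesis using ab by (simp add: zs_def)
    qed
    moreover have "chain_length \<gamma> zs \<le> ennreal (real (length zs) * \<eta>)"
    proof (intro chain_length_small)
      fix s t assume "s \<in> set zs" "t \<in> set zs"
      then have "s \<in> {a..b}" "t \<in> {a..b}" using ys ab by (auto simp: zs_def)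
      then show "dist (\<gamma> s) (\<gamma> t) \<le> \<eta>"
        using ab d(2)[of t s] by (auto simp: dist_real_def intro!: less_imp_le)
    qed (use \<eta> in simp)
    moreover have "length zs * \<eta> < e'"
    proof -
      have "length zs \<le> n"
        unfolding zs_def ys_def n_def by (auto intro: order_trans[OF length_filter_le])
      then have "length zs * \<eta> \<le> n * \<eta>" using \<eta> by (intro mult_right_mono) auto
      also have "n * \<eta> = e' / 2"
      proof -
        have "real n \<noteq> 0" by (simp add: n_def)
        then show ?thesis by (simp add: \<eta>_def)
      qed
      finally show ?thesis using e' by simp
    qed
    \<comment> \<open>The lengths before \<open>a\<close> and after \<open>b\<close> occur on both
      sides and cancel; \<open>len b - len a\<close> stays below the steps of \<open>zs\<close> plus
      the defect \<open>e'\<close>, each at most \<open>e / 2\<close>.\<close>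
    ultimately have "curve_length \<gamma> 0 1 \<le> curve_length \<gamma> 0 a + (ennreal (length zs * \<eta>) + curve_length \<gamma> b 1) + e'"
      using ts(3) by (meson add_mono add_left_mono add_right_mono order_trans order_refl)
    then have "ennreal (len 1) \<le> ennreal (len a) + (ennreal (length zs * \<eta>) + ennreal (len 1 - len b)) + e'"
      using ab by (simp add: ennreal_len curve_length_eq_len_diff)
    then have "len 1 \<le> len a + (length zs * \<eta> + (len 1 - len b)) + e'"
      using curve_length_eq_len_diff(2)[of b 1] ab \<eta> e' len_nonneg
      by (simp add: ennreal_le_iff flip: ennreal_plus)
    then show ?thesis using \<open>length zs * \<eta> < e'\<close> by (simp add: e'_def)
  qed
  show "\<exists>d>0. \<forall>x'\<in>{0..1}. dist x' x < d \<longrightarrow> dist (len x') (len x) < e"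
  proof (intro exI[of _ d] conjI ballI impI)
    fix y assume "y \<in> {0..1}" "dist y x < d"
    then show "dist (len y) (len x) < e"
      using small[of x y] small[of y x] x curve_length_eq_len_diff(2)[of x y]
        curve_length_eq_len_diff(2)[of y x] e
      by (cases "x \<le> y") (auto simp: dist_real_def abs_if)
  qed (rule d)
qed


lemma len_mono: "0 \<le> a \<Longrightarrow> a \<le> b \<Longrightarrow> b \<le> 1 \<Longrightarrow> len a \<le> len b"
  by (rule curve_length_eq_len_diff)

lemma len_surj:
  assumes "0 \<le> a" "a \<le> b" "b \<le> 1" "len a \<le> s" "s \<le> len b"
  obtains t where "a \<le> t" "t \<le> b" "len t = s"
  using IVT'[of len a s b] assms continuous_on_subset[OF continuous_len, of "{a..b}"] by auto

lemma arclength_param_len: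
  assumes "t \<in> {0..1}"
  shows "arclength_param \<gamma> (len t) = \<gamma> t"
proof -
  define t' where "t' = (SOME t'. t' \<in> {0..1} \<and> curve_length \<gamma> 0 t' = ennreal (len t))"
  have "t' \<in> {0..1} \<and> curve_length \<gamma> 0 t' = ennreal (len t)"
    unfolding t'_def by (rule someI[of _ t]) (use assms ennreal_len in auto)
  then have t': "t' \<in> {0..1}" "len t' = len t"
    using len_nonneg by (auto simp: len_def[of t'])
  have "dist (\<gamma> t') (\<gamma> t) \<le> 0"
    using dist_le_abs_len[OF t'(1) assms] t'(2) by simp
  then show ?thesis
    by (simp add: arclength_param_def t'_def)
qed

lemma dist_arclength_param_le:
  assumes "r \<in> {0..len 1}" "s \<in> {0..len 1}"
  shows "dist (arclength_param \<gamma> r) (arclength_param \<gamma> s) \<le> \<bar>r - s\<bar>"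
proof -
  have *: "\<exists>t\<in>{0..1}. len t = r" if "r \<in> {0..len 1}" for r
    by (rule len_surj[of 0 1 r]) (use that in \<open>auto simp: len_0\<close>)
  then obtain t t' where "t \<in> {0..1}" "t' \<in> {0..1}" "len t = r" "len t' = s"
    using assms by meson
  then show ?thesis
    using dist_le_abs_len[of t t'] arclength_param_len[of t] arclength_param_len[of t'] by simp
qed

lemma continuous_arclength_param: "continuous_on {0..len 1} (arclength_param \<gamma>)"
proof -
  have "1-lipschitz_on {0..len 1} (arclength_param \<gamma>)"
    by (rule lipschitz_onI) (simp_all add: dist_arclength_param_le dist_real_def)
  then show ?thesis by (rule lipschitz_on_continuous_on)
qed

text \<open>The variable runs over the arc length of the whole curve, not of the piece, so that
  adjacent pieces give adjacent intervals of integration.\<close>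

definition arc_integral :: "('a \<Rightarrow> ennreal) \<Rightarrow> real \<Rightarrow> real \<Rightarrow> ennreal" where
  "arc_integral g a b = (\<integral>\<^sup>+s\<in>{len a..len b}. g (arclength_param \<gamma> s) \<partial>lborel)"

lemma curve_integral_eq_arc_integral: "curve_integral \<gamma> g = arc_integral g 0 1"
  unfolding curve_integral_def arc_integral_def len_0 by (simp add: len_def)

lemma arclength_param_in_image:
  assumes "0 \<le> a" "a \<le> b" "b \<le> 1" "s \<in> {len a..len b}"
  shows "arclength_param \<gamma> s \<in> \<gamma> ` {a..b}"
proof -
  obtain t where "a \<le> t" "t \<le> b" "len t = s" using len_surj[of a b s] assms by auto
  then show ?thesis using arclength_param_len[of t] assms by auto
qed

text \<open>\<open>g\<close> is Borel only on \<open>U\<close>; the integrand becomes measurable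
  after restriction to \<open>{len a..len b}\<close>, where the arc length parametrization is
  continuous and stays in \<open>U\<close>.\<close>

lemma arc_integrand_measurable:
  fixes g :: "'a \<Rightarrow> ennreal"
  assumes g: "g \<in> borel_measurable (restrict_space borel U)" and U: "\<gamma> ` {a..b} \<subseteq> U"
    and ab: "0 \<le> a" "a \<le> b" "b \<le> 1"
  shows "(\<lambda>s. g (arclength_param \<gamma> s) * indicator {len a..len b} s) \<in> borel_measurable borel"
proof -
  have sub: "{len a..len b} \<subseteq> {0..len 1}"
    using ab len_nonneg[of a] len_mono[of b 1] by auto
  have "arclength_param \<gamma> \<in> borel_measurable (restrict_space borel {len a..len b})"
    by (rule borel_measurable_continuous_on_restrict)
       (rule continuous_on_subset[OF continuous_arclength_param sub])
  then have "arclength_param \<gamma> \<in> measurable (restrict_space borel {len a..len b}) (restrict_space borel U)"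
    by (rule measurable_restrict_space2[rotated])
       (use arclength_param_in_image[OF ab] U in \<open>auto simp: space_restrict_space\<close>)
  from measurable_compose[OF this g] show ?thesis
    using borel_measurable_restrict_space_iff_ennreal[of "{len a..len b}" borel
      "\<lambda>s. g (arclength_param \<gamma> s)"] by simp
qed

lemma arc_integral_mono:
  assumes "\<And>x. x \<in> \<gamma> ` {a..b} \<Longrightarrow> g x \<le> h x" "0 \<le> a" "a \<le> b" "b \<le> 1"
  shows "arc_integral g a b \<le> arc_integral h a b"
  unfolding arc_integral_def
  by (intro nn_integral_mono)
     (use assms arclength_param_in_image[of a b] in \<open>auto simp: indicator_def\<close>)

lemma arc_integral_mono_interval:
  assumes "0 \<le> a'" "a' \<le> a" "a \<le> b" "b \<le> b'" "b' \<le> 1"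
  shows "arc_integral g a b \<le> arc_integral g a' b'"
  unfolding arc_integral_def
  by (intro nn_integral_mono)
     (use len_mono[of a' a] len_mono[of b b'] assms in \<open>auto simp: indicator_def\<close>)

text \<open>The values \<open>len a\<close> and \<open>len b\<close> are Lebesgue null, and every
  arc length strictly between them is attained strictly inside. This serves pieces in
  \<open>upper_gradient_min\<close> at whose end points \<open>h < t\<close> may fail.\<close>

lemma arc_integral_cong_interior:
  assumes "\<And>t. a < t \<Longrightarrow> t < b \<Longrightarrow> g (\<gamma> t) = h (\<gamma> t)" "0 \<le> a" "a \<le> b" "b \<le> 1"
  shows "arc_integral g a b = arc_integral h a b"
  unfolding arc_integral_def
proof (rule nn_integral_cong_AE)
  have "AE s in lborel. s \<noteq> len a" "AE s in lborel. s \<noteq> len b"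
    by (rule AE_lborel_singleton)+
  then show "AE s in lborel. g (arclength_param \<gamma> s) * indicator {len a..len b} s =
               h (arclength_param \<gamma> s) * indicator {len a..len b} s"
  proof eventually_elim
    case (elim s)
    show ?case
    proof (cases "s \<in> {len a..len b}")
      case True
      then obtain t where t: "a \<le> t" "t \<le> b" "len t = s" using len_surj[of a b s] assms by auto
      then have "a < t" "t < b" using elim by (auto simp: order_le_less)
      then show ?thesis using assms(1)[of t] t arclength_param_len[of t] assms by auto
    qed simp
  qed
qed

lemma arc_integral_add:
  assumes g: "g \<in> borel_measurable (restrict_space borel U)" and U: "\<gamma> ` {a..c} \<subseteq> U"
    and abc: "0 \<le> a" "a \<le> b" "b \<le> c" "c \<le> 1"
  shows "arc_integral g a b + arc_integral g b c = arc_integral g a c"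
proof -
  have [measurable]: "(\<lambda>s. g (arclength_param \<gamma> s) * indicator {len a..len b} s) \<in> borel_measurable borel"
    "(\<lambda>s. g (arclength_param \<gamma> s) * indicator {len b..len c} s) \<in> borel_measurable borel"
    by (rule arc_integrand_measurable[OF g]; use U abc in \<open>auto simp: image_subset_iff\<close>)+
  have "len a \<le> len b" "len b \<le> len c" using len_mono abc by auto
  have "arc_integral g a b + arc_integral g b c =
    (\<integral>\<^sup>+s. g (arclength_param \<gamma> s) * indicator {len a..len b} s
         + g (arclength_param \<gamma> s) * indicator {len b..len c} s \<partial>lborel)"
    unfolding arc_integral_def
    by (rule nn_integral_add[symmetric]) simp_all
  also have "\<dots> = arc_integral g a c"
    unfolding arc_integral_def
  proof (rule nn_integral_cong_AE)
    show "AE s in lborel. g (arclength_param \<gamma> s) * indicator {len a..len b} s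
         + g (arclength_param \<gamma> s) * indicator {len b..len c} s
         = g (arclength_param \<gamma> s) * indicator {len a..len c} s"
      using AE_lborel_singleton[of "len b"]
      by eventually_elim (use \<open>len a \<le> len b\<close> \<open>len b \<le> len c\<close> in \<open>auto simp: indicator_def\<close>)
  qed
  finally show ?thesis .
qed

definition subcurve :: "real \<Rightarrow> real \<Rightarrow> real \<Rightarrow> 'a" where
  "subcurve a b t = \<gamma> (a + (b - a) * t)"

lemma subcurve_arg:
  fixes a b t :: real
  assumes "a \<le> b" "t \<in> {0..1}"
  shows "a + (b - a) * t \<in> {a..b}"
  using assms mult_left_mono[of t 1 "b - a"] by auto

lemma path_image_subcurve: "a \<le> b \<Longrightarrow> path_image (subcurve a b) \<subseteq> \<gamma> ` {a..b}"
  using subcurve_arg by (auto simp: path_image_def subcurve_def)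

lemma rectifiable_subcurve:
  assumes ab: "0 \<le> a" "a \<le> b" "b \<le> 1"
  shows "rectifiable_curve (subcurve a b)"
proof -
  have "continuous_on {0..1} (subcurve a b)"
    unfolding subcurve_def
  proof (rule continuous_on_compose2[OF continuous_curve])
    show "continuous_on {0..1} (\<lambda>t. a + (b - a) * t)" by (intro continuous_intros)
    show "(\<lambda>t. a + (b - a) * t) ` {0..1} \<subseteq> {0..1}"
      using subcurve_arg[OF ab(2)] ab by fastforce
  qed
  moreover have "curve_length (subcurve a b) 0 1 < \<infinity>"
    using curve_length_affine[of "b - a" \<gamma> a 0 1] curve_length_finite[of a b] ab
    by (simp add: subcurve_def[abs_def])
  ultimately show ?thesis by (simp add: rectifiable_curve_def path_def)
qed

text \<open>Arc length along the piece is that of the whole curve shifted by \<open>len a\<close>,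
  so the two integrals differ by a translation of the variable.\<close>

lemma curve_integral_subcurve:
  assumes g: "g \<in> borel_measurable (restrict_space borel U)" and U: "\<gamma> ` {a..b} \<subseteq> U"
    and ab: "0 \<le> a" "a \<le> b" "b \<le> 1"
  shows "curve_integral (subcurve a b) g = arc_integral g a b"
proof -
  interpret sub: rectifiable "subcurve a b"
    by (rule rectifiable.intro) (rule rectifiable_subcurve[OF ab])
  have len: "sub.len t = len (a + (b - a) * t) - len a" if "t \<in> {0..1}" for t
    unfolding sub.len_def
    using curve_length_affine[of "b - a" \<gamma> a 0 t] subcurve_arg[OF ab(2) that] ab
      curve_length_eq_len_diff[of a "a + (b - a) * t"]
    by (simp add: subcurve_def[abs_def])
  have param: "arclength_param (subcurve a b) s = arclength_param \<gamma> (len a + s)"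
    if s: "s \<in> {0..len b - len a}" for s
  proof -
    obtain t where "0 \<le> t" "t \<le> 1" and t': "sub.len t = s"
      by (rule sub.len_surj[of 0 1 s]) (use s len[of 1] in \<open>simp_all add: sub.len_0\<close>)
    then have t: "t \<in> {0..1}" "sub.len t = s" by auto
    then have "arclength_param (subcurve a b) s = \<gamma> (a + (b - a) * t)"
      using sub.arclength_param_len[of t] by (simp add: subcurve_def)
    also have "\<dots> = arclength_param \<gamma> (len (a + (b - a) * t))"
      using arclength_param_len[of "a + (b - a) * t"] subcurve_arg[OF ab(2) t(1)] ab by simp
    finally show ?thesis using t(2) len[OF t(1)] by (metis add.commute diff_add_cancel)
  qed
  have "curve_integral (subcurve a b) g =
      (\<integral>\<^sup>+s. g (arclength_param \<gamma> (len a + s)) * indicator {0..len b - len a} s \<partial>lborel)"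
    unfolding sub.curve_integral_eq_arc_integral sub.arc_integral_def
  proof (intro nn_integral_cong)
    have "sub.len 1 = len b - len a" using len[of 1] by simp
    then show "g (arclength_param (subcurve a b) s) * indicator {sub.len 0..sub.len 1} s
        = g (arclength_param \<gamma> (len a + s)) * indicator {0..len b - len a} s" for s
      using param[of s] by (simp add: sub.len_0 indicator_def)
  qed
  also have "\<dots> = (\<integral>\<^sup>+s. g (arclength_param \<gamma> (len a + 1 * s)) * indicator {len a..len b} (len a + 1 * s) \<partial>lborel)"
    by (intro nn_integral_cong) (auto simp: indicator_def)
  also have "\<dots> = arc_integral g a b"
    unfolding arc_integral_def
    by (subst nn_integral_real_affine[OF arc_integrand_measurable[OF g U ab], of 1 "len a"]) simp_all
  finally show ?thesis .
qed

end

section \<open>Upper gradients\<close>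

context rectifiable begin

lemma arc_integral_plus:
  assumes "g \<in> borel_measurable (restrict_space borel U)" "h \<in> borel_measurable (restrict_space borel U)"
    "\<gamma> ` {a..b} \<subseteq> U" "0 \<le> a" "a \<le> b" "b \<le> 1"
  shows "arc_integral (\<lambda>x. g x + h x) a b = arc_integral g a b + arc_integral h a b"
  unfolding arc_integral_def
  by (subst nn_integral_add[symmetric])
     (use arc_integrand_measurable[of g U a b] arc_integrand_measurable[of h U a b] assms in
       \<open>simp_all add: distrib_right\<close>)

lemma arc_integral_cmult:
  assumes "g \<in> borel_measurable (restrict_space borel U)"
    "\<gamma> ` {a..b} \<subseteq> U" "0 \<le> a" "a \<le> b" "b \<le> 1"
  shows "arc_integral (\<lambda>x. c * g x) a b = c * arc_integral g a b"
  unfolding arc_integral_def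
  by (subst nn_integral_cmult[symmetric])
     (use arc_integrand_measurable[of g U a b] assms in \<open>simp_all add: mult.assoc\<close>)

lemma arc_integral_const:
  assumes "0 \<le> a" "a \<le> b" "b \<le> 1"
  shows "arc_integral (\<lambda>x. c) a b = c * ennreal (len b - len a)"
  unfolding arc_integral_def using len_mono[OF assms]
  by (simp add: nn_integral_cmult_indicator)

text \<open>The inequality passes from two adjacent intervals to their union and holds on short
  intervals around each parameter, so the bisection principle \<open>Bolzano\<close> extends it to
  \<open>{0..1}\<close>.\<close>

lemma oscillation_le_arc_integral_local:
  fixes h :: "'a \<Rightarrow> real"
  assumes g: "g \<in> borel_measurable (restrict_space borel U)" and U: "path_image \<gamma> \<subseteq> U"
    and loc: "\<And>x. x \<in> {0..1} \<Longrightarrow> \<exists>d>0. \<forall>a b. 0 \<le> a \<and> a \<le> x \<and> x \<le> b \<and> b \<le> 1 \<and> b - a < d \<longrightarrow>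
          ennreal \<bar>h (\<gamma> a) - h (\<gamma> b)\<bar> \<le> arc_integral g a b"
  shows "ennreal \<bar>h (pathstart \<gamma>) - h (pathfinish \<gamma>)\<bar> \<le> curve_integral \<gamma> g"
proof -
  define P where "P a b \<longleftrightarrow> (0 \<le> a \<and> b \<le> 1 \<longrightarrow>
    ennreal \<bar>h (\<gamma> a) - h (\<gamma> b)\<bar> \<le> arc_integral g a b)" for a b
  have "P 0 1"
  proof (rule Bolzano[of 0 1 P])
    fix a b c assume trans: "P a b" "P b c" "a \<le> b" "b \<le> c"
    show "P a c"
      unfolding P_def
    proof
      assume ac: "0 \<le> a \<and> c \<le> 1"
      have "ennreal \<bar>h (\<gamma> a) - h (\<gamma> c)\<bar> \<le> ennreal \<bar>h (\<gamma> a) - h (\<gamma> b)\<bar> + ennreal \<bar>h (\<gamma> b) - h (\<gamma> c)\<bar>"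
        by (simp flip: ennreal_plus)
      also have "\<dots> \<le> arc_integral g a b + arc_integral g b c"
        using trans ac by (intro add_mono) (auto simp: P_def)
      also have "\<dots> = arc_integral g a c"
        by (rule arc_integral_add[OF g]) (use U trans ac in \<open>auto simp: path_image_def\<close>)
      finally show "ennreal \<bar>h (\<gamma> a) - h (\<gamma> c)\<bar> \<le> arc_integral g a c" .
    qed
  next
    fix x :: real assume "0 \<le> x" "x \<le> 1"
    then show "\<exists>d>0. \<forall>a b. a \<le> x \<and> x \<le> b \<and> b - a < d \<longrightarrow> P a b"
      unfolding P_def using loc[of x] by simp meson
  qed simp
  then show ?thesis
    by (simp add: P_def pathstart_def pathfinish_def curve_integral_eq_arc_integral)
qed

lemma curve_window:
  assumes "open N" "\<gamma> x \<in> N" "x \<in> {0..1}"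
  shows "\<exists>d>0. \<forall>a b. 0 \<le> a \<and> a \<le> x \<and> x \<le> b \<and> b \<le> 1 \<and> b - a < d \<longrightarrow> \<gamma> ` {a..b} \<subseteq> N"
proof -
  obtain e where e: "e > 0" "ball (\<gamma> x) e \<subseteq> N" using assms openE by blast
  obtain d where d: "d > 0" "\<And>y. y \<in> {0..1} \<Longrightarrow> dist y x < d \<Longrightarrow> dist (\<gamma> y) (\<gamma> x) < e"
    using continuous_curve e(1) assms(3) unfolding continuous_on_iff by meson
  have "\<gamma> y \<in> N" if "0 \<le> a" "a \<le> x" "x \<le> b" "b \<le> 1" "b - a < d" "y \<in> {a..b}" for a b y
    using d(2)[of y] that e(2) by (auto simp: dist_real_def dist_commute subset_eq)
  then show ?thesis using d(1) by (intro exI[of _ d]) auto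
qed

end

text \<open>Real values never meet the infinite case, and on a constant curve the left side is
  zero.\<close>

lemma upper_gradient_real_iff:
  "upper_gradient U (\<lambda>x. ereal (h x)) g \<longleftrightarrow>
     g \<in> borel_measurable (restrict_space borel U) \<and>
     (\<forall>\<gamma>. rectifiable_curve \<gamma> \<and> path_image \<gamma> \<subseteq> U \<longrightarrow>
        ennreal \<bar>h (pathstart \<gamma>) - h (pathfinish \<gamma>)\<bar> \<le> curve_integral \<gamma> g)"
proof -
  have "ennreal \<bar>h (pathstart \<gamma>) - h (pathfinish \<gamma>)\<bar> \<le> curve_integral \<gamma> g"
    if "\<not> (\<exists>t\<in>{0..1}. \<gamma> t \<noteq> \<gamma> 0)" for \<gamma> :: "real \<Rightarrow> 'a"
  proof -
    have "\<gamma> 1 = \<gamma> 0" using that by (metis atLeastAtMost_iff order_refl zero_le_one)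
    then show ?thesis by (simp add: pathstart_def pathfinish_def)
  qed
  moreover have "e2ennreal (ereal r) = ennreal r" for r
    by (simp add: ennreal_def)
  ultimately show ?thesis
    unfolding upper_gradient_def Let_def by simp blast
qed

lemma upper_gradientD:
  assumes "upper_gradient U (\<lambda>x. ereal (h x)) g"
  shows "g \<in> borel_measurable (restrict_space borel U)"
    and "\<lbrakk>rectifiable_curve \<gamma>; \<gamma> ` {a..b} \<subseteq> U; 0 \<le> a; a \<le> b; b \<le> 1\<rbrakk> \<Longrightarrow>
      ennreal \<bar>h (\<gamma> a) - h (\<gamma> b)\<bar> \<le> rectifiable.arc_integral \<gamma> g a b"
proof -
  show g: "g \<in> borel_measurable (restrict_space borel U)"
    using assms upper_gradient_real_iff by blast
  assume r: "rectifiable_curve \<gamma>" "\<gamma> ` {a..b} \<subseteq> U" "0 \<le> a" "a \<le> b" "b \<le> 1"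
  interpret rectifiable \<gamma> by unfold_locales fact
  have "ennreal \<bar>h (pathstart (subcurve a b)) - h (pathfinish (subcurve a b))\<bar>
      \<le> curve_integral (subcurve a b) g"
    using assms rectifiable_subcurve[of a b] path_image_subcurve[of a b] r
    unfolding upper_gradient_real_iff by blast
  then show "ennreal \<bar>h (\<gamma> a) - h (\<gamma> b)\<bar> \<le> arc_integral g a b"
    using curve_integral_subcurve[OF g] r
    by (simp add: pathstart_def pathfinish_def subcurve_def)
qed

lemma upper_gradientI_oscillation:
  assumes "g \<in> borel_measurable (restrict_space borel U)"
    and "\<And>\<gamma> x. rectifiable_curve \<gamma> \<Longrightarrow> path_image \<gamma> \<subseteq> U \<Longrightarrow> x \<in> {0..1} \<Longrightarrow>
      \<exists>d>0. \<forall>a b. 0 \<le> a \<and> a \<le> x \<and> x \<le> b \<and> b \<le> 1 \<and> b - a < d \<longrightarrow>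
          ennreal \<bar>h (\<gamma> a) - h (\<gamma> b)\<bar> \<le> rectifiable.arc_integral \<gamma> g a b"
  shows "upper_gradient U (\<lambda>x. ereal (h x)) g"
  unfolding upper_gradient_real_iff
  using assms rectifiable.oscillation_le_arc_integral_local[OF rectifiable.intro] by blast

lemma borel_measurable_restrict_subset:
  assumes "g \<in> borel_measurable (restrict_space borel U)" "V \<subseteq> U"
  shows "g \<in> borel_measurable (restrict_space borel V)"
proof -
  have "sets (restrict_space (restrict_space borel U) V) = sets (restrict_space borel V)"
    using assms(2) by (simp add: sets_restrict_restrict_space Int_absorb1)
  then show ?thesis
    using measurable_restrict_space1[OF assms(1), of V] measurable_cong_sets by blast
qed

lemma upper_gradient_subset:
  assumes "upper_gradient U (\<lambda>x. ereal (h x)) g" "V \<subseteq> U"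
  shows "upper_gradient V (\<lambda>x. ereal (h x)) g"
  using assms borel_measurable_restrict_subset unfolding upper_gradient_real_iff
  by (meson order_trans)

lemma upper_gradient_mono:
  assumes "upper_gradient U (\<lambda>x. ereal (h x)) g"
    "g' \<in> borel_measurable (restrict_space borel U)" "\<And>x. x \<in> U \<Longrightarrow> g x \<le> g' x"
    "\<And>x. x \<in> U \<Longrightarrow> h x = h' x"
  shows "upper_gradient U (\<lambda>x. ereal (h' x)) g'"
  unfolding upper_gradient_real_iff
proof (intro conjI assms allI impI; (elim conjE)?)
  fix \<gamma> :: "real \<Rightarrow> 'a" assume r: "rectifiable_curve \<gamma>" "path_image \<gamma> \<subseteq> U"
  then interpret rectifiable \<gamma> by unfold_locales
  have "ennreal \<bar>h (pathstart \<gamma>) - h (pathfinish \<gamma>)\<bar> \<le> curve_integral \<gamma> g"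
    using assms(1) r unfolding upper_gradient_real_iff by blast
  also have "\<dots> \<le> curve_integral \<gamma> g'"
    unfolding curve_integral_eq_arc_integral
    by (rule arc_integral_mono) (use r assms(3) in \<open>auto simp: path_image_def\<close>)
  finally show "ennreal \<bar>h' (pathstart \<gamma>) - h' (pathfinish \<gamma>)\<bar> \<le> curve_integral \<gamma> g'"
    using r(2) assms(4) pathstart_in_path_image[of \<gamma>] pathfinish_in_path_image[of \<gamma>] by (simp add: subset_eq)
qed

text \<open>A curve in \<open>U\<close> stays in \<open>N\<close> near each parameter, so the
  oscillation estimate holds on short pieces and adds up along the curve. The gluing constructions
  below rest on this.\<close>

lemma upper_gradientI_local:
  assumes g: "g \<in> borel_measurable (restrict_space borel U)"
    and loc: "\<And>x. x \<in> U \<Longrightarrow> \<exists>N. open N \<and> x \<in> N \<and> upper_gradient (N \<inter> U) (\<lambda>x. ereal (h x)) g"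
  shows "upper_gradient U (\<lambda>x. ereal (h x)) g"
proof (rule upper_gradientI_oscillation[OF g])
  fix \<gamma> and x :: real assume r: "rectifiable_curve \<gamma>" "path_image \<gamma> \<subseteq> U" "x \<in> {0..1}"
  then interpret rectifiable \<gamma> by unfold_locales
  have "\<gamma> x \<in> U" using r by (auto simp: path_image_def)
  then obtain N where N: "open N" "\<gamma> x \<in> N" "upper_gradient (N \<inter> U) (\<lambda>x. ereal (h x)) g"
    using loc by blast
  obtain d where d: "d > 0" "\<And>a b. 0 \<le> a \<and> a \<le> x \<and> x \<le> b \<and> b \<le> 1 \<and> b - a < d \<Longrightarrow> \<gamma> ` {a..b} \<subseteq> N"
    using curve_window[OF N(1,2) r(3)] by blast
  have "ennreal \<bar>h (\<gamma> a) - h (\<gamma> b)\<bar> \<le> arc_integral g a b"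
    if "0 \<le> a \<and> a \<le> x \<and> x \<le> b \<and> b \<le> 1 \<and> b - a < d" for a b
    by (rule upper_gradientD(2)[OF N(3) r(1)]) (use d(2)[OF that] r(2) that in \<open>auto simp: path_image_def\<close>)
  then show "\<exists>d>0. \<forall>a b. 0 \<le> a \<and> a \<le> x \<and> x \<le> b \<and> b \<le> 1 \<and> b - a < d \<longrightarrow>
      ennreal \<bar>h (\<gamma> a) - h (\<gamma> b)\<bar> \<le> arc_integral g a b"
    using d(1) by blast
qed

lemma upper_gradient_add:
  assumes "upper_gradient U (\<lambda>x. ereal (h x)) g" "upper_gradient U (\<lambda>x. ereal (h' x)) g'"
  shows "upper_gradient U (\<lambda>x. ereal (h x + h' x)) (\<lambda>x. g x + g' x)"
  unfolding upper_gradient_real_iff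
proof (intro conjI allI impI; (elim conjE)?)
  show "(\<lambda>x. g x + g' x) \<in> borel_measurable (restrict_space borel U)"
    using upper_gradientD(1)[OF assms(1)] upper_gradientD(1)[OF assms(2)] by simp
  fix \<gamma> :: "real \<Rightarrow> 'a" assume r: "rectifiable_curve \<gamma>" "path_image \<gamma> \<subseteq> U"
  then interpret rectifiable \<gamma> by unfold_locales
  have "ennreal \<bar>h (pathstart \<gamma>) + h' (pathstart \<gamma>) - (h (pathfinish \<gamma>) + h' (pathfinish \<gamma>))\<bar>
      \<le> ennreal \<bar>h (pathstart \<gamma>) - h (pathfinish \<gamma>)\<bar> + ennreal \<bar>h' (pathstart \<gamma>) - h' (pathfinish \<gamma>)\<bar>"
    by (simp flip: ennreal_plus)
  also have "\<dots> \<le> curve_integral \<gamma> g + curve_integral \<gamma> g'"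
    using assms r unfolding upper_gradient_real_iff by (intro add_mono) blast+
  also have "\<dots> = curve_integral \<gamma> (\<lambda>x. g x + g' x)"
    unfolding curve_integral_eq_arc_integral
    by (rule arc_integral_plus[symmetric, OF upper_gradientD(1)[OF assms(1)] upper_gradientD(1)[OF assms(2)]])
       (use r in \<open>auto simp: path_image_def\<close>)
  finally show "ennreal \<bar>h (pathstart \<gamma>) + h' (pathstart \<gamma>) - (h (pathfinish \<gamma>) + h' (pathfinish \<gamma>))\<bar>
      \<le> curve_integral \<gamma> (\<lambda>x. g x + g' x)" .
qed

lemma upper_gradient_compose:
  assumes "upper_gradient U (\<lambda>x. ereal (h x)) g" and f: "\<And>s t :: real. \<bar>f s - f t\<bar> \<le> c * \<bar>s - t\<bar>"
  shows "upper_gradient U (\<lambda>x. ereal (f (h x))) (\<lambda>x. ennreal c * g x)"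
  unfolding upper_gradient_real_iff
proof (intro conjI allI impI; (elim conjE)?)
  show "(\<lambda>x. ennreal c * g x) \<in> borel_measurable (restrict_space borel U)"
    using upper_gradientD(1)[OF assms(1)] by simp
  have c: "c \<ge> 0" using f[of 0 1] by simp
  fix \<gamma> :: "real \<Rightarrow> 'a" assume r: "rectifiable_curve \<gamma>" "path_image \<gamma> \<subseteq> U"
  then interpret rectifiable \<gamma> by unfold_locales
  have "ennreal \<bar>f (h (pathstart \<gamma>)) - f (h (pathfinish \<gamma>))\<bar>
      \<le> ennreal c * ennreal \<bar>h (pathstart \<gamma>) - h (pathfinish \<gamma>)\<bar>"
    using c f by (simp flip: ennreal_mult)
  also have "\<dots> \<le> ennreal c * curve_integral \<gamma> g"
    using assms r unfolding upper_gradient_real_iff by (intro mult_left_mono) auto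
  also have "\<dots> = curve_integral \<gamma> (\<lambda>x. ennreal c * g x)"
    unfolding curve_integral_eq_arc_integral
    by (rule arc_integral_cmult[symmetric, OF upper_gradientD(1)[OF assms(1)]])
       (use r in \<open>auto simp: path_image_def\<close>)
  finally show "ennreal \<bar>f (h (pathstart \<gamma>)) - f (h (pathfinish \<gamma>))\<bar>
      \<le> curve_integral \<gamma> (\<lambda>x. ennreal c * g x)" .
qed

lemma upper_gradient_lipschitz:
  assumes "L-lipschitz_on U h"
  shows "upper_gradient U (\<lambda>x. ereal (h x)) (\<lambda>_. ennreal L)"
  unfolding upper_gradient_real_iff
proof (intro conjI allI impI; (elim conjE)?)
  fix \<gamma> :: "real \<Rightarrow> 'a" assume r: "rectifiable_curve \<gamma>" "path_image \<gamma> \<subseteq> U"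
  then interpret rectifiable \<gamma> by unfold_locales
  have L: "L \<ge> 0" by (rule lipschitz_on_nonneg[OF assms])
  have "\<bar>h (\<gamma> 0) - h (\<gamma> 1)\<bar> \<le> L * dist (\<gamma> 0) (\<gamma> 1)"
    using lipschitz_onD[OF assms, of "\<gamma> 0" "\<gamma> 1"] r(2)
    by (simp add: dist_real_def path_image_def image_subset_iff)
  also have "\<dots> \<le> L * (len 1 - len 0)" using L dist_le_len[of 0 1] by (intro mult_left_mono) auto
  finally show "ennreal \<bar>h (pathstart \<gamma>) - h (pathfinish \<gamma>)\<bar> \<le> curve_integral \<gamma> (\<lambda>_. ennreal L)"
    using L by (simp add: curve_integral_eq_arc_integral arc_integral_const len_0 pathstart_def
        pathfinish_def flip: ennreal_mult')
qed simp

text \<open>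
  If \<open>h\<close> is below \<open>t\<close> at one end point of the curve, only the part of the curve between that end
  point and the first point where \<open>h\<close> reaches \<open>t\<close> matters.
\<close>

lemma upper_gradient_min:
  assumes ug: "upper_gradient U (\<lambda>x. ereal (h x)) g" and cont: "continuous_on U h"
  shows "upper_gradient U (\<lambda>x. ereal (min (h x) t)) (\<lambda>x. g x * indicator {x. h x < t} x)"
  unfolding upper_gradient_real_iff
proof (intro conjI allI impI; (elim conjE)?)
  let ?g = "\<lambda>x. g x * indicator {x. h x < t} x"
  note g = upper_gradientD(1)[OF ug]
  have [measurable]: "h \<in> borel_measurable (restrict_space borel U)"
    by (rule borel_measurable_continuous_on_restrict[OF cont])
  show g': "?g \<in> borel_measurable (restrict_space borel U)"
  proof -
    note g[measurable]
    have "?g \<in> borel_measurable (restrict_space borel U) \<longleftrightarrow>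
       (\<lambda>x. if h x < t then g x else 0) \<in> borel_measurable (restrict_space borel U)"
      by (intro measurable_cong) (auto simp: indicator_def)
    then show ?thesis by simp
  qed
  fix \<gamma> :: "real \<Rightarrow> 'a" assume r: "rectifiable_curve \<gamma>" "path_image \<gamma> \<subseteq> U"
  then interpret rectifiable \<gamma> by unfold_locales
  have im: "\<gamma> ` {a..b} \<subseteq> U" if "0 \<le> a" "b \<le> 1" for a b
    using r(2) that by (auto simp: path_image_def)
  have hc: "continuous_on {0..1} (\<lambda>s. h (\<gamma> s))"
    by (rule continuous_on_compose2[OF cont continuous_curve]) (use im in auto)
  have below: "ennreal \<bar>h (\<gamma> a) - h (\<gamma> b)\<bar> \<le> arc_integral ?g 0 1"
    if "0 \<le> a" "a \<le> b" "b \<le> 1" "\<And>s. a < s \<Longrightarrow> s < b \<Longrightarrow> h (\<gamma> s) < t" for a b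
  proof -
    have "ennreal \<bar>h (\<gamma> a) - h (\<gamma> b)\<bar> \<le> arc_integral g a b"
      by (rule upper_gradientD(2)[OF ug r(1) im]) (use that in auto)
    also have "\<dots> = arc_integral ?g a b"
      by (rule arc_integral_cong_interior) (use that in auto)
    also have "\<dots> \<le> arc_integral ?g 0 1"
      by (rule arc_integral_mono_interval) (use that in auto)
    finally show ?thesis .
  qed
  define S where "S = {s\<in>{0..1}. t \<le> h (\<gamma> s)}"
  have "S = {0..1} \<inter> (\<lambda>s. h (\<gamma> s)) -` {t..}" by (auto simp: S_def)
  then have "closed S"
    using continuous_closed_preimage[OF hc, of "{t..}"] by simp
  have main: "ennreal \<bar>min (h (\<gamma> 0)) t - min (h (\<gamma> 1)) t\<bar> \<le> arc_integral ?g 0 1"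
  proof (cases "S = {}")
    case True
    then have "h (\<gamma> s) < t" if "s \<in> {0..1}" for s using that unfolding S_def by auto
    then show ?thesis using below[of 0 1] by auto
  next
    case False
    have "S \<subseteq> {0..1}" by (auto simp: S_def)
    then have S: "compact S" "S \<subseteq> {0..1}"
      using compact_Int_closed[of "{0..1}" S] \<open>closed S\<close> by (simp_all add: Int_absorb1)
    obtain s0 where s0: "s0 \<in> S" "\<And>s. s \<in> S \<Longrightarrow> s0 \<le> s"
      using compact_attains_inf[OF S(1) False] by blast
    obtain s1 where s1: "s1 \<in> S" "\<And>s. s \<in> S \<Longrightarrow> s \<le> s1"
      using compact_attains_sup[OF S(1) False] by blast
    have "ennreal \<bar>h (\<gamma> 0) - h (\<gamma> s0)\<bar> \<le> arc_integral ?g 0 1"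
    proof (rule below)
      fix s :: real assume s: "0 < s" "s < s0"
      then have "s \<notin> S" using s0(2)[of s] by auto
      then show "h (\<gamma> s) < t" using s s0(1) by (simp add: S_def)
    qed (use s0(1) in \<open>simp_all add: S_def\<close>)
    moreover have "ennreal \<bar>h (\<gamma> s1) - h (\<gamma> 1)\<bar> \<le> arc_integral ?g 0 1"
    proof (rule below)
      fix s :: real assume s: "s1 < s" "s < 1"
      then have "s \<notin> S" using s1(2)[of s] by auto
      then show "h (\<gamma> s) < t" using s s1(1) by (simp add: S_def)
    qed (use s1(1) in \<open>simp_all add: S_def\<close>)
    \<comment> \<open>At \<open>s0\<close> and \<open>s1\<close> the function is at least
      \<open>t\<close>, so the truncated difference is dominated by the climb on the side of the
      smaller end value.\<close>
    moreover have "\<bar>min (h (\<gamma> 0)) t - min (h (\<gamma> 1)) t\<bar> \<le> \<bar>h (\<gamma> 0) - h (\<gamma> s0)\<bar> \<or>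
        \<bar>min (h (\<gamma> 0)) t - min (h (\<gamma> 1)) t\<bar> \<le> \<bar>h (\<gamma> s1) - h (\<gamma> 1)\<bar>"
      using s0(1) s1(1) by (auto simp: S_def min_def)
    ultimately show ?thesis
      by (meson ennreal_leI order_trans)
  qed
  then show "ennreal \<bar>min (h (pathstart \<gamma>)) t - min (h (pathfinish \<gamma>)) t\<bar> \<le> curve_integral \<gamma> ?g"
    by (simp add: curve_integral_eq_arc_integral pathstart_def pathfinish_def)
qed

text \<open>By reflection from \<open>upper_gradient_min\<close>. The two gradients are supported on
  the disjoint sets \<open>h < t\<close> and \<open>t < h\<close>, which is what
  \<open>TV_truncate\<close> exploits.\<close>

lemma upper_gradient_max:
  assumes ug: "upper_gradient U (\<lambda>x. ereal (h x)) g" and cont: "continuous_on U h"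
  shows "upper_gradient U (\<lambda>x. ereal (max (h x) t)) (\<lambda>x. g x * indicator {x. t < h x} x)"
proof -
  have "upper_gradient U (\<lambda>x. ereal (- h x)) (\<lambda>x. ennreal 1 * g x)"
    by (rule upper_gradient_compose[OF ug]) simp
  then have "upper_gradient U (\<lambda>x. ereal (min (- h x) (- t))) (\<lambda>x. g x * indicator {x. - h x < - t} x)"
    using upper_gradient_min[of U "\<lambda>x. - h x" g "- t"] cont continuous_on_minus by auto
  moreover have "max (h x) t = - min (- h x) (- t)" for x by auto
  ultimately show ?thesis
    using upper_gradient_compose[of U "\<lambda>x. min (- h x) (- t)" _ uminus 1] by simp
qed

text \<open>The variation of \<open>\<phi>\<close> is multiplied by \<open>\<bar>v - w\<bar>\<close>
  at one end of a piece, whereas the gradient involves the values along the piece. On short pieces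
  continuity bounds the discrepancy by the slack \<open>e\<close>.\<close>

lemma upper_gradient_leibniz:
  assumes v: "upper_gradient W (\<lambda>x. ereal (v x)) gv" "continuous_on W v"
    and w: "upper_gradient W (\<lambda>x. ereal (w x)) gw" "continuous_on W w"
    and \<phi>: "upper_gradient W (\<lambda>x. ereal (\<phi> x)) g\<phi>" "\<And>x. x \<in> W \<Longrightarrow> \<phi> x \<in> {0..1}"
    and e: "0 < (e::real)"
  shows "upper_gradient W (\<lambda>x. ereal (\<phi> x * v x + (1 - \<phi> x) * w x))
           (\<lambda>x. gv x + gw x + ennreal (\<bar>v x - w x\<bar> + e) * g\<phi> x)"
proof (rule upper_gradientI_oscillation)
  note [measurable] = upper_gradientD(1)[OF v(1)] upper_gradientD(1)[OF w(1)] upper_gradientD(1)[OF \<phi>(1)]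
    borel_measurable_continuous_on_restrict[OF v(2)] borel_measurable_continuous_on_restrict[OF w(2)]
  have m3: "(\<lambda>x. ennreal (\<bar>v x - w x\<bar> + e) * g\<phi> x) \<in> borel_measurable (restrict_space borel W)"
    by measurable
  show m: "(\<lambda>x. gv x + gw x + ennreal (\<bar>v x - w x\<bar> + e) * g\<phi> x) \<in> borel_measurable (restrict_space borel W)"
    by measurable
  fix \<gamma> :: "real \<Rightarrow> 'a" and x :: real
  assume r: "rectifiable_curve \<gamma>" "path_image \<gamma> \<subseteq> W" "x \<in> {0..1}"
  then interpret rectifiable \<gamma> by unfold_locales
  define F where "F s = \<bar>v (\<gamma> s) - w (\<gamma> s)\<bar>" for s
  have im: "\<gamma> ` {a..b} \<subseteq> W" if "0 \<le> a" "b \<le> 1" for a b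
    using r(2) that by (auto simp: path_image_def)
  have "continuous_on {0..1} F"
    unfolding F_def
    by (intro continuous_intros continuous_on_compose2[OF v(2) continuous_curve]
        continuous_on_compose2[OF w(2) continuous_curve]) (use im in auto)
  then obtain d where d: "d > 0" "\<And>s. s \<in> {0..1} \<Longrightarrow> dist s x < d \<Longrightarrow> dist (F s) (F x) < e / 2"
    using r(3) e unfolding continuous_on_iff by (meson half_gt_zero)
  show "\<exists>d>0. \<forall>a b. 0 \<le> a \<and> a \<le> x \<and> x \<le> b \<and> b \<le> 1 \<and> b - a < d \<longrightarrow>
      ennreal \<bar>\<phi> (\<gamma> a) * v (\<gamma> a) + (1 - \<phi> (\<gamma> a)) * w (\<gamma> a)
        - (\<phi> (\<gamma> b) * v (\<gamma> b) + (1 - \<phi> (\<gamma> b)) * w (\<gamma> b))\<bar>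
      \<le> arc_integral (\<lambda>x. gv x + gw x + ennreal (\<bar>v x - w x\<bar> + e) * g\<phi> x) a b"
  proof (intro exI[of _ d] conjI allI impI; (elim conjE)?)
    fix a b assume ab: "0 \<le> a" "a \<le> x" "x \<le> b" "b \<le> 1" "b - a < d"
    then have ab': "0 \<le> a" "a \<le> b" "b \<le> 1" by auto
    note im = im[OF ab(1,4)]
    have osc: "F a \<le> F s + e" if "s \<in> {a..b}" for s
    proof -
      have "dist (F s) (F x) < e / 2" "dist (F a) (F x) < e / 2"
        by (rule d(2); use that ab in \<open>auto simp: dist_real_def\<close>)+
      then show ?thesis unfolding dist_real_def by linarith
    qed
    \<comment> \<open>The product rule with different base points: \<open>\<phi>\<close> is taken at
      \<open>b\<close> in front of the differences of \<open>v\<close> and \<open>w\<close>, where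
      its weights are at most 1, and \<open>v - w\<close> is taken at \<open>a\<close> in front of
      the difference of \<open>\<phi>\<close>.\<close>
    have "\<phi> (\<gamma> a) * v (\<gamma> a) + (1 - \<phi> (\<gamma> a)) * w (\<gamma> a) - (\<phi> (\<gamma> b) * v (\<gamma> b) + (1 - \<phi> (\<gamma> b)) * w (\<gamma> b))
      = \<phi> (\<gamma> b) * (v (\<gamma> a) - v (\<gamma> b)) + (1 - \<phi> (\<gamma> b)) * (w (\<gamma> a) - w (\<gamma> b))
        + (v (\<gamma> a) - w (\<gamma> a)) * (\<phi> (\<gamma> a) - \<phi> (\<gamma> b))" (is "?l = ?r")
      by (simp add: algebra_simps)
    moreover have "\<bar>?r\<bar> \<le> \<bar>\<phi> (\<gamma> b) * (v (\<gamma> a) - v (\<gamma> b))\<bar> + \<bar>(1 - \<phi> (\<gamma> b)) * (w (\<gamma> a) - w (\<gamma> b))\<bar>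
        + \<bar>(v (\<gamma> a) - w (\<gamma> a)) * (\<phi> (\<gamma> a) - \<phi> (\<gamma> b))\<bar>"
      by (meson abs_triangle_ineq add_right_mono order_trans)
    moreover have "\<phi> (\<gamma> b) \<in> {0..1}" using \<phi>(2)[of "\<gamma> b"] im ab' by force
    then have "\<bar>\<phi> (\<gamma> b) * (v (\<gamma> a) - v (\<gamma> b))\<bar> \<le> 1 * \<bar>v (\<gamma> a) - v (\<gamma> b)\<bar>"
      "\<bar>(1 - \<phi> (\<gamma> b)) * (w (\<gamma> a) - w (\<gamma> b))\<bar> \<le> 1 * \<bar>w (\<gamma> a) - w (\<gamma> b)\<bar>"
      unfolding abs_mult by (intro mult_right_mono; auto)+
    ultimately have "\<bar>?l\<bar> \<le> \<bar>v (\<gamma> a) - v (\<gamma> b)\<bar> + \<bar>w (\<gamma> a) - w (\<gamma> b)\<bar> + F a * \<bar>\<phi> (\<gamma> a) - \<phi> (\<gamma> b)\<bar>"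
      by (simp add: F_def abs_mult)
    then have "ennreal \<bar>?l\<bar> \<le> ennreal \<bar>v (\<gamma> a) - v (\<gamma> b)\<bar> + ennreal \<bar>w (\<gamma> a) - w (\<gamma> b)\<bar>
        + ennreal (F a) * ennreal \<bar>\<phi> (\<gamma> a) - \<phi> (\<gamma> b)\<bar>"
      by (simp add: F_def flip: ennreal_plus ennreal_mult)
    also have "\<dots> \<le> arc_integral gv a b + arc_integral gw a b + ennreal (F a) * arc_integral g\<phi> a b"
      by (intro add_mono mult_left_mono upper_gradientD(2)[OF v(1) r(1) im ab']
          upper_gradientD(2)[OF w(1) r(1) im ab'] upper_gradientD(2)[OF \<phi>(1) r(1) im ab']) simp
    also have "ennreal (F a) * arc_integral g\<phi> a b = arc_integral (\<lambda>x. ennreal (F a) * g\<phi> x) a b"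
      by (rule arc_integral_cmult[symmetric, OF _ im ab']) simp
    also have "\<dots> \<le> arc_integral (\<lambda>x. ennreal (\<bar>v x - w x\<bar> + e) * g\<phi> x) a b"
      by (intro arc_integral_mono mult_right_mono ennreal_leI ab') (use osc in \<open>auto simp: F_def\<close>)
    finally show "ennreal \<bar>?l\<bar> \<le> arc_integral (\<lambda>x. gv x + gw x + ennreal (\<bar>v x - w x\<bar> + e) * g\<phi> x) a b"
      using im ab' by (simp add: arc_integral_plus[where U = W] m3 add_left_mono)
  qed (rule d)
qed

section \<open>Locally Lipschitz functions and doubling spaces\<close>

lemma liminf_add_le_ennreal:
  fixes f g :: "nat \<Rightarrow> ennreal"
  shows "liminf f + liminf g \<le> liminf (\<lambda>n. f n + g n)"
proof -
  have inc: "incseq (\<lambda>n. INF m\<in>{n..}. h m)" for h :: "nat \<Rightarrow> ennreal"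
    by (auto simp: incseq_def intro!: INF_superset_mono)
  have "liminf f + liminf g = (SUP n. (INF m\<in>{n..}. f m) + (INF m\<in>{n..}. g m))"
    unfolding liminf_SUP_INF by (rule ennreal_SUP_add[OF inc inc, symmetric])
  also have "\<dots> \<le> (SUP n. INF m\<in>{n..}. f m + g m)"
    by (intro SUP_mono' INF_greatest add_mono INF_lower) auto
  finally show ?thesis by (simp add: liminf_SUP_INF)
qed

text \<open>\<open>infdist\<close> to the empty set is 0, so the full space gets the value 1 to keep
  the gap positive on \<open>U\<close>.\<close>

definition boundary_gap :: "'a::metric_space set \<Rightarrow> 'a \<Rightarrow> real" where
  "boundary_gap U x = (if U = UNIV then 1 else infdist x (- U))"

lemma boundary_gap_pos_iff: "open U \<Longrightarrow> 0 < boundary_gap U x \<longleftrightarrow> x \<in> U"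
  using in_closed_iff_infdist_zero[of "- U" x] infdist_nonneg[of x "- U"]
  by (auto simp: boundary_gap_def less_le)

lemma boundary_gap_lipschitz: "1-lipschitz_on A (boundary_gap U)"
  by (rule lipschitz_onI) (auto simp: boundary_gap_def dist_real_def infdist_triangle_abs)

lemma continuous_boundary_gap: "continuous_on A (boundary_gap U)"
  using boundary_gap_lipschitz by (rule lipschitz_on_continuous_on)

text \<open>A bound on this function bounds the distance from \<open>x0\<close> and keeps away from
  the complement of \<open>U\<close>, so its sublevel sets in \<open>U\<close> are compact
  (\<open>compact_exhaustion\<close>).\<close>

definition exhaustion :: "'a::metric_space set \<Rightarrow> 'a \<Rightarrow> 'a \<Rightarrow> real" where
  "exhaustion U x0 x = dist x0 x + 1 / boundary_gap U x"

lemma exhaustion_pos: "open U \<Longrightarrow> x \<in> U \<Longrightarrow> 0 < exhaustion U x0 x"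
  unfolding exhaustion_def using boundary_gap_pos_iff[of U x] by (simp add: add_nonneg_pos)

lemma continuous_exhaustion: "open U \<Longrightarrow> continuous_on U (exhaustion U x0)"
  unfolding exhaustion_def
  by (intro continuous_intros continuous_boundary_gap) (metis boundary_gap_pos_iff less_irrefl)

text \<open>The pointwise form of \<open>lip_loc\<close>, which is easier to glue; on open sets the
  two agree by \<open>lip_loc_iff\<close>.\<close>

definition locally_lipschitz :: "'a::metric_space set \<Rightarrow> ('a \<Rightarrow> real) \<Rightarrow> bool" where
  "locally_lipschitz U h \<longleftrightarrow> (\<forall>x\<in>U. \<exists>r>0. \<exists>L. L-lipschitz_on (ball x r) h)"

lemma locally_lipschitz_continuous:
  assumes "locally_lipschitz U h"
  shows "continuous_on U h"
proof (rule continuous_at_imp_continuous_on, rule ballI)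
  fix x assume "x \<in> U"
  then obtain r L where "r > 0" "L-lipschitz_on (ball x r) h"
    using assms unfolding locally_lipschitz_def by blast
  then show "isCont h x"
    using lipschitz_on_continuous_on continuous_on_interior[of "ball x r" h x] by auto
qed

lemma locally_lipschitz_cong_local:
  assumes "\<And>x. x \<in> U \<Longrightarrow> \<exists>N h'. open N \<and> x \<in> N \<and> locally_lipschitz N h' \<and> (\<forall>y\<in>N. h y = h' y)"
  shows "locally_lipschitz U h"
  unfolding locally_lipschitz_def
proof
  fix x assume "x \<in> U"
  then obtain N h' where N: "open N" "x \<in> N" "locally_lipschitz N h'" "\<And>y. y \<in> N \<Longrightarrow> h y = h' y"
    using assms by metis
  then obtain r L where rL: "r > 0" "L-lipschitz_on (ball x r) h'"
    unfolding locally_lipschitz_def by blast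
  obtain r' where r': "r' > 0" "ball x r' \<subseteq> N" using N openE by blast
  have "L-lipschitz_on (ball x (min r r')) h'"
    using rL(2) by (rule lipschitz_on_subset) auto
  then have "L-lipschitz_on (ball x (min r r')) h"
    by (rule lipschitz_on_transform) (use N(4) r' in auto)
  then show "\<exists>r>0. \<exists>L. L-lipschitz_on (ball x r) h"
    using rL(1) r'(1) by (meson min_less_iff_conj)
qed

lemma locally_lipschitz_subset: "locally_lipschitz U h \<Longrightarrow> V \<subseteq> U \<Longrightarrow> locally_lipschitz V h"
  by (auto simp: locally_lipschitz_def)

lemma locally_lipschitz_lipschitz: "L-lipschitz_on UNIV h \<Longrightarrow> locally_lipschitz U h"
  unfolding locally_lipschitz_def by (meson lipschitz_on_subset subset_UNIV zero_less_one)

lemma locally_lipschitz_compose: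
  assumes h: "locally_lipschitz U h" and f: "\<And>s t :: real. \<bar>f s - f t\<bar> \<le> c * \<bar>s - t\<bar>"
  shows "locally_lipschitz U (\<lambda>x. f (h x))"
  unfolding locally_lipschitz_def
proof
  have c: "0 \<le> c" using f[of 0 1] by simp
  fix x assume "x \<in> U"
  then obtain r L where rL: "r > 0" "L-lipschitz_on (ball x r) h"
    using h unfolding locally_lipschitz_def by blast
  have "(c * L)-lipschitz_on (ball x r) (\<lambda>x. f (h x))"
    by (rule lipschitz_on_compose2[OF rL(2)]) (use f c in \<open>auto simp: lipschitz_on_def dist_real_def\<close>)
  then show "\<exists>r>0. \<exists>L. L-lipschitz_on (ball x r) (\<lambda>x. f (h x))" using rL(1) by blast
qed

lemma locally_lipschitz_obtain2:
  assumes "locally_lipschitz U h" "locally_lipschitz U k" "x \<in> U"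
  obtains r L where "r > 0" "L-lipschitz_on (ball x r) h" "L-lipschitz_on (ball x r) k" "L \<ge> 0"
proof -
  obtain r L where 1: "r > 0" "L-lipschitz_on (ball x r) h"
    using assms unfolding locally_lipschitz_def by blast
  obtain r' L' where 2: "r' > 0" "L'-lipschitz_on (ball x r') k"
    using assms unfolding locally_lipschitz_def by blast
  show thesis
  proof (rule that)
    show "min r r' > 0" using 1 2 by simp
    show "(max L L')-lipschitz_on (ball x (min r r')) h"
      by (rule lipschitz_on_mono[OF 1(2)]) auto
    show "(max L L')-lipschitz_on (ball x (min r r')) k"
      by (rule lipschitz_on_mono[OF 2(2)]) auto
    show "0 \<le> max L L'" using lipschitz_on_nonneg[OF 1(2)] by simp
  qed
qed

lemma locally_lipschitz_add:
  assumes "locally_lipschitz U h" "locally_lipschitz U k"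
  shows "locally_lipschitz U (\<lambda>x. h x + k x)"
  unfolding locally_lipschitz_def
proof
  fix x assume "x \<in> U"
  then obtain r L where "r > 0" "L-lipschitz_on (ball x r) h" "L-lipschitz_on (ball x r) k"
    using assms locally_lipschitz_obtain2 by blast
  then show "\<exists>r>0. \<exists>L. L-lipschitz_on (ball x r) (\<lambda>x. h x + k x)"
    using lipschitz_on_add by blast
qed

lemma locally_lipschitz_mult:
  assumes "locally_lipschitz U h" "locally_lipschitz U k"
  shows "locally_lipschitz U (\<lambda>x. h x * k x)"
  unfolding locally_lipschitz_def
proof
  fix x assume "x \<in> U"
  then obtain r L where rL: "r > 0" "L-lipschitz_on (ball x r) h" "L-lipschitz_on (ball x r) k" "L \<ge> 0"
    using assms locally_lipschitz_obtain2 by blast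
  \<comment> \<open>A common bound for both factors on the ball: the values at the centre plus the
    oscillation \<open>L * r\<close>.\<close>
  define B where "B = L * r + \<bar>h x\<bar> + \<bar>k x\<bar>"
  have B: "\<bar>f y\<bar> \<le> B" if "L-lipschitz_on (ball x r) f" "f = h \<or> f = k" "y \<in> ball x r" for y f
  proof -
    have "\<bar>f y - f x\<bar> \<le> L * dist y x"
      using lipschitz_onD[OF that(1), of y x] that(3) rL(1) by (auto simp: dist_real_def)
    also have "\<dots> \<le> L * r" using that(3) rL(4) by (intro mult_left_mono) (auto simp: dist_commute)
    finally show ?thesis using that(2) unfolding B_def by auto
  qed
  have "0 \<le> B" unfolding B_def using rL by simp
  have "(2 * B * L)-lipschitz_on (ball x r) (\<lambda>x. h x * k x)"
  proof (rule lipschitz_onI)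
    fix y z assume yz: "y \<in> ball x r" "z \<in> ball x r"
    have "\<bar>h y * k y - h z * k z\<bar> = \<bar>h y * (k y - k z) + k z * (h y - h z)\<bar>"
      by (simp add: algebra_simps)
    also have "\<dots> \<le> \<bar>h y\<bar> * \<bar>k y - k z\<bar> + \<bar>k z\<bar> * \<bar>h y - h z\<bar>"
      by (metis abs_triangle_ineq abs_mult)
    also have "\<dots> \<le> B * (L * dist y z) + B * (L * dist y z)"
      using B[OF rL(2) _ yz(1)] B[OF rL(3) _ yz(2)] \<open>0 \<le> B\<close>
        lipschitz_onD[OF rL(2) yz] lipschitz_onD[OF rL(3) yz]
      by (intro add_mono mult_mono) (auto simp: dist_real_def)
    finally show "dist (h y * k y) (h z * k z) \<le> 2 * B * L * dist y z"
      by (simp add: dist_real_def)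
  qed (use \<open>0 \<le> B\<close> rL in simp)
  then show "\<exists>r>0. \<exists>L. L-lipschitz_on (ball x r) (\<lambda>x. h x * k x)" using rL(1) by blast
qed

lemma locally_lipschitz_exhaustion:
  assumes "open U"
  shows "locally_lipschitz U (exhaustion U x0)"
  unfolding locally_lipschitz_def
proof
  fix x assume "x \<in> U"
  \<comment> \<open>On the ball whose radius is half the gap, the gap stays above \<open>g\<close>,
    so its reciprocal has Lipschitz constant \<open>1 / g\<^sup>2\<close>.\<close>
  define g where "g = boundary_gap U x / 2"
  have g: "0 < g" using boundary_gap_pos_iff[OF assms] \<open>x \<in> U\<close> by (simp add: g_def)
  have ge: "g \<le> boundary_gap U y" if "y \<in> ball x g" for y
    using lipschitz_onD[OF boundary_gap_lipschitz, of x UNIV y U] that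
    by (auto simp: dist_real_def g_def)
  have "(1 + 1 / g\<^sup>2)-lipschitz_on (ball x g) (exhaustion U x0)"
    unfolding exhaustion_def
  proof (rule lipschitz_on_add)
    show "1-lipschitz_on (ball x g) (dist x0)"
    proof (rule lipschitz_onI)
      show "dist (dist x0 y) (dist x0 z) \<le> 1 * dist y z" for y z
        using abs_dist_diff_le[of y x0 z] by (simp add: dist_real_def dist_commute)
    qed simp
    show "(1 / g\<^sup>2)-lipschitz_on (ball x g) (\<lambda>x. 1 / boundary_gap U x)"
    proof (rule lipschitz_onI)
      fix y z assume yz: "y \<in> ball x g" "z \<in> ball x g"
      have pos: "0 < boundary_gap U y" "0 < boundary_gap U z"
        using ge[OF yz(1)] ge[OF yz(2)] g by linarith+
      then have "\<bar>1 / boundary_gap U y - 1 / boundary_gap U z\<bar>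
          = \<bar>boundary_gap U z - boundary_gap U y\<bar> / (boundary_gap U y * boundary_gap U z)"
        by (simp add: divide_simps abs_mult)
      also have "\<dots> \<le> dist y z / (g * g)"
      proof (rule frac_le)
        show "\<bar>boundary_gap U z - boundary_gap U y\<bar> \<le> dist y z"
          using lipschitz_onD[OF boundary_gap_lipschitz, of z UNIV y U]
          by (simp add: dist_real_def dist_commute)
        show "g * g \<le> boundary_gap U y * boundary_gap U z"
          by (rule mult_mono) (use ge[OF yz(1)] ge[OF yz(2)] g in linarith)+
      qed (use g in simp_all)
      finally show "dist (1 / boundary_gap U y) (1 / boundary_gap U z) \<le> 1 / g\<^sup>2 * dist y z"
        by (simp add: dist_real_def power2_eq_square)
    qed simp
  qed
  then show "\<exists>r>0. \<exists>L. L-lipschitz_on (ball x r) (exhaustion U x0)" using g by blast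
qed

locale doubling_space =
  fixes \<mu> :: "'a::complete_space set \<Rightarrow> ennreal"
  assumes regular: "borel_regular_outer_measure \<mu>" and doubling: "doubling \<mu>"
begin

abbreviation M :: "'a measure" where "M \<equiv> caratheodory_measure \<mu>"

lemma outer: "outer_measure_space UNIV \<mu>"
  using regular by (simp add: borel_regular_outer_measure_def)

lemma space_M [simp]: "space M = UNIV"
  by (rule space_caratheodory_measure[OF outer])

lemma borel_sets_M: "A \<in> sets borel \<Longrightarrow> A \<in> sets M"
  using regular by (auto simp: borel_regular_outer_measure_def sets_caratheodory_measure)

lemma emeasure_M: "A \<in> sets M \<Longrightarrow> emeasure M A = \<mu> A"
  using emeasure_caratheodory_measure[OF outer] by (simp add: sets_caratheodory_measure[OF outer])

lemma borel_measurable_M: "h \<in> measurable borel N \<Longrightarrow> h \<in> measurable M N"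
  by (rule measurable_mono[of N N borel M, THEN subsetD]) (auto intro: borel_sets_M)

lemma open_sets_M [measurable]: "open A \<Longrightarrow> A \<in> sets M"
  by (simp add: borel_sets_M)

lemma emeasure_ball [simp]: "emeasure M (ball x r) = \<mu> (ball x r)"
  by (simp add: emeasure_M open_sets_M)

lemma doubling_constant:
  obtains C :: real where "C \<ge> 1" "\<And>x r. r > 0 \<Longrightarrow> \<mu> (ball x (2 * r)) \<le> ennreal C * \<mu> (ball x r)"
    "\<And>x r. r > 0 \<Longrightarrow> 0 < \<mu> (ball x r)" "\<And>x r. \<mu> (ball x r) < \<infinity>"
proof -
  obtain C :: real where C: "C \<ge> 1" "\<And>x r. r > 0 \<Longrightarrow> 0 < \<mu> (ball x (2 * r)) \<and>
           \<mu> (ball x (2 * r)) \<le> ennreal C * \<mu> (ball x r) \<and> ennreal C * \<mu> (ball x r) < \<infinity>"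
    using doubling unfolding doubling_def by blast
  show thesis
  proof (rule that[OF C(1)])
    show "\<mu> (ball x (2 * r)) \<le> ennreal C * \<mu> (ball x r)" if "r > 0" for x r
      using C(2)[OF that] by blast
    show "0 < \<mu> (ball x r)" if "r > 0" for x r
      using C(2)[of "r / 2" x] that by simp
    show "\<mu> (ball x r) < \<infinity>" for x r
    proof -
      have "\<mu> (ball x r) \<le> \<mu> (ball x (2 * max 1 r))"
        using emeasure_mono[of "ball x r" "ball x (2 * max 1 r)" M] by (simp add: open_sets_M subset_ball)
      also have "\<dots> < \<infinity>"
      proof -
        have "max 1 r > 0" by simp
        from C(2)[OF this, of x] show ?thesis using le_less_trans by blast
      qed
      finally show ?thesis .
    qed
  qed
qed

lemma ball_positive: "r > 0 \<Longrightarrow> 0 < \<mu> (ball x r)"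
  by (rule doubling_constant)

lemma ball_finite: "\<mu> (ball x r) < top"
  by (rule doubling_constant) simp

lemma bounded_finite: "bounded A \<Longrightarrow> emeasure M A < top"
proof -
  assume "bounded A"
  then obtain x r where "A \<subseteq> ball x r" by (metis bounded_subset_ballD)
  then have "emeasure M A \<le> \<mu> (ball x r)"
    using emeasure_mono[of A "ball x r" M] by (simp add: open_sets_M)
  then show ?thesis using ball_finite le_less_trans by blast
qed

lemma doubling_iterate:
  obtains C :: real where "C \<ge> 1"
    "\<And>x r. r > 0 \<Longrightarrow> \<mu> (ball x (2 ^ k * r)) \<le> ennreal C * \<mu> (ball x r)"
proof -
  obtain C :: real where C: "C \<ge> 1" "\<And>x r. r > 0 \<Longrightarrow> \<mu> (ball x (2 * r)) \<le> ennreal C * \<mu> (ball x r)"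
    using doubling_constant by metis
  have "\<mu> (ball x (2 ^ k * r)) \<le> ennreal (C ^ k) * \<mu> (ball x r)" if "r > 0" for x r
    using that
  proof (induction k)
    case (Suc k)
    have "\<mu> (ball x (2 ^ Suc k * r)) \<le> ennreal C * \<mu> (ball x (2 ^ k * r))"
      using C(2)[of "2 ^ k * r" x] Suc.prems by (simp add: mult.assoc)
    also have "\<dots> \<le> ennreal C * (ennreal (C ^ k) * \<mu> (ball x r))"
      using Suc by (intro mult_left_mono) auto
    finally show ?case using C(1) by (simp add: ennreal_mult mult.assoc)
  qed simp
  then show thesis using that[of "C ^ k"] C(1) by simp
qed

text \<open>
  Disjoint balls of radius \<open>e / 2\<close> about points of a bounded set have comparable measure, so there
  are boundedly many of them.
\<close>

lemma compact_cball: "compact (cball x0 (R :: real) :: 'a set)"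
proof (cases "0 \<le> R")
  case True
  show ?thesis
    unfolding compact_eq_totally_bounded
  proof (intro conjI allI impI)
    show "complete (cball x0 R)" by (simp add: complete_eq_closed)
    fix e :: real assume e: "e > 0"
    define A where "A = ball x0 (R + e)"
    define sep where "sep S \<longleftrightarrow> finite S \<and> S \<subseteq> cball x0 R \<and> (\<forall>x\<in>S. \<forall>y\<in>S. x \<noteq> y \<longrightarrow> e \<le> dist x y)" for S
    \<comment> \<open>A point of \<open>cball x0 R\<close> has distance less than
      \<open>2 * R + e\<close> to every point of \<open>A\<close>, so \<open>k\<close> doublings of
      a ball of radius \<open>e / 2\<close> about it cover \<open>A\<close>.\<close>
    obtain k :: nat where k: "(2 * R + e) / (e / 2) \<le> 2 ^ k"
      using real_arch_pow[of 2] by (meson less_imp_le one_less_numeral_iff semiring_norm(76))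
    obtain C :: real where C: "C \<ge> 1"
      "\<And>x r. r > 0 \<Longrightarrow> \<mu> (ball x (2 ^ k * r)) \<le> ennreal C * \<mu> (ball x r)"
      using doubling_iterate by metis
    have card: "card S \<le> C" if "sep S" for S
    proof -
      have S: "finite S" "S \<subseteq> cball x0 R" "\<And>x y. x \<in> S \<Longrightarrow> y \<in> S \<Longrightarrow> x \<noteq> y \<Longrightarrow> e \<le> dist x y"
        using that by (auto simp: sep_def)
      have "\<mu> A \<le> ennreal C * \<mu> (ball x (e / 2))" if "x \<in> S" for x
      proof -
        have "A \<subseteq> ball x (2 ^ k * (e / 2))"
        proof
          fix y assume "y \<in> A"
          then have "dist x y < R + (R + e)"
            using S(2) that dist_triangle[of x y x0] by (auto simp: A_def dist_commute)
          also have "\<dots> \<le> 2 ^ k * (e / 2)" using k e by (simp add: field_simps)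
          finally show "y \<in> ball x (2 ^ k * (e / 2))" by simp
        qed
        then have "\<mu> A \<le> \<mu> (ball x (2 ^ k * (e / 2)))"
          using emeasure_mono[of A "ball x (2 ^ k * (e / 2))" M] by (simp add: A_def open_sets_M)
        also have "\<dots> \<le> ennreal C * \<mu> (ball x (e / 2))" using C(2)[of "e / 2" x] e by simp
        finally show ?thesis .
      qed
      then have "(\<Sum>x\<in>S. \<mu> A) \<le> (\<Sum>x\<in>S. ennreal C * \<mu> (ball x (e / 2)))"
        by (rule sum_mono)
      also have "\<dots> = ennreal C * (\<Sum>x\<in>S. emeasure M (ball x (e / 2)))"
        by (simp add: sum_distrib_left)
      also have "(\<Sum>x\<in>S. emeasure M (ball x (e / 2))) = emeasure M (\<Union>x\<in>S. ball x (e / 2))"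
      proof (rule sum_emeasure)
        show "disjoint_family_on (\<lambda>x. ball x (e / 2)) S"
          unfolding disjoint_family_on_def
        proof (intro ballI impI equals0I)
          fix x y z assume "x \<in> S" "y \<in> S" "x \<noteq> y" "z \<in> ball x (e / 2) \<inter> ball y (e / 2)"
          then show False using S(3)[of x y] dist_triangle[of x y z] by (auto simp: dist_commute)
        qed
      qed (auto simp: S open_sets_M)
      also have "\<dots> \<le> \<mu> A"
      proof -
        have "(\<Union>x\<in>S. ball x (e / 2)) \<subseteq> A"
        proof clarify
          fix x y assume "x \<in> S" "y \<in> ball x (e / 2)"
          then show "y \<in> A" using S(2) dist_triangle[of x0 y x] e by (auto simp: A_def)
        qed
        then show ?thesis
          using emeasure_mono[of "\<Union>x\<in>S. ball x (e / 2)" A M] by (simp add: A_def open_sets_M)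
      qed
      finally have "of_nat (card S) * \<mu> A \<le> ennreal C * \<mu> A" by (simp add: mult_left_mono)
      moreover have "0 < \<mu> A" "\<mu> A < top" using True e by (auto simp: A_def ball_positive ball_finite)
      ultimately have "of_nat (card S) \<le> ennreal C"
        using ennreal_mult_le_mult_iff[of "\<mu> A" "of_nat (card S)" "ennreal C"] by (simp add: mult.commute)
      then show ?thesis using C(1) by (simp add: ennreal_of_nat_eq_real_of_nat)
    qed
    define N where "N = nat \<lceil>C\<rceil>"
    have "\<exists>S. sep S \<and> (\<forall>S'. sep S' \<longrightarrow> card S' \<le> card S)"
    proof (rule ex_has_greatest_nat[of sep "{}" card "Suc N"])
      show "sep {}" by (simp add: sep_def)
      show "\<forall>S. sep S \<longrightarrow> card S < Suc N"
      proof (intro allI impI)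
        fix S assume "sep S"
        then have "real (card S) \<le> of_int \<lceil>C\<rceil>" using card le_of_int_ceiling order_trans by blast
        then show "card S < Suc N" unfolding N_def by linarith
      qed
    qed
    then obtain S where S: "sep S" "\<And>S'. sep S' \<Longrightarrow> card S' \<le> card S" by blast
    \<comment> \<open>A point missed by the balls could be added to \<open>S\<close>, which is a
      separated set of largest size.\<close>
    have "cball x0 R \<subseteq> (\<Union>x\<in>S. ball x e)"
    proof (rule ccontr)
      assume "\<not> ?thesis"
      then obtain y where y: "y \<in> cball x0 R" "\<And>x. x \<in> S \<Longrightarrow> e \<le> dist x y"
        by (force simp: not_less)
      then have "y \<notin> S" using e by force
      have "sep (insert y S)" using S(1) y by (auto simp: sep_def dist_commute)
      then have "card (insert y S) \<le> card S" by (rule S(2))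
      then show False using S(1) \<open>y \<notin> S\<close> by (simp add: sep_def)
    qed
    then show "\<exists>k. finite k \<and> cball x0 R \<subseteq> (\<Union>x\<in>k. ball x e)"
      using S(1) by (auto simp: sep_def)
  qed
qed simp

lemma compact_closed_bounded: "closed S \<Longrightarrow> bounded S \<Longrightarrow> compact (S :: 'a set)"
proof -
  assume S: "closed S" "bounded S"
  then obtain x r where "S \<subseteq> cball x r" by (meson bounded_subset_cball)
  then show "compact S"
    using compact_Int_closed[OF compact_cball S(1), of x r] by (simp add: Int_absorb1)
qed

lemma compact_exhaustion:
  fixes U :: "'a set"
  assumes "open U"
  shows "compact {x \<in> U. exhaustion U x0 x \<le> (c :: real)}"
proof (cases "0 < c")
  case True
  define K where "K = cball x0 c \<inter> (boundary_gap U -` {1 / c..})"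
  have "closed K"
    unfolding K_def using continuous_closed_preimage[OF continuous_boundary_gap[of UNIV U], of "{1 / c..}"]
    by (intro closed_Int) auto
  have "K \<subseteq> U"
  proof
    fix x assume "x \<in> K"
    then have "0 < 1 / c" "1 / c \<le> boundary_gap U x" using True by (auto simp: K_def)
    then show "x \<in> U" using boundary_gap_pos_iff[OF assms] by (meson less_le_trans)
  qed
  have "{x \<in> U. exhaustion U x0 x \<le> c} = K \<inter> exhaustion U x0 -` {..c}"
  proof -
    \<comment> \<open>Both summands of \<open>exhaustion\<close> are nonnegative on
      \<open>U\<close>, so each is bounded by \<open>c\<close>; this places the sublevel set in the
      closed bounded set \<open>K\<close>.\<close>
    have "dist x0 x \<le> c \<and> 1 / c \<le> boundary_gap U x" if "x \<in> U" "exhaustion U x0 x \<le> c" for x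
    proof -
      have "0 < boundary_gap U x" using that boundary_gap_pos_iff[OF assms] by blast
      then have "dist x0 x \<le> c" "1 / boundary_gap U x \<le> c"
        using that(2) zero_le_dist[of x0 x] unfolding exhaustion_def
        by (smt (verit) divide_pos_pos)+
      then show ?thesis using True \<open>0 < boundary_gap U x\<close> by (simp add: field_simps)
    qed
    then show ?thesis using \<open>K \<subseteq> U\<close> by (auto simp: K_def)
  qed
  moreover have "closed (K \<inter> exhaustion U x0 -` {..c})"
    using continuous_closed_preimage[OF continuous_on_subset[OF continuous_exhaustion[OF assms] \<open>K \<subseteq> U\<close>] \<open>closed K\<close>]
    by simp
  moreover have "bounded (K \<inter> exhaustion U x0 -` {..c})"
    by (rule bounded_subset[OF bounded_cball[of x0 c]]) (auto simp: K_def)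
  ultimately show ?thesis by (simp add: compact_closed_bounded)
next
  case False
  then have "\<not> exhaustion U x0 x \<le> c" if "x \<in> U" for x
    using exhaustion_pos[OF assms that, of x0] by linarith
  then have "{x \<in> U. exhaustion U x0 x \<le> c} = {}" by blast
  then show ?thesis by (rule ssubst) simp
qed

lemma compactly_inside_exhaustion:
  fixes U :: "'a set"
  assumes "open U"
  shows "compactly_inside {x \<in> U. a < exhaustion U x0 x \<and> exhaustion U x0 x < b} U"
    and "closure {x \<in> U. a < exhaustion U x0 x \<and> exhaustion U x0 x < b}
           \<subseteq> {x \<in> U. a \<le> exhaustion U x0 x \<and> exhaustion U x0 x \<le> b}"
proof -
  let ?V = "{x \<in> U. a < exhaustion U x0 x \<and> exhaustion U x0 x < b}"
  let ?K = "{x \<in> U. exhaustion U x0 x \<le> b}"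
  have K: "compact ?K" by (rule compact_exhaustion[OF assms])
  have "closed (?K \<inter> exhaustion U x0 -` {a..})"
    by (rule continuous_closed_preimage[OF continuous_on_subset[OF continuous_exhaustion[OF assms]]])
       (use K compact_imp_closed in auto)
  then show cl: "closure ?V \<subseteq> {x \<in> U. a \<le> exhaustion U x0 x \<and> exhaustion U x0 x \<le> b}"
  proof -
    assume "closed (?K \<inter> exhaustion U x0 -` {a..})"
    then have "closure ?V \<subseteq> ?K \<inter> exhaustion U x0 -` {a..}"
      by (rule closure_minimal[rotated]) auto
    then show ?thesis by auto
  qed
  have "open (U \<inter> exhaustion U x0 -` {a<..<b})"
    by (rule continuous_open_preimage[OF continuous_exhaustion]) (use assms in auto)
  moreover have "U \<inter> exhaustion U x0 -` {a<..<b} = ?V" by auto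
  moreover have "compact (closure ?V)"
  proof -
    have "closure ?V \<subseteq> ?K" using cl by blast
    then show ?thesis
      using compact_Int_closed[OF K, of "closure ?V"] by (simp only: Int_absorb1 closed_closure simp_thms)
  qed
  moreover have "closure ?V \<subseteq> U" using cl by blast
  ultimately show "compactly_inside ?V U" by (simp only: compactly_inside_def simp_thms)
qed

lemma compact_below_exhaustion:
  fixes U :: "'a set"
  assumes "open U" "compact K" "K \<subseteq> U"
  obtains n :: nat where "\<And>x. x \<in> K \<Longrightarrow> exhaustion U x0 x < n"
proof -
  have "bounded (exhaustion U x0 ` K)"
    using assms continuous_on_subset[OF continuous_exhaustion[OF assms(1)]]
    by (intro compact_imp_bounded compact_continuous_image)
  then obtain b where "\<And>x. x \<in> K \<Longrightarrow> \<bar>exhaustion U x0 x\<bar> \<le> b"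
    by (auto simp: bounded_iff)
  then show thesis using that reals_Archimedean2[of b] by (metis abs_le_D1 le_less_trans)
qed

lemma compactly_inside_superset:
  fixes U K :: "'a set"
  assumes "open U" "compact K" "K \<subseteq> U"
  obtains Q where "compactly_inside Q U" "K \<subseteq> Q"
proof -
  obtain x0 :: 'a where True by blast
  obtain n :: nat where "\<And>x. x \<in> K \<Longrightarrow> exhaustion U x0 x < n"
    using compact_below_exhaustion[OF assms] by metis
  then show thesis
    using that[OF compactly_inside_exhaustion(1)[OF assms(1), of "-1" x0 n]] assms(3)
      exhaustion_pos[OF assms(1), of _ x0] by force
qed

lemma lip_loc_iff:
  assumes "open U"
  shows "lip_loc U h \<longleftrightarrow> locally_lipschitz U (h :: 'a \<Rightarrow> real)"
proof
  assume h: "lip_loc U h"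
  show "locally_lipschitz U h"
    unfolding locally_lipschitz_def
  proof
    fix x assume "x \<in> U"
    then obtain r where r: "r > 0" "cball x r \<subseteq> U" using assms open_contains_cball by blast
    have "closure (ball x r) \<subseteq> cball x r" by (simp add: closure_minimal ball_subset_cball)
    then have "compactly_inside (ball x r) U"
      unfolding compactly_inside_def using r compact_cball[of x r]
      by (auto intro: compact_closed_bounded)
    then show "\<exists>r>0. \<exists>L. L-lipschitz_on (ball x r) h" using h r unfolding lip_loc_def by blast
  qed
next
  assume h: "locally_lipschitz U h"
  show "lip_loc U h"
    unfolding lip_loc_def
  proof (intro allI impI)
    fix V assume V: "compactly_inside V U"
    \<comment> \<open>This notion carries a time parameter; with the single dummy time 0 it supplies
      the passage from local Lipschitz bounds to a uniform one on a compact set.\<close>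
    have "local_lipschitz {0::real} (closure V) (\<lambda>_. h)"
    proof (rule local_lipschitzI)
      fix x t assume "x \<in> closure V"
      then obtain r L where rL: "r > 0" "L-lipschitz_on (ball x r) h"
        using h V unfolding locally_lipschitz_def compactly_inside_def by blast
      have "L-lipschitz_on (cball x (r / 2) \<inter> closure V) h"
        using rL by (auto intro!: lipschitz_on_subset[OF rL(2)])
      then show "\<exists>u>0. \<exists>L. \<forall>t\<in>cball t u \<inter> {0}. L-lipschitz_on (cball x u \<inter> closure V) h"
        using rL(1) by (intro exI[of _ "r / 2"]) auto
    qed
    then obtain L where "L-lipschitz_on (closure V) h"
      using V local_lipschitz_compact_implies_lipschitz[of "{0::real}" "closure V" "\<lambda>_. h"]
      unfolding compactly_inside_def by (metis compact_insert compact_empty continuous_on_const singletonI)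
    then show "\<exists>L. L-lipschitz_on V h" using lipschitz_on_subset[OF _ closure_subset] by blast
  qed
qed

end

section \<open>Total variation on open sets\<close>

lemma suminf_half_powers:
  assumes "0 \<le> (e::real)"
  shows "(\<Sum>i. ennreal (e * (1/2) ^ Suc i)) = ennreal e"
proof -
  have "(\<lambda>i. e * (1/2) ^ Suc i) sums (e * 1)" by (rule sums_mult[OF power_half_series])
  then show ?thesis using assms by (subst suminf_ennreal2) (auto simp: sums_iff)
qed

lemma ennreal_restrict_borel:
  fixes g :: "'a::topological_space \<Rightarrow> ennreal"
  assumes "g \<in> borel_measurable (restrict_space borel U)" "open U"
  shows "(\<lambda>x. g x * indicator U x) \<in> borel_measurable borel"
  using assms borel_measurable_restrict_space_iff_ennreal[of U borel g] by simp

lemma continuous_restrict_borel: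
  fixes v :: "'a::topological_space \<Rightarrow> real"
  assumes "continuous_on U v" "open T" "T \<subseteq> U"
  shows "(\<lambda>x. v x * indicator T x) \<in> borel_measurable borel"
proof -
  have "(\<lambda>x. indicator T x *\<^sub>R v x) \<in> borel_measurable borel"
    by (rule borel_measurable_continuous_on_indicator)
       (use assms continuous_on_subset in auto)
  then show ?thesis by (simp add: mult.commute)
qed

lemma compactly_inside_mono: "compactly_inside T U \<Longrightarrow> U \<subseteq> V \<Longrightarrow> compactly_inside T V"
  by (auto simp: compactly_inside_def)

lemma compactly_inside_Un:
  "compactly_inside S U \<Longrightarrow> compactly_inside T U \<Longrightarrow> compactly_inside (S \<union> T) U"
  by (auto simp: compactly_inside_def compact_Un)

lemma compactly_inside_subset: "compactly_inside T U \<Longrightarrow> T \<subseteq> U"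
  using closure_subset by (auto simp: compactly_inside_def)

lemma compactly_inside_open: "compactly_inside T U \<Longrightarrow> open T"
  by (simp add: compactly_inside_def)

lemma compactly_inside_empty: "compactly_inside {} U"
  by (simp add: compactly_inside_def)

context doubling_space
begin

lemma compactly_inside_finite: "compactly_inside T U \<Longrightarrow> emeasure M T < top"
  by (rule bounded_finite)
     (auto simp: compactly_inside_def intro: bounded_subset[OF compact_imp_bounded closure_subset])

abbreviation TV :: "('a \<Rightarrow> real) \<Rightarrow> 'a set \<Rightarrow> ennreal" where
  "TV u U \<equiv> total_variation_open \<mu> u U"

lemma restrict_borel_measurable:
  fixes g :: "'a \<Rightarrow> ennreal"
  shows "g \<in> borel_measurable (restrict_space borel U) \<Longrightarrow> open U \<Longrightarrow>
    (\<lambda>x. g x * indicator U x) \<in> borel_measurable M"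
  by (intro borel_measurable_M ennreal_restrict_borel)

lemma L1_integrand_measurable:
  fixes v :: "'a \<Rightarrow> real"
  assumes "continuous_on U v" "open U" "open T" "T \<subseteq> U" "u \<in> borel_measurable M"
  shows "(\<lambda>x. ennreal \<bar>v x - u x\<bar> * indicator T x) \<in> borel_measurable M"
proof -
  have [measurable]: "(\<lambda>x. v x * indicator T x) \<in> borel_measurable M" "u \<in> borel_measurable M" "T \<in> sets M"
    using borel_measurable_M[OF continuous_restrict_borel[OF assms(1,3,4)]] assms(5) open_sets_M[OF assms(3)]
    by auto
  have "(\<lambda>x. ennreal \<bar>v x * indicator T x - u x\<bar> * indicator T x) \<in> borel_measurable M"
    by measurable
  also have "(\<lambda>x. ennreal \<bar>v x * indicator T x - u x\<bar> * indicator T x) = (\<lambda>x. ennreal \<bar>v x - u x\<bar> * indicator T x)"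
    by (auto simp: indicator_def)
  finally show ?thesis .
qed

text \<open>Replaces sequences by single approximants. Accuracy \<open>1 / (n + 1)\<close> on the
  \<open>n\<close>-th set of an exhaustion gives one sequence that converges on every set compactly
  inside \<open>U\<close>, since each such set is eventually swallowed.\<close>

lemma TV_leI:
  assumes U: "open U"
    and approx: "\<And>T e. compactly_inside T U \<Longrightarrow> 0 < e \<Longrightarrow>
      \<exists>v g. locally_lipschitz U v \<and> upper_gradient U (\<lambda>x. ereal (v x)) g \<and>
        (\<integral>\<^sup>+x\<in>T. ennreal \<bar>v x - u x\<bar> \<partial>M) \<le> ennreal e \<and> (\<integral>\<^sup>+x\<in>U. g x \<partial>M) \<le> c + ennreal e"
  shows "TV u U \<le> c"
proof -
  obtain x0 :: 'a where True by blast
  \<comment> \<open>The lower bound -1 excludes nothing, as \<open>exhaustion\<close> is positive on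
    \<open>U\<close>; it brings the set into the two-sided form of
    \<open>compactly_inside_exhaustion\<close>.\<close>
  define V where "V n = {x \<in> U. -1 < exhaustion U x0 x \<and> exhaustion U x0 x < real n}" for n :: nat
  have V: "compactly_inside (V n) U" for n
    unfolding V_def by (rule compactly_inside_exhaustion[OF U])
  have "\<forall>n. \<exists>v g. locally_lipschitz U v \<and> upper_gradient U (\<lambda>x. ereal (v x)) g \<and>
      (\<integral>\<^sup>+x\<in>V n. ennreal \<bar>v x - u x\<bar> \<partial>M) \<le> ennreal (inverse (Suc n)) \<and>
      (\<integral>\<^sup>+x\<in>U. g x \<partial>M) \<le> c + ennreal (inverse (Suc n))"
    using approx[OF V] by simp
  from choice[OF this] obtain v where "\<forall>n. \<exists>g. locally_lipschitz U (v n) \<and>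
      upper_gradient U (\<lambda>x. ereal (v n x)) g \<and>
      (\<integral>\<^sup>+x\<in>V n. ennreal \<bar>v n x - u x\<bar> \<partial>M) \<le> ennreal (inverse (Suc n)) \<and>
      (\<integral>\<^sup>+x\<in>U. g x \<partial>M) \<le> c + ennreal (inverse (Suc n))" ..
  from choice[OF this] obtain g where vg: "\<And>n. locally_lipschitz U (v n)"
    "\<And>n. upper_gradient U (\<lambda>x. ereal (v n x)) (g n)"
    "\<And>n. (\<integral>\<^sup>+x\<in>V n. ennreal \<bar>v n x - u x\<bar> \<partial>M) \<le> ennreal (inverse (Suc n))"
    "\<And>n. (\<integral>\<^sup>+x\<in>U. g n x \<partial>M) \<le> c + ennreal (inverse (Suc n))"
    by blast
  have lim: "(\<lambda>n. ennreal (inverse (Suc n))) \<longlonglongrightarrow> 0"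
    using tendsto_ennrealI[OF LIMSEQ_inverse_real_of_nat] by simp
  have conv: "converges_L1_loc \<mu> U v u"
    unfolding converges_L1_loc_def
  proof (intro allI impI)
    fix T assume T: "compactly_inside T U"
    then have "compact (closure T)" "closure T \<subseteq> U" by (auto simp: compactly_inside_def)
    then obtain N :: nat where N: "\<And>x. x \<in> closure T \<Longrightarrow> exhaustion U x0 x < N"
      using compact_below_exhaustion[OF U] by metis
    have sub: "T \<subseteq> V n" if "N \<le> n" for n
    proof
      fix x assume "x \<in> T"
      then have "x \<in> U" "exhaustion U x0 x < N" using N closure_subset \<open>closure T \<subseteq> U\<close> by auto
      then show "x \<in> V n" using that exhaustion_pos[OF U \<open>x \<in> U\<close>, of x0] by (simp add: V_def)
    qed
    show "(\<lambda>n. \<integral>\<^sup>+x\<in>T. ennreal \<bar>v n x - u x\<bar> \<partial>M) \<longlonglongrightarrow> 0"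
    proof (rule tendsto_sandwich[OF _ _ tendsto_const lim])
      show "\<forall>\<^sub>F n in sequentially. (\<integral>\<^sup>+x\<in>T. ennreal \<bar>v n x - u x\<bar> \<partial>M) \<le> ennreal (inverse (Suc n))"
        using eventually_ge_at_top[of N]
      proof eventually_elim
        case (elim n)
        have "(\<integral>\<^sup>+x\<in>T. ennreal \<bar>v n x - u x\<bar> \<partial>M) \<le> (\<integral>\<^sup>+x\<in>V n. ennreal \<bar>v n x - u x\<bar> \<partial>M)"
          using sub[OF elim] by (intro nn_integral_mono) (auto simp: indicator_def)
        then show ?case using vg(3) order_trans by blast
      qed
    qed simp
  qed
  have "TV u U \<le> liminf (\<lambda>n. \<integral>\<^sup>+x\<in>U. g n x \<partial>M)"
    unfolding total_variation_open_def
    by (rule Inf_lower) (use vg conv lip_loc_iff[OF U] in blast)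
  also have "\<dots> \<le> liminf (\<lambda>n. c + ennreal (inverse (Suc n)))"
    using vg(4) by (intro Liminf_mono always_eventually) blast
  also have "\<dots> = c"
  proof (rule lim_imp_Liminf)
    show "(\<lambda>n. c + ennreal (inverse (Suc n))) \<longlonglongrightarrow> c"
      using tendsto_add[OF tendsto_const lim, of c] by simp
  qed simp
  finally show ?thesis .
qed

text \<open>The converse of \<open>TV_leI\<close>: closeness on \<open>T\<close> holds eventually
  and the gradient bound infinitely often, so some index has both.\<close>

lemma TV_lessD:
  assumes "TV u U < c" and U: "open U" and T: "compactly_inside T U" and e: "0 < e"
  shows "\<exists>v g. locally_lipschitz U v \<and> upper_gradient U (\<lambda>x. ereal (v x)) g \<and>
      (\<integral>\<^sup>+x\<in>T. ennreal \<bar>v x - u x\<bar> \<partial>M) \<le> ennreal e \<and> (\<integral>\<^sup>+x\<in>U. g x \<partial>M) < c"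
proof -
  obtain v g where vg: "\<And>n. lip_loc U (v n)" "converges_L1_loc \<mu> U v u"
    "\<And>n. upper_gradient U (\<lambda>x. ereal (v n x)) (g n)" "liminf (\<lambda>n. \<integral>\<^sup>+x\<in>U. g n x \<partial>M) < c"
    using assms(1) unfolding total_variation_open_def Inf_less_iff by auto
  have "(\<lambda>n. \<integral>\<^sup>+x\<in>T. ennreal \<bar>v n x - u x\<bar> \<partial>M) \<longlonglongrightarrow> 0"
    using vg(2) T by (simp add: converges_L1_loc_def)
  then have ev: "\<forall>\<^sub>F n in sequentially. (\<integral>\<^sup>+x\<in>T. ennreal \<bar>v n x - u x\<bar> \<partial>M) < ennreal e"
    by (rule order_tendstoD) (use e in simp)
  have "\<exists>\<^sub>F n in sequentially. (\<integral>\<^sup>+x\<in>U. g n x \<partial>M) < c"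
  proof (rule ccontr)
    assume "\<not> ?thesis"
    then have "\<forall>\<^sub>F n in sequentially. c \<le> (\<integral>\<^sup>+x\<in>U. g n x \<partial>M)"
      by (simp add: frequently_def not_less)
    then have "c \<le> liminf (\<lambda>n. \<integral>\<^sup>+x\<in>U. g n x \<partial>M)" by (rule Liminf_bounded)
    then show False using vg(4) by simp
  qed
  then have "\<exists>\<^sub>F n in sequentially. (\<integral>\<^sup>+x\<in>T. ennreal \<bar>v n x - u x\<bar> \<partial>M) < ennreal e \<and> (\<integral>\<^sup>+x\<in>U. g n x \<partial>M) < c"
    using ev by (rule frequently_eventually_conj)
  then obtain n where n: "(\<integral>\<^sup>+x\<in>U. g n x \<partial>M) < c" "(\<integral>\<^sup>+x\<in>T. ennreal \<bar>v n x - u x\<bar> \<partial>M) < ennreal e"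
    by (auto dest: frequently_ex)
  show ?thesis
    using vg(1,3)[of n] n lip_loc_iff[OF U] by (metis less_imp_le)
qed

lemma TV_approx:
  assumes "TV u U < top" "open U" "compactly_inside T U" "0 < e"
  obtains v g where "locally_lipschitz U v" "upper_gradient U (\<lambda>x. ereal (v x)) g"
      "(\<integral>\<^sup>+x\<in>T. ennreal \<bar>v x - u x\<bar> \<partial>M) \<le> ennreal e" "(\<integral>\<^sup>+x\<in>U. g x \<partial>M) \<le> TV u U + ennreal e"
proof -
  have "TV u U < TV u U + ennreal e"
    using assms ennreal_add_left_cancel_less[of "TV u U" 0 "ennreal e"] by simp
  from TV_lessD[OF this assms(2-4)] show thesis using that less_imp_le by blast
qed

lemma TV_mono:
  assumes "U \<subseteq> V"
  shows "TV u U \<le> TV u V"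
  unfolding total_variation_open_def[of _ _ V]
proof (rule Inf_greatest, clarify)
  fix v g assume vg: "\<forall>i. lip_loc V (v i)" "converges_L1_loc \<mu> V v u"
    "\<forall>i. upper_gradient V (\<lambda>x. ereal (v i x)) (g i)"
  have "TV u U \<le> liminf (\<lambda>i. \<integral>\<^sup>+x\<in>U. g i x \<partial>M)"
    unfolding total_variation_open_def
    by (rule Inf_lower)
       (use vg assms in \<open>auto simp: lip_loc_def converges_L1_loc_def
          intro: upper_gradient_subset compactly_inside_mono intro!: exI[of _ v] exI[of _ g]\<close>)
  also have "\<dots> \<le> liminf (\<lambda>i. \<integral>\<^sup>+x\<in>V. g i x \<partial>M)"
    using assms by (intro Liminf_mono always_eventually allI nn_integral_mono) (auto simp: indicator_def)
  finally show "TV u U \<le> liminf (\<lambda>i. \<integral>\<^sup>+x\<in>V. g i x \<partial>M)" .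
qed

lemma TV_cong:
  assumes "\<And>x. x \<in> U \<Longrightarrow> u x = u' x"
  shows "TV u U = TV u' U"
proof -
  have "(\<integral>\<^sup>+x\<in>T. ennreal \<bar>v x - u x\<bar> \<partial>M) = (\<integral>\<^sup>+x\<in>T. ennreal \<bar>v x - u' x\<bar> \<partial>M)"
    if "compactly_inside T U" for v T
    using assms compactly_inside_subset[OF that]
    by (intro nn_integral_cong) (auto simp: indicator_def)
  then have "converges_L1_loc \<mu> U v u \<longleftrightarrow> converges_L1_loc \<mu> U v u'" for v
    unfolding converges_L1_loc_def by simp
  then show ?thesis unfolding total_variation_open_def by simp
qed

text \<open>One approximating sequence on \<open>W\<close> restricts to both parts, where its
  gradients are integrated over disjoint sets.\<close>

lemma TV_superadditive:
  assumes "open U" "open V" "U \<inter> V = {}" "U \<subseteq> W" "V \<subseteq> W"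
  shows "TV u U + TV u V \<le> TV u W"
  unfolding total_variation_open_def[of _ _ W]
proof (rule Inf_greatest, clarify)
  fix v g assume vg: "\<forall>i. lip_loc W (v i)" "converges_L1_loc \<mu> W v u"
    "\<forall>i. upper_gradient W (\<lambda>x. ereal (v i x)) (g i)"
  have *: "TV u X \<le> liminf (\<lambda>i. \<integral>\<^sup>+x\<in>X. g i x \<partial>M)" if "X \<subseteq> W" for X
    unfolding total_variation_open_def
    by (rule Inf_lower)
       (use vg that in \<open>auto simp: lip_loc_def converges_L1_loc_def
          intro: upper_gradient_subset compactly_inside_mono intro!: exI[of _ v] exI[of _ g]\<close>)
  have meas: "(\<lambda>x. g i x * indicator X x) \<in> borel_measurable M" if "X \<subseteq> W" "open X" for X i
    using borel_measurable_restrict_subset[OF upper_gradientD(1)[OF vg(3)[rule_format]] that(1)] that(2)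
    by (rule restrict_borel_measurable)
  have "TV u U + TV u V \<le> liminf (\<lambda>i. (\<integral>\<^sup>+x\<in>U. g i x \<partial>M) + (\<integral>\<^sup>+x\<in>V. g i x \<partial>M))"
    using add_mono[OF *[OF assms(4)] *[OF assms(5)]] liminf_add_le_ennreal order_trans by blast
  also have "\<dots> \<le> liminf (\<lambda>i. \<integral>\<^sup>+x\<in>W. g i x \<partial>M)"
  proof (intro Liminf_mono always_eventually allI)
    fix i
    have "(\<integral>\<^sup>+x\<in>U. g i x \<partial>M) + (\<integral>\<^sup>+x\<in>V. g i x \<partial>M)
        = (\<integral>\<^sup>+x. g i x * indicator U x + g i x * indicator V x \<partial>M)"
      by (rule nn_integral_add[symmetric]) (use meas assms in auto)
    also have "\<dots> \<le> (\<integral>\<^sup>+x\<in>W. g i x \<partial>M)"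
      using assms by (intro nn_integral_mono) (auto simp: indicator_def)
    finally show "(\<integral>\<^sup>+x\<in>U. g i x \<partial>M) + (\<integral>\<^sup>+x\<in>V. g i x \<partial>M) \<le> (\<integral>\<^sup>+x\<in>W. g i x \<partial>M)" .
  qed
  finally show "TV u U + TV u V \<le> liminf (\<lambda>i. \<integral>\<^sup>+x\<in>W. g i x \<partial>M)" .
qed

lemma TV_superadditive_finite:
  assumes "finite I" "\<And>i. i \<in> I \<Longrightarrow> open (A i)" "disjoint_family_on A I" "\<And>i. i \<in> I \<Longrightarrow> A i \<subseteq> W"
  shows "(\<Sum>i\<in>I. TV u (A i)) \<le> TV u W"
proof -
  have "(\<Sum>i\<in>I. TV u (A i)) \<le> TV u (\<Union>i\<in>I. A i)"
    using assms(1-3)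
  proof (induction I)
    case (insert j J)
    have "(\<Sum>i\<in>J. TV u (A i)) \<le> TV u (\<Union>i\<in>J. A i)"
      using insert by (auto simp: disjoint_family_on_def)
    then have "(\<Sum>i\<in>insert j J. TV u (A i)) \<le> TV u (A j) + TV u (\<Union>i\<in>J. A i)"
      using insert by (simp add: add_left_mono)
    also have "\<dots> \<le> TV u (\<Union>i\<in>insert j J. A i)"
      by (rule TV_superadditive) (use insert in \<open>auto simp: disjoint_family_on_def\<close>)
    finally show ?case .
  qed simp
  also have "\<dots> \<le> TV u W" by (rule TV_mono) (use assms(4) in blast)
  finally show ?thesis .
qed

lemma TV_empty [simp]: "TV u {} = 0"
proof -
  have "TV u {} \<le> 0"
  proof (rule TV_leI)
    fix T and e :: real assume T: "compactly_inside T ({} :: 'a set)" "0 < e"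
    have "upper_gradient {} (\<lambda>x::'a. ereal 0) (\<lambda>_. ennreal 0)"
      by (rule upper_gradient_lipschitz[where L = 0]) simp
    then show "\<exists>v g. locally_lipschitz ({}::'a set) v \<and> upper_gradient {} (\<lambda>x. ereal (v x)) g \<and>
        (\<integral>\<^sup>+x\<in>T. ennreal \<bar>v x - u x\<bar> \<partial>M) \<le> ennreal e \<and> (\<integral>\<^sup>+x\<in>{}. g x \<partial>M) \<le> 0 + ennreal e"
      using T compactly_inside_subset[of T "{}"]
      by (intro exI[of _ "\<lambda>_. 0"] exI[of _ "\<lambda>_. 0"]) (simp add: locally_lipschitz_def)
  qed simp
  then show ?thesis by simp
qed

lemma TV_const: "open U \<Longrightarrow> TV (\<lambda>_. c) U = 0"
proof -
  assume "open U"
  then have "TV (\<lambda>_. c) U \<le> 0"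
  proof (rule TV_leI)
    fix T and e :: real assume T: "compactly_inside T U" "0 < e"
    have "upper_gradient U (\<lambda>x::'a. ereal c) (\<lambda>_. ennreal 0)"
      by (rule upper_gradient_lipschitz[where L = 0]) (rule lipschitz_on_constant)
    then show "\<exists>v g. locally_lipschitz U v \<and> upper_gradient U (\<lambda>x. ereal (v x)) g \<and>
        (\<integral>\<^sup>+x\<in>T. ennreal \<bar>v x - c\<bar> \<partial>M) \<le> ennreal e \<and> (\<integral>\<^sup>+x\<in>U. g x \<partial>M) \<le> 0 + ennreal e"
      by (intro exI[of _ "\<lambda>_. c"] exI[of _ "\<lambda>_. 0"])
         (simp add: locally_lipschitz_lipschitz[OF lipschitz_on_constant])
  qed
  then show ?thesis by simp
qed

lemma TV_add:
  assumes U: "open U" and u: "u \<in> borel_measurable M" and w: "w \<in> borel_measurable M"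
  shows "TV (\<lambda>x. u x + w x) U \<le> TV u U + TV w U"
proof (cases "TV u U < top \<and> TV w U < top")
  case True
  show ?thesis
  proof (rule TV_leI[OF U])
    fix T and e :: real assume T: "compactly_inside T U" and e: "0 < e"
    obtain v g where v: "locally_lipschitz U v" "upper_gradient U (\<lambda>x. ereal (v x)) g"
      "(\<integral>\<^sup>+x\<in>T. ennreal \<bar>v x - u x\<bar> \<partial>M) \<le> ennreal (e / 2)" "(\<integral>\<^sup>+x\<in>U. g x \<partial>M) \<le> TV u U + ennreal (e / 2)"
      using TV_approx[of u U T "e / 2"] True U T e by auto
    obtain v' g' where v': "locally_lipschitz U v'" "upper_gradient U (\<lambda>x. ereal (v' x)) g'"
      "(\<integral>\<^sup>+x\<in>T. ennreal \<bar>v' x - w x\<bar> \<partial>M) \<le> ennreal (e / 2)" "(\<integral>\<^sup>+x\<in>U. g' x \<partial>M) \<le> TV w U + ennreal (e / 2)"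
      using TV_approx[of w U T "e / 2"] True U T e by auto
    have e2: "ennreal (e / 2) + ennreal (e / 2) = ennreal e" using e by (simp flip: ennreal_plus)
    note mT = L1_integrand_measurable[OF _ U compactly_inside_open[OF T] compactly_inside_subset[OF T]]
    have "(\<integral>\<^sup>+x\<in>T. ennreal \<bar>v x + v' x - (u x + w x)\<bar> \<partial>M)
        \<le> (\<integral>\<^sup>+x. ennreal \<bar>v x - u x\<bar> * indicator T x + ennreal \<bar>v' x - w x\<bar> * indicator T x \<partial>M)"
      by (intro nn_integral_mono) (auto simp: indicator_def simp flip: ennreal_plus)
    also have "\<dots> = (\<integral>\<^sup>+x\<in>T. ennreal \<bar>v x - u x\<bar> \<partial>M) + (\<integral>\<^sup>+x\<in>T. ennreal \<bar>v' x - w x\<bar> \<partial>M)"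
      by (intro nn_integral_add mT u w locally_lipschitz_continuous v(1) v'(1))
    also have "\<dots> \<le> ennreal e" using add_mono[OF v(3) v'(3)] by (simp add: e2)
    finally have 1: "(\<integral>\<^sup>+x\<in>T. ennreal \<bar>v x + v' x - (u x + w x)\<bar> \<partial>M) \<le> ennreal e" .
    have "(\<integral>\<^sup>+x\<in>U. (g x + g' x) \<partial>M) = (\<integral>\<^sup>+x\<in>U. g x \<partial>M) + (\<integral>\<^sup>+x\<in>U. g' x \<partial>M)"
      unfolding distrib_right
      by (intro nn_integral_add restrict_borel_measurable upper_gradientD(1)[OF v(2)] upper_gradientD(1)[OF v'(2)] U)
    also have "\<dots> \<le> (TV u U + ennreal (e / 2)) + (TV w U + ennreal (e / 2))"
      by (rule add_mono[OF v(4) v'(4)])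
    also have "\<dots> = TV u U + TV w U + ennreal e" by (simp add: e2[symmetric] ac_simps)
    finally show "\<exists>v g. locally_lipschitz U v \<and> upper_gradient U (\<lambda>x. ereal (v x)) g \<and>
        (\<integral>\<^sup>+x\<in>T. ennreal \<bar>v x - (u x + w x)\<bar> \<partial>M) \<le> ennreal e \<and>
        (\<integral>\<^sup>+x\<in>U. g x \<partial>M) \<le> TV u U + TV w U + ennreal e"
      using 1 locally_lipschitz_add[OF v(1) v'(1)] upper_gradient_add[OF v(2) v'(2)] by blast
  qed
qed (auto simp: less_top[symmetric])

lemma TV_compose:
  assumes U: "open U" and u: "u \<in> borel_measurable M"
    and f: "\<And>s t :: real. \<bar>f s - f t\<bar> \<le> c * \<bar>s - t\<bar>" and c: "0 < c"
  shows "TV (\<lambda>x. f (u x)) U \<le> ennreal c * TV u U"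
proof (cases "TV u U < top")
  case True
  show ?thesis
  proof (rule TV_leI[OF U])
    fix T and e :: real assume T: "compactly_inside T U" and e: "0 < e"
    obtain v g where v: "locally_lipschitz U v" "upper_gradient U (\<lambda>x. ereal (v x)) g"
      "(\<integral>\<^sup>+x\<in>T. ennreal \<bar>v x - u x\<bar> \<partial>M) \<le> ennreal (e / c)" "(\<integral>\<^sup>+x\<in>U. g x \<partial>M) \<le> TV u U + ennreal (e / c)"
      using TV_approx[of u U T "e / c"] True U T e c by auto
    have ce: "ennreal c * ennreal (e / c) = ennreal e" using c e by (simp flip: ennreal_mult)
    have scale: "(\<integral>\<^sup>+x\<in>T. ennreal \<bar>f (v x) - f (u x)\<bar> \<partial>M) \<le> ennreal c * (\<integral>\<^sup>+x\<in>T. ennreal \<bar>v x - u x\<bar> \<partial>M)"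
    proof -
      have "(\<integral>\<^sup>+x\<in>T. ennreal \<bar>f (v x) - f (u x)\<bar> \<partial>M) \<le> (\<integral>\<^sup>+x. ennreal c * (ennreal \<bar>v x - u x\<bar> * indicator T x) \<partial>M)"
        using f c by (intro nn_integral_mono) (auto simp: indicator_def simp flip: ennreal_mult)
      also have "\<dots> = ennreal c * (\<integral>\<^sup>+x\<in>T. ennreal \<bar>v x - u x\<bar> \<partial>M)"
        by (intro nn_integral_cmult L1_integrand_measurable[OF _ U compactly_inside_open[OF T]
          compactly_inside_subset[OF T]] u locally_lipschitz_continuous v(1))
      finally show ?thesis .
    qed
    also have "\<dots> \<le> ennreal e" using mult_left_mono[OF v(3), of "ennreal c"] by (simp add: ce)
    finally have 1: "(\<integral>\<^sup>+x\<in>T. ennreal \<bar>f (v x) - f (u x)\<bar> \<partial>M) \<le> ennreal e" .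
    have "(\<integral>\<^sup>+x\<in>U. (ennreal c * g x) \<partial>M) = ennreal c * (\<integral>\<^sup>+x\<in>U. g x \<partial>M)"
      unfolding mult.assoc
      by (intro nn_integral_cmult restrict_borel_measurable upper_gradientD(1)[OF v(2)] U)
    also have "\<dots> \<le> ennreal c * (TV u U + ennreal (e / c))"
      by (intro mult_left_mono v(4)) simp
    also have "\<dots> = ennreal c * TV u U + ennreal e" by (simp add: distrib_left ce)
    finally show "\<exists>v g. locally_lipschitz U v \<and> upper_gradient U (\<lambda>x. ereal (v x)) g \<and>
        (\<integral>\<^sup>+x\<in>T. ennreal \<bar>v x - f (u x)\<bar> \<partial>M) \<le> ennreal e \<and>
        (\<integral>\<^sup>+x\<in>U. g x \<partial>M) \<le> ennreal c * TV u U + ennreal e"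
      using 1 locally_lipschitz_compose[OF v(1) f] upper_gradient_compose[OF v(2) f] by blast
  qed
qed (use c in \<open>auto simp: less_top[symmetric] ennreal_mult_top\<close>)

text \<open>The two truncations of an approximant have upper gradients supported where it is below
  and above \<open>t\<close>, so together they cost at most the original gradient. This is the
  source of the coarea inequality.\<close>

lemma TV_truncate:
  assumes U: "open U"
  shows "TV (\<lambda>x. min (u x) t) U + TV (\<lambda>x. max (u x) t) U \<le> TV u U"
  unfolding total_variation_open_def[of _ u]
proof (rule Inf_greatest, clarify)
  fix v g assume vg: "\<forall>i. lip_loc U (v i)" "converges_L1_loc \<mu> U v u"
    "\<forall>i. upper_gradient U (\<lambda>x. ereal (v i x)) (g i)"
  have lip: "locally_lipschitz U (v i)" for i using vg(1) lip_loc_iff[OF U] by blast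
  have *: "TV (\<lambda>x. f (u x)) U \<le> liminf (\<lambda>i. \<integral>\<^sup>+x\<in>U. h i x \<partial>M)"
    if f: "\<And>s t :: real. \<bar>f s - f t\<bar> \<le> 1 * \<bar>s - t\<bar>" and h: "\<And>i. upper_gradient U (\<lambda>x. ereal (f (v i x))) (h i)" for f h
    unfolding total_variation_open_def
  proof (rule Inf_lower)
    have "converges_L1_loc \<mu> U (\<lambda>i x. f (v i x)) (\<lambda>x. f (u x))"
      unfolding converges_L1_loc_def
    proof (intro allI impI)
      fix T assume "compactly_inside T U"
      then have "(\<lambda>i. \<integral>\<^sup>+x\<in>T. ennreal \<bar>v i x - u x\<bar> \<partial>M) \<longlonglongrightarrow> 0"
        using vg(2) by (simp add: converges_L1_loc_def)
      then show "(\<lambda>i. \<integral>\<^sup>+x\<in>T. ennreal \<bar>f (v i x) - f (u x)\<bar> \<partial>M) \<longlonglongrightarrow> 0"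
        by (rule tendsto_sandwich[OF _ _ tendsto_const, rotated 2])
           (use f in \<open>auto intro!: always_eventually nn_integral_mono mult_right_mono ennreal_leI\<close>)
    qed
    moreover have "lip_loc U (\<lambda>x. f (v i x))" for i
      using locally_lipschitz_compose[OF lip f] lip_loc_iff[OF U] by blast
    ultimately show "liminf (\<lambda>i. \<integral>\<^sup>+x\<in>U. h i x \<partial>M) \<in> {liminf (\<lambda>i. \<integral>\<^sup>+x\<in>U. g i x \<partial>M) |v g.
        (\<forall>i. lip_loc U (v i)) \<and> converges_L1_loc \<mu> U v (\<lambda>x. f (u x)) \<and>
        (\<forall>i. upper_gradient U (\<lambda>x. ereal (v i x)) (g i))}"
      using h by (intro CollectI exI[of _ "\<lambda>i x. f (v i x)"] exI[of _ h]) simp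
  qed
  define g1 where "g1 i x = g i x * indicator {x. v i x < t} x" for i x
  define g2 where "g2 i x = g i x * indicator {x. t < v i x} x" for i x
  have ug: "upper_gradient U (\<lambda>x. ereal (min (v i x) t)) (g1 i)"
    "upper_gradient U (\<lambda>x. ereal (max (v i x) t)) (g2 i)" for i
    unfolding g1_def g2_def
    using upper_gradient_min upper_gradient_max vg(3) locally_lipschitz_continuous[OF lip] by blast+
  have "TV (\<lambda>x. min (u x) t) U + TV (\<lambda>x. max (u x) t) U
      \<le> liminf (\<lambda>i. (\<integral>\<^sup>+x\<in>U. g1 i x \<partial>M)) + liminf (\<lambda>i. \<integral>\<^sup>+x\<in>U. g2 i x \<partial>M)"
    by (intro add_mono *[of "\<lambda>s. min s t"] *[of "\<lambda>s. max s t"] ug) auto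
  also have "\<dots> \<le> liminf (\<lambda>i. (\<integral>\<^sup>+x\<in>U. g1 i x \<partial>M) + (\<integral>\<^sup>+x\<in>U. g2 i x \<partial>M))"
    by (rule liminf_add_le_ennreal)
  also have "\<dots> \<le> liminf (\<lambda>i. \<integral>\<^sup>+x\<in>U. g i x \<partial>M)"
  proof (intro Liminf_mono always_eventually allI)
    fix i
    have "(\<integral>\<^sup>+x\<in>U. g1 i x \<partial>M) + (\<integral>\<^sup>+x\<in>U. g2 i x \<partial>M)
        = (\<integral>\<^sup>+x. g1 i x * indicator U x + g2 i x * indicator U x \<partial>M)"
      by (intro nn_integral_add[symmetric] restrict_borel_measurable upper_gradientD(1)[OF ug(1)]
          upper_gradientD(1)[OF ug(2)] U)
    also have "\<dots> \<le> (\<integral>\<^sup>+x\<in>U. g i x \<partial>M)"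
      by (intro nn_integral_mono) (auto simp: indicator_def g1_def g2_def)
    finally show "(\<integral>\<^sup>+x\<in>U. g1 i x \<partial>M) + (\<integral>\<^sup>+x\<in>U. g2 i x \<partial>M) \<le> (\<integral>\<^sup>+x\<in>U. g i x \<partial>M)" .
  qed
  finally show "TV (\<lambda>x. min (u x) t) U + TV (\<lambda>x. max (u x) t) U \<le> liminf (\<lambda>i. \<integral>\<^sup>+x\<in>U. g i x \<partial>M)" .
qed

text \<open>An approximant of \<open>w\<close> on \<open>T\<close> also approximates
  \<open>u\<close> there, with the errors added. Since \<open>w\<close> may depend on
  \<open>T\<close> and \<open>e\<close>, closeness on sets compactly inside \<open>U\<close> is all
  that is asked.\<close>

lemma TV_lower_semicontinuous:
  assumes U: "open U" and u: "u \<in> borel_measurable M"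
    and approx: "\<And>T e. compactly_inside T U \<Longrightarrow> 0 < e \<Longrightarrow>
      \<exists>w\<in>borel_measurable M. (\<integral>\<^sup>+x\<in>T. ennreal \<bar>w x - u x\<bar> \<partial>M) \<le> ennreal e \<and> TV w U \<le> c + ennreal e"
  shows "TV u U \<le> c"
proof (cases "c < top")
  case True
  show ?thesis
  proof (rule TV_leI[OF U])
    fix T and e :: real assume T: "compactly_inside T U" and e: "0 < e"
    obtain w where w: "w \<in> borel_measurable M" "(\<integral>\<^sup>+x\<in>T. ennreal \<bar>w x - u x\<bar> \<partial>M) \<le> ennreal (e / 2)"
      "TV w U \<le> c + ennreal (e / 2)"
      using approx[OF T, of "e / 2"] e by auto
    have e2: "ennreal (e / 2) + ennreal (e / 2) = ennreal e" using e by (simp flip: ennreal_plus)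
    have "TV w U < top" using w(3) True by (auto intro: le_less_trans)
    then obtain v g where v: "locally_lipschitz U v" "upper_gradient U (\<lambda>x. ereal (v x)) g"
      "(\<integral>\<^sup>+x\<in>T. ennreal \<bar>v x - w x\<bar> \<partial>M) \<le> ennreal (e / 2)" "(\<integral>\<^sup>+x\<in>U. g x \<partial>M) \<le> TV w U + ennreal (e / 2)"
      using TV_approx[of w U T "e / 2"] U T e by auto
    note [measurable] = u w(1) open_sets_M[OF compactly_inside_open[OF T]]
    have "(\<integral>\<^sup>+x\<in>T. ennreal \<bar>v x - u x\<bar> \<partial>M)
        \<le> (\<integral>\<^sup>+x. ennreal \<bar>v x - w x\<bar> * indicator T x + ennreal \<bar>w x - u x\<bar> * indicator T x \<partial>M)"
      by (intro nn_integral_mono) (auto simp: indicator_def simp flip: ennreal_plus)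
    also have "\<dots> = (\<integral>\<^sup>+x\<in>T. ennreal \<bar>v x - w x\<bar> \<partial>M) + (\<integral>\<^sup>+x\<in>T. ennreal \<bar>w x - u x\<bar> \<partial>M)"
    proof (rule nn_integral_add)
      show "(\<lambda>x. ennreal \<bar>v x - w x\<bar> * indicator T x) \<in> borel_measurable M"
        by (rule L1_integrand_measurable[OF locally_lipschitz_continuous[OF v(1)] U
              compactly_inside_open[OF T] compactly_inside_subset[OF T] w(1)])
    qed measurable
    also have "\<dots> \<le> ennreal e" using add_mono[OF v(3) w(2)] by (simp add: e2)
    finally have 1: "(\<integral>\<^sup>+x\<in>T. ennreal \<bar>v x - u x\<bar> \<partial>M) \<le> ennreal e" .
    have "(\<integral>\<^sup>+x\<in>U. g x \<partial>M) \<le> c + ennreal (e / 2) + ennreal (e / 2)"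
      using v(4) w(3) add_right_mono order_trans by blast
    then have "(\<integral>\<^sup>+x\<in>U. g x \<partial>M) \<le> c + ennreal e" by (simp add: add.assoc e2)
    then show "\<exists>v g. locally_lipschitz U v \<and> upper_gradient U (\<lambda>x. ereal (v x)) g \<and>
        (\<integral>\<^sup>+x\<in>T. ennreal \<bar>v x - u x\<bar> \<partial>M) \<le> ennreal e \<and> (\<integral>\<^sup>+x\<in>U. g x \<partial>M) \<le> c + ennreal e"
      using 1 v(1,2) by blast
  qed
qed (simp add: less_top[symmetric])

lemma total_variation_open_eq:
  assumes "open U"
  shows "total_variation \<mu> u U = TV u U"
  unfolding total_variation_def
  by (rule antisym) (use assms TV_mono in \<open>auto intro!: INF_lower INF_greatest\<close>)

end

section \<open>Gluing along layers\<close>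

lemma clamp_unit_lipschitz: "\<bar>max 0 (min 1 a) - max 0 (min 1 b)\<bar> \<le> 1 * \<bar>a - b\<bar>" for a b :: real
  by (auto simp: max_def min_def)

text \<open>The descent is confined to \<open>[1/3, 2/3]\<close>; the plateaus leave room for open
  neighbourhoods of the integers on which only one \<open>w j\<close> is active.\<close>

definition step_down :: "real \<Rightarrow> real" where "step_down s = max 0 (min 1 (2 - 3 * s))"

lemma step_down_lipschitz: "\<bar>step_down s - step_down t\<bar> \<le> 3 * \<bar>s - t\<bar>"
proof -
  have "\<bar>step_down s - step_down t\<bar> \<le> \<bar>3 * t - 3 * s\<bar>"
    using clamp_unit_lipschitz[of "2 - 3 * s" "2 - 3 * t"] by (simp add: step_down_def)
  also have "\<dots> = 3 * \<bar>s - t\<bar>" by (simp add: abs_if)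
  finally show ?thesis .
qed

lemma step_down_range: "step_down s \<in> {0..1}"
  by (auto simp: step_down_def)

lemma step_down_eq_1: "s \<le> 1/3 \<Longrightarrow> step_down s = 1"
  unfolding step_down_def max_def min_def by simp

lemma step_down_eq_0: "2/3 \<le> s \<Longrightarrow> step_down s = 0"
  unfolding step_down_def max_def min_def by simp

definition layer :: "(nat \<Rightarrow> 'a \<Rightarrow> real) \<Rightarrow> ('a \<Rightarrow> real) \<Rightarrow> nat \<Rightarrow> 'a \<Rightarrow> real" where
  "layer w \<rho> i x = step_down (\<rho> x - i) * w i x + (1 - step_down (\<rho> x - i)) * w (Suc i) x"

definition layered :: "(nat \<Rightarrow> 'a \<Rightarrow> real) \<Rightarrow> ('a \<Rightarrow> real) \<Rightarrow> 'a \<Rightarrow> real" where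
  "layered w \<rho> x = layer w \<rho> (nat \<lfloor>\<rho> x\<rfloor>) x"

lemma layered_between:
  assumes "real i \<le> \<rho> x" "\<rho> x < real i + 1"
  shows "layered w \<rho> x = layer w \<rho> i x"
proof -
  have "\<lfloor>\<rho> x\<rfloor> = int i" using assms by (simp add: floor_eq_iff)
  then show ?thesis by (simp add: layered_def)
qed

text \<open>The index in \<open>layered\<close> jumps where \<open>\<rho>\<close> crosses
  \<open>j\<close>, but the layers on both sides have their plateaus there and give the same
  \<open>w j\<close>.\<close>

lemma layered_near:
  assumes "real j - 1/3 < \<rho> x" "\<rho> x < real j + 1/3" "0 \<le> \<rho> x"
  shows "layered w \<rho> x = w j x"
proof (cases "real j \<le> \<rho> x")
  case True
  then show ?thesis
    using layered_between[of j \<rho> x w] assms by (simp add: layer_def step_down_eq_1)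
next
  case False
  then obtain i where "j = Suc i" using assms(3) by (cases j) auto
  then show ?thesis
    using layered_between[of i \<rho> x w] assms False by (simp add: layer_def step_down_eq_0)
qed

context doubling_space
begin

text \<open>
  Near-optimal approximations \<open>w i\<close> on the sets \<open>D i\<close> are glued where \<open>\<rho>\<close> passes from \<open>i + 1/3\<close> to
  \<open>i + 2/3\<close>.  The extra gradient there is \<open>\<bar>w i - w (i + 1)\<bar>\<close> times a Lipschitz constant that is known
  before the \<open>w i\<close> are chosen, so its integral can be made as small as desired.
\<close>

lemma TV_layered_le:
  fixes \<rho> :: "'a \<Rightarrow> real" and D T :: "nat \<Rightarrow> 'a set" and L :: "nat \<Rightarrow> real"
  assumes U: "open U" and u: "u \<in> borel_measurable M"
    and \<rho>: "locally_lipschitz U \<rho>" and \<rho>0: "\<And>x. x \<in> U \<Longrightarrow> 0 \<le> \<rho> x"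
    and D: "\<And>i. open (D i)"
    and cover: "\<And>i x. x \<in> U \<Longrightarrow> real i - 1 < \<rho> x \<Longrightarrow> \<rho> x < real i + 1 \<Longrightarrow> x \<in> D i"
    and T: "\<And>i. compactly_inside (T i) (D i \<inter> D (Suc i))"
    and TL: "\<And>i. (L i)-lipschitz_on (T i) \<rho>"
    and Tc: "\<And>i x. x \<in> U \<Longrightarrow> real i + 1/3 \<le> \<rho> x \<Longrightarrow> \<rho> x \<le> real i + 2/3 \<Longrightarrow> x \<in> T i"
  shows "TV u U \<le> (\<Sum>i. TV u (D i))"
proof (cases "(\<Sum>i. TV u (D i)) < top")
  case True
  have TVD: "TV u (D i) < top" for i
  proof -
    have "sum (\<lambda>i. TV u (D i)) {i} \<le> (\<Sum>i. TV u (D i))" by (rule sum_le_suminf) auto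
    then show ?thesis using True by (auto intro: le_less_trans)
  qed
  have L0: "0 \<le> L i" for i using lipschitz_on_nonneg[OF TL] .
  have To: "open (T i)" and TD: "T i \<subseteq> D i" and TD': "T i \<subseteq> D (Suc i)" for i
    using T[of i] compactly_inside_subset[OF T[of i]] by (auto simp: compactly_inside_def)
  have \<rho>c: "continuous_on U \<rho>" by (rule locally_lipschitz_continuous[OF \<rho>])
  show ?thesis
  proof (rule TV_leI[OF U])
    fix S and e :: real assume S: "compactly_inside S U" and e: "0 < e"
    \<comment> \<open>\<open>w i\<close> has nonzero weight only where \<open>\<rho>\<close> is
      within 2/3 of \<open>i\<close>, so the distance to \<open>u\<close> on \<open>S\<close>
      involves \<open>w i\<close> on \<open>K i\<close> only.\<close>
    define K where "K i = closure S \<inter> \<rho> -` {real i - 2/3..real i + 2/3}" for i :: nat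
    have K: "compact (K i)" "K i \<subseteq> D i" for i
    proof -
      have S': "compact (closure S)" "closure S \<subseteq> U" using S by (auto simp: compactly_inside_def)
      have "closed (K i)"
        unfolding K_def
        by (rule continuous_closed_preimage[OF continuous_on_subset[OF \<rho>c S'(2)]]) auto
      then show "compact (K i)"
        using compact_Int_closed[OF S'(1), of "K i"] by (simp add: K_def Int_absorb1 flip: Int_assoc)
      show "K i \<subseteq> D i" using S'(2) cover[of _ i] by (auto simp: K_def)
    qed
    have "\<exists>Q. compactly_inside Q (D i) \<and> K i \<subseteq> Q" for i
      using compactly_inside_superset[OF D[of i] K] by metis
    then obtain Q where Q: "\<And>i. compactly_inside (Q i) (D i)" "\<And>i. K i \<subseteq> Q i" by metis
    \<comment> \<open>Besides \<open>K i\<close>, the approximant \<open>w i\<close> has to be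
      accurate on the transition zones on both sides, \<open>T i\<close> and
      \<open>T (i - 1)\<close>, where its distance to a neighbour enters the gradient.\<close>
    define R where "R i = Q i \<union> T i \<union> (if i = 0 then {} else T (i - 1))" for i
    have R: "compactly_inside (R i) (D i)" for i
      unfolding R_def
      by (cases i; simp)
         (intro compactly_inside_Un Q compactly_inside_mono[OF T] compactly_inside_empty; blast)+
    have RT: "T i \<subseteq> R i" "T i \<subseteq> R (Suc i)" "K i \<subseteq> R i" for i
      using Q by (auto simp: R_def)

    \<comment> \<open>The error budget of the layers\<close>
    define \<epsilon> where "\<epsilon> i = e * (1/2) ^ Suc i" for i :: nat
    have \<epsilon>0: "0 < \<epsilon> i" for i using e by (simp add: \<epsilon>_def)
    have \<epsilon>sum: "(\<Sum>i. ennreal (\<epsilon> i)) = ennreal e"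
      unfolding \<epsilon>_def using e by (intro suminf_half_powers) simp
    define m where "m i = enn2real (emeasure M (T i))" for i
    have m: "emeasure M (T i) = ennreal (m i)" for i
      using compactly_inside_finite[OF T] by (simp add: m_def)
    have m0: "0 \<le> m i" for i by (simp add: m_def)
    \<comment> \<open>\<open>w i\<close> meets the Lipschitz constants of both adjacent zones, so
      \<open>a i\<close> is divided by a bound for both; the summand 1 also gives
      \<open>a i \<le> \<epsilon> i / 8\<close>. For \<open>i = 0\<close> the truncated
      \<open>i - 1\<close> merely repeats \<open>L 0\<close>.\<close>
    define B where "B i = 1 + 3 * L i + 3 * L (i - 1)" for i
    define a where "a i = \<epsilon> i / (8 * B i)" for i
    \<comment> \<open>The slack of \<open>upper_gradient_leibniz\<close> is constant on
      \<open>T i\<close> and costs \<open>3 * L i * (\<eta> i * m i)\<close> in total; the summand 1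
      keeps the denominator positive.\<close>
    define \<eta> where "\<eta> i = \<epsilon> i / (8 * (1 + 3 * L i * m i))" for i
    have B1: "1 \<le> B i" for i using L0 by (simp add: B_def)
    have a0: "0 < a i" for i using \<epsilon>0 B1[of i] by (simp add: a_def)
    have \<eta>0: "0 < \<eta> i" for i
      unfolding \<eta>_def using \<epsilon>0 L0[of i] m0[of i] by (intro divide_pos_pos mult_pos_pos add_pos_nonneg mult_nonneg_nonneg) auto
    have abound: "c * a i \<le> \<epsilon> i / 8" if "c \<le> B i" for c i
    proof -
      have "c * \<epsilon> i / (8 * B i) \<le> B i * \<epsilon> i / (8 * B i)"
        using that \<epsilon>0[of i] B1[of i] by (intro divide_right_mono mult_right_mono) auto
      also have "\<dots> = \<epsilon> i / 8" using B1[of i] by simp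
      finally show ?thesis by (simp add: a_def)
    qed
    have \<eta>bound: "3 * L i * (\<eta> i * m i) \<le> \<epsilon> i / 8" for i
    proof -
      have pos: "0 < 1 + 3 * L i * m i" using L0[of i] m0[of i] by (simp add: add_pos_nonneg)
      have "3 * L i * (\<eta> i * m i) = (3 * L i * m i) * \<epsilon> i / (8 * (1 + 3 * L i * m i))"
        by (simp add: \<eta>_def)
      also have "\<dots> \<le> (1 + 3 * L i * m i) * \<epsilon> i / (8 * (1 + 3 * L i * m i))"
        using pos \<epsilon>0[of i] by (intro divide_right_mono mult_right_mono) auto
      also have "\<dots> = \<epsilon> i / 8"
      proof -
        have "c * \<epsilon> i / (8 * c) = \<epsilon> i / 8" if "0 < c" for c using that by simp
        then show ?thesis using pos by blast
      qed
      finally show ?thesis .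
    qed
    have weights: "3 * L i * (a i + a (Suc i) + \<eta> i * m i) \<le> \<epsilon> i / 2" for i
    proof -
      have "3 * L i * a i \<le> \<epsilon> i / 8" by (rule abound) (use L0 in \<open>simp add: B_def\<close>)
      moreover have "3 * L i * a (Suc i) \<le> \<epsilon> (Suc i) / 8" by (rule abound) (use L0 in \<open>simp add: B_def\<close>)
      moreover have "\<epsilon> (Suc i) \<le> \<epsilon> i" using e by (simp add: \<epsilon>_def)
      ultimately show ?thesis using \<eta>bound[of i] \<epsilon>0[of i] by (simp add: distrib_left)
    qed
    have "\<forall>i. \<exists>w g. locally_lipschitz (D i) w \<and> upper_gradient (D i) (\<lambda>x. ereal (w x)) g \<and>
        (\<integral>\<^sup>+x\<in>R i. ennreal \<bar>w x - u x\<bar> \<partial>M) \<le> ennreal (a i) \<and>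
        (\<integral>\<^sup>+x\<in>D i. g x \<partial>M) \<le> TV u (D i) + ennreal (a i)"
    proof
      fix i
      show "\<exists>w g. locally_lipschitz (D i) w \<and> upper_gradient (D i) (\<lambda>x. ereal (w x)) g \<and>
        (\<integral>\<^sup>+x\<in>R i. ennreal \<bar>w x - u x\<bar> \<partial>M) \<le> ennreal (a i) \<and>
        (\<integral>\<^sup>+x\<in>D i. g x \<partial>M) \<le> TV u (D i) + ennreal (a i)"
        by (rule TV_approx[OF TVD[of i] D[of i] R[of i] a0[of i]]) blast
    qed
    from choice[OF this] obtain w where "\<forall>i. \<exists>g. locally_lipschitz (D i) (w i) \<and>
        upper_gradient (D i) (\<lambda>x. ereal (w i x)) g \<and>
        (\<integral>\<^sup>+x\<in>R i. ennreal \<bar>w i x - u x\<bar> \<partial>M) \<le> ennreal (a i) \<and>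
        (\<integral>\<^sup>+x\<in>D i. g x \<partial>M) \<le> TV u (D i) + ennreal (a i)" ..
    from choice[OF this] obtain g where w: "\<And>i. locally_lipschitz (D i) (w i)"
        "\<And>i. upper_gradient (D i) (\<lambda>x. ereal (w i x)) (g i)"
        "\<And>i. (\<integral>\<^sup>+x\<in>R i. ennreal \<bar>w i x - u x\<bar> \<partial>M) \<le> ennreal (a i)"
        "\<And>i. (\<integral>\<^sup>+x\<in>D i. g i x \<partial>M) \<le> TV u (D i) + ennreal (a i)"
      by blast

    \<comment> \<open>The glued function and its candidate gradient\<close>
    note wc = locally_lipschitz_continuous[OF w(1)]
    define h where "h = layered w \<rho>"
    \<comment> \<open>The Leibniz cost on \<open>T i\<close>: the distance of the two neighbours
      plus the slack, times the Lipschitz constant \<open>3 * L i\<close> of the cutoff.\<close>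
    define k where "k i x = ennreal (\<bar>w i x - w (Suc i) x\<bar> + \<eta> i) * (ennreal 3 * ennreal (L i))" for i x
    define G where "G x = (\<Sum>i. g i x * indicator (D i) x) + (\<Sum>i. k i x * indicator (T i) x)" for x
    have gm: "(\<lambda>x. g i x * indicator (D i) x) \<in> borel_measurable borel" for i
      by (rule ennreal_restrict_borel[OF upper_gradientD(1)[OF w(2)] D])
    have km: "(\<lambda>x. k i x * indicator (T i) x) \<in> borel_measurable borel" for i
    proof -
      note [measurable] = continuous_restrict_borel[OF wc To TD, of i]
        continuous_restrict_borel[OF wc To TD', of i] borel_open[OF To, of i]
      have "(\<lambda>x. ennreal (\<bar>w i x * indicator (T i) x - w (Suc i) x * indicator (T i) x\<bar> + \<eta> i)
          * (ennreal 3 * ennreal (L i)) * indicator (T i) x) \<in> borel_measurable borel"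
        by measurable
      also have "(\<lambda>x. ennreal (\<bar>w i x * indicator (T i) x - w (Suc i) x * indicator (T i) x\<bar> + \<eta> i)
          * (ennreal 3 * ennreal (L i)) * indicator (T i) x) = (\<lambda>x. k i x * indicator (T i) x)"
        by (auto simp: indicator_def k_def)
      finally show ?thesis .
    qed
    have Gm: "G \<in> borel_measurable borel"
      unfolding G_def using gm km by measurable
    have gG: "(\<Sum>i\<in>I. g i x) \<le> (\<Sum>i. g i x * indicator (D i) x)" if "finite I" "\<And>i. i \<in> I \<Longrightarrow> x \<in> D i" for I x
    proof -
      have "(\<Sum>i\<in>I. g i x) = (\<Sum>i\<in>I. g i x * indicator (D i) x)" using that by (intro sum.cong) auto
      also have "\<dots> \<le> (\<Sum>i. g i x * indicator (D i) x)" by (rule sum_le_suminf) (use that in auto)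
      finally show ?thesis .
    qed
    have kG: "k i x \<le> (\<Sum>i. k i x * indicator (T i) x)" if "x \<in> T i" for i x
    proof -
      have "k i x = (\<Sum>i\<in>{i}. k i x * indicator (T i) x)" using that by simp
      also have "\<dots> \<le> (\<Sum>i. k i x * indicator (T i) x)" by (rule sum_le_suminf) auto
      finally show ?thesis .
    qed
    \<comment> \<open>The open sets \<open>N j\<close>, where a single approximant is active, and
      \<open>P i\<close>, where two are mixed, cover \<open>U\<close>. Lipschitz continuity and the
      upper gradient property are local and are checked on each kind.\<close>
    define N where "N j = U \<inter> \<rho> -` {real j - 1/3<..<real j + 1/3}" for j :: nat
    define P where "P i = T i \<inter> (U \<inter> \<rho> -` {real i<..<real i + 1})" for i :: nat
    have No: "open (N j)" for j
      unfolding N_def by (rule continuous_open_preimage[OF \<rho>c U]) simp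
    have Po: "open (P i)" for i
      unfolding P_def by (intro open_Int To continuous_open_preimage[OF \<rho>c U]) simp
    have hN: "h x = w j x" if "x \<in> N j" for x j
      using that \<rho>0 layered_near[of j \<rho> x w] by (auto simp: N_def h_def)
    have hP: "h x = layer w \<rho> i x" if "x \<in> P i" for x i
      using that layered_between[of i \<rho> x w] by (auto simp: P_def h_def)
    have ND: "N j \<subseteq> D j" "N j \<subseteq> U" for j using cover[of _ j] by (auto simp: N_def)
    have NP: "(\<exists>j. x \<in> N j) \<or> (\<exists>i. x \<in> P i)" if "x \<in> U" for x
    proof -
      define i where "i = nat \<lfloor>\<rho> x\<rfloor>"
      have i: "real i \<le> \<rho> x" "\<rho> x < real i + 1" using \<rho>0[OF that] by (auto simp: i_def)
      consider "\<rho> x < real i + 1/3" | "real i + 1/3 \<le> \<rho> x" "\<rho> x \<le> real i + 2/3" | "real i + 2/3 < \<rho> x"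
        by linarith
      then show ?thesis
      proof cases
        case 1
        then have "x \<in> N i" using i that by (simp add: N_def)
        then show ?thesis by blast
      next
        case 2
        then have "x \<in> P i" using i that Tc[of x i] by (simp add: P_def)
        then show ?thesis by blast
      next
        case 3
        then have "x \<in> N (Suc i)" using i that by (simp add: N_def)
        then show ?thesis by blast
      qed
    qed
    have lipP: "locally_lipschitz (P i) (layer w \<rho> i)" for i
    proof -
      have f: "locally_lipschitz (P i) (\<lambda>x. f (\<rho> x))" if "\<And>s t. \<bar>f s - f t\<bar> \<le> 3 * \<bar>s - t\<bar>" for f :: "real \<Rightarrow> real"
        by (rule locally_lipschitz_compose[OF locally_lipschitz_subset[OF \<rho>] that]) (auto simp: P_def)
      have sd: "\<bar>step_down (s - real i) - step_down (t - real i)\<bar> \<le> 3 * \<bar>s - t\<bar>" for s t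
        using step_down_lipschitz[of "s - real i" "t - real i"] by simp
      have "locally_lipschitz (P i) (\<lambda>x. step_down (\<rho> x - real i))"
        by (rule f[of "\<lambda>s. step_down (s - real i)"]) (rule sd)
      moreover have "locally_lipschitz (P i) (\<lambda>x. 1 - step_down (\<rho> x - real i))"
        by (rule f[of "\<lambda>s. 1 - step_down (s - real i)"]) (use sd in \<open>simp add: abs_minus_commute\<close>)
      moreover have "locally_lipschitz (P i) (w i)" "locally_lipschitz (P i) (w (Suc i))"
        using TD[of i] TD'[of i] by (auto simp: P_def intro!: locally_lipschitz_subset[OF w(1)])
      ultimately show ?thesis
        unfolding layer_def by (intro locally_lipschitz_add locally_lipschitz_mult)
    qed
    have lip: "locally_lipschitz U h"
    proof (rule locally_lipschitz_cong_local)
      fix x assume "x \<in> U"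
      then consider j where "x \<in> N j" | i where "x \<in> P i" using NP by blast
      then show "\<exists>N h'. open N \<and> x \<in> N \<and> locally_lipschitz N h' \<and> (\<forall>y\<in>N. h y = h' y)"
      proof cases
        case 1
        then show ?thesis using No hN locally_lipschitz_subset[OF w(1) ND(1)] by blast
      next
        case 2
        then show ?thesis using Po hP lipP by blast
      qed
    qed
    have ugN: "upper_gradient (N j) (\<lambda>x. ereal (h x)) G" for j
    proof (rule upper_gradient_mono[OF upper_gradient_subset[OF w(2) ND(1)]])
      show "G \<in> borel_measurable (restrict_space borel (N j))" using Gm by (rule measurable_restrict_space1)
      show "g j x \<le> G x" if "x \<in> N j" for x
      proof -
        have "x \<in> D j" using that ND(1) by blast
        then have "g j x \<le> (\<Sum>i. g i x * indicator (D i) x)" using gG[of "{j}" x] by simp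
        then show ?thesis unfolding G_def by (rule add_increasing2[rotated]) simp
      qed
      show "w j x = h x" if "x \<in> N j" for x using hN[OF that] by simp
    qed
    have ugP: "upper_gradient (P i) (\<lambda>x. ereal (h x)) G" for i
    proof (rule upper_gradient_mono)
      have PD: "P i \<subseteq> D i" "P i \<subseteq> D (Suc i)" "P i \<subseteq> T i" using TD[of i] TD'[of i] by (auto simp: P_def)
      have "upper_gradient (P i) (\<lambda>x. ereal (step_down (\<rho> x - real i))) (\<lambda>_. ennreal 3 * ennreal (L i))"
        by (rule upper_gradient_compose[where f = "\<lambda>s. step_down (s - real i)",
              OF upper_gradient_lipschitz[OF lipschitz_on_subset[OF TL PD(3)]]])
           (use step_down_lipschitz in \<open>metis diff_diff_eq2 diff_add_cancel\<close>)
      then show "upper_gradient (P i) (\<lambda>x. ereal (layer w \<rho> i x)) (\<lambda>x. g i x + g (Suc i) x + k i x)"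
        unfolding layer_def k_def
        by (intro upper_gradient_leibniz upper_gradient_subset[OF w(2)] continuous_on_subset[OF wc] PD step_down_range \<eta>0)
      show "G \<in> borel_measurable (restrict_space borel (P i))" using Gm by (rule measurable_restrict_space1)
      show "g i x + g (Suc i) x + k i x \<le> G x" if "x \<in> P i" for x
        using gG[of "{i, Suc i}" x] kG[of x i] that PD by (auto simp: G_def intro!: add_mono)
      show "layer w \<rho> i x = h x" if "x \<in> P i" for x using hP[OF that] by simp
    qed
    have ug: "upper_gradient U (\<lambda>x. ereal (h x)) G"
    proof (rule upper_gradientI_local)
      show "G \<in> borel_measurable (restrict_space borel U)" using Gm by (rule measurable_restrict_space1)
      fix x assume "x \<in> U"
      then consider j where "x \<in> N j" | i where "x \<in> P i" using NP by blast
      then show "\<exists>N. open N \<and> x \<in> N \<and> upper_gradient (N \<inter> U) (\<lambda>x. ereal (h x)) G"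
      proof cases
        case (1 j)
        then show ?thesis using No[of j] upper_gradient_subset[OF ugN[of j], of "N j \<inter> U"] by blast
      next
        case (2 i)
        then show ?thesis using Po[of i] upper_gradient_subset[OF ugP[of i], of "P i \<inter> U"] by blast
      qed
    qed

    \<comment> \<open>Distance of the glued function to \<open>u\<close>\<close>
    have dist: "(\<integral>\<^sup>+x\<in>S. ennreal \<bar>h x - u x\<bar> \<partial>M) \<le> ennreal e"
    proof -
      let ?d = "\<lambda>i x. ennreal \<bar>w i x - u x\<bar> * indicator (R i) x"
      have "(\<integral>\<^sup>+x\<in>S. ennreal \<bar>h x - u x\<bar> \<partial>M) \<le> (\<integral>\<^sup>+x. (\<Sum>i. ?d i x) \<partial>M)"
      proof (rule nn_integral_mono)
        fix x
        show "ennreal \<bar>h x - u x\<bar> * indicator S x \<le> (\<Sum>i. ?d i x)"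
        proof (cases "x \<in> S")
          case True
          then have x: "x \<in> U" "x \<in> closure S" using compactly_inside_subset[OF S] closure_subset by auto
          define i where "i = nat \<lfloor>\<rho> x\<rfloor>"
          have i: "real i \<le> \<rho> x" "\<rho> x < real i + 1" using \<rho>0[OF x(1)] by (auto simp: i_def)
          define s where "s = step_down (\<rho> x - real i)"
          have s: "0 \<le> s" "s \<le> 1" using step_down_range by (auto simp: s_def)
          \<comment> \<open>A convex combination of the two errors; a term of nonzero weight has
            \<open>x\<close> in the corresponding \<open>K\<close>.\<close>
          have "h x - u x = s * (w i x - u x) + (1 - s) * (w (Suc i) x - u x)"
            using layered_between[of i \<rho> x w] i by (simp add: h_def layer_def s_def algebra_simps)
          then have "\<bar>h x - u x\<bar> \<le> s * \<bar>w i x - u x\<bar> + (1 - s) * \<bar>w (Suc i) x - u x\<bar>"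
            using s abs_triangle_ineq[of "s * (w i x - u x)" "(1 - s) * (w (Suc i) x - u x)"] by (simp add: abs_mult)
          then have "ennreal \<bar>h x - u x\<bar> \<le> ennreal (s * \<bar>w i x - u x\<bar>) + ennreal ((1 - s) * \<bar>w (Suc i) x - u x\<bar>)"
            using s by (simp flip: ennreal_plus)
          also have "\<dots> \<le> ?d i x + ?d (Suc i) x"
          proof (rule add_mono)
            show "ennreal (s * \<bar>w i x - u x\<bar>) \<le> ?d i x"
            proof (cases "\<rho> x \<le> real i + 2/3")
              case True
              then have "x \<in> K i" using x i by (simp add: K_def)
              then show ?thesis using RT(3)[of i] s mult_right_mono[of s 1 "\<bar>w i x - u x\<bar>"] by (auto simp: ennreal_leI)
            next
              case False
              then have "s = 0" by (simp add: s_def step_down_eq_0)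
              then show ?thesis by simp
            qed
            show "ennreal ((1 - s) * \<bar>w (Suc i) x - u x\<bar>) \<le> ?d (Suc i) x"
            proof (cases "real i + 1/3 \<le> \<rho> x")
              case True
              then have "x \<in> K (Suc i)" using x i by (simp add: K_def)
              then show ?thesis using RT(3)[of "Suc i"] s mult_right_mono[of "1 - s" 1 "\<bar>w (Suc i) x - u x\<bar>"]
                by (auto simp: ennreal_leI)
            next
              case False
              then have "s = 1" by (simp add: s_def step_down_eq_1)
              then show ?thesis by simp
            qed
          qed
          also have "\<dots> = sum (\<lambda>i. ?d i x) {i, Suc i}"
            by (subst sum.insert) (simp_all only: sum.insert finite.intros sum.empty add_0_right
                empty_iff insert_iff simp_thms n_not_Suc_n not_False_eq_True)
          also have "\<dots> \<le> (\<Sum>i. ?d i x)" by (rule sum_le_suminf) auto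
          finally show ?thesis using True by simp
        qed simp
      qed
      also have "\<dots> = (\<Sum>i. \<integral>\<^sup>+x. ?d i x \<partial>M)"
        by (rule nn_integral_suminf)
           (rule L1_integrand_measurable[OF wc D compactly_inside_open[OF R] compactly_inside_subset[OF R] u])
      also have "\<dots> \<le> (\<Sum>i. ennreal (\<epsilon> i))"
      proof (rule suminf_le)
        fix i
        have "a i \<le> \<epsilon> i" using abound[of 1 i] B1[of i] \<epsilon>0[of i] by simp
        then show "(\<integral>\<^sup>+x. ?d i x \<partial>M) \<le> ennreal (\<epsilon> i)" using w(3)[of i] by (meson ennreal_leI order_trans)
      qed auto
      finally show ?thesis by (simp add: \<epsilon>sum)
    qed

    \<comment> \<open>The integral of the gradient\<close>
    have grad: "(\<integral>\<^sup>+x\<in>U. G x \<partial>M) \<le> (\<Sum>i. TV u (D i)) + ennreal e"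
    proof -
      have "(\<integral>\<^sup>+x\<in>U. G x \<partial>M) \<le> (\<integral>\<^sup>+x. G x \<partial>M)"
        by (intro nn_integral_mono) (auto simp: indicator_def)
      also have "\<dots> = (\<integral>\<^sup>+x. (\<Sum>i. g i x * indicator (D i) x) \<partial>M) + (\<integral>\<^sup>+x. (\<Sum>i. k i x * indicator (T i) x) \<partial>M)"
        unfolding G_def
        by (intro nn_integral_add borel_measurable_suminf_order borel_measurable_M gm km)
      also have "(\<integral>\<^sup>+x. (\<Sum>i. g i x * indicator (D i) x) \<partial>M) = (\<Sum>i. \<integral>\<^sup>+x\<in>D i. g i x \<partial>M)"
        by (intro nn_integral_suminf borel_measurable_M gm)
      also have "(\<integral>\<^sup>+x. (\<Sum>i. k i x * indicator (T i) x) \<partial>M) = (\<Sum>i. \<integral>\<^sup>+x\<in>T i. k i x \<partial>M)"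
        by (intro nn_integral_suminf borel_measurable_M km)
      also have "(\<Sum>i. \<integral>\<^sup>+x\<in>D i. g i x \<partial>M) + (\<Sum>i. \<integral>\<^sup>+x\<in>T i. k i x \<partial>M)
          \<le> (\<Sum>i. TV u (D i) + ennreal (\<epsilon> i / 2)) + (\<Sum>i. ennreal (\<epsilon> i / 2))"
      proof (intro add_mono suminf_le)
        fix i
        have "a i \<le> \<epsilon> i / 2" using abound[of 1 i] B1[of i] \<epsilon>0[of i] by simp
        then show "(\<integral>\<^sup>+x\<in>D i. g i x \<partial>M) \<le> TV u (D i) + ennreal (\<epsilon> i / 2)"
          using w(4)[of i] by (meson add_left_mono ennreal_leI order_trans)
        let ?d = "\<lambda>j x. ennreal \<bar>w j x - u x\<bar> * indicator (T i) x"
        have dm: "?d i \<in> borel_measurable M" "?d (Suc i) \<in> borel_measurable M"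
          by (rule L1_integrand_measurable[OF wc D To _ u]; use TD TD' in blast)+
        have "(\<integral>\<^sup>+x\<in>T i. k i x \<partial>M)
            \<le> (\<integral>\<^sup>+x. ennreal (3 * L i) * (?d i x + ?d (Suc i) x + ennreal (\<eta> i) * indicator (T i) x) \<partial>M)"
        proof (rule nn_integral_mono)
          fix x
          have "ennreal (\<bar>w i x - w (Suc i) x\<bar> + \<eta> i) \<le> ennreal (\<bar>w i x - u x\<bar> + \<bar>w (Suc i) x - u x\<bar> + \<eta> i)"
            by (rule ennreal_leI) simp
          then have "k i x \<le> ennreal (3 * L i) * (ennreal \<bar>w i x - u x\<bar> + ennreal \<bar>w (Suc i) x - u x\<bar> + ennreal (\<eta> i))"
            unfolding k_def using L0[of i] \<eta>0[of i]
            by (subst mult.commute) (auto simp: ennreal_mult ennreal_plus intro!: mult_left_mono)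
          then show "k i x * indicator (T i) x \<le> ennreal (3 * L i) * (?d i x + ?d (Suc i) x + ennreal (\<eta> i) * indicator (T i) x)"
            by (auto simp: indicator_def)
        qed
        also have "\<dots> = ennreal (3 * L i) * ((\<integral>\<^sup>+x. ?d i x \<partial>M) + (\<integral>\<^sup>+x. ?d (Suc i) x \<partial>M) + ennreal (\<eta> i) * emeasure M (T i))"
          using dm open_sets_M[OF To[of i]]
          by (simp add: nn_integral_cmult nn_integral_add nn_integral_cmult_indicator)
        also have "\<dots> \<le> ennreal (3 * L i) * (ennreal (a i) + ennreal (a (Suc i)) + ennreal (\<eta> i) * ennreal (m i))"
        proof (intro mult_left_mono add_mono)
          show "(\<integral>\<^sup>+x. ?d i x \<partial>M) \<le> ennreal (a i)"
            by (rule order_trans[OF nn_integral_mono w(3)]) (use RT(1) in \<open>auto simp: indicator_def\<close>)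
          show "(\<integral>\<^sup>+x. ?d (Suc i) x \<partial>M) \<le> ennreal (a (Suc i))"
            by (rule order_trans[OF nn_integral_mono w(3)]) (use RT(2) in \<open>auto simp: indicator_def\<close>)
        qed (simp_all add: m)
        also have "\<dots> = ennreal (3 * L i * (a i + a (Suc i) + \<eta> i * m i))"
          using L0[of i] a0[of i] a0[of "Suc i"] \<eta>0[of i] m0[of i]
          by (simp add: ennreal_mult ennreal_plus less_imp_le)
        also have "\<dots> \<le> ennreal (\<epsilon> i / 2)" by (rule ennreal_leI[OF weights])
        finally show "(\<integral>\<^sup>+x\<in>T i. k i x \<partial>M) \<le> ennreal (\<epsilon> i / 2)" .
      qed auto
      also have "\<dots> = (\<Sum>i. TV u (D i)) + ((\<Sum>i. ennreal (\<epsilon> i / 2)) + (\<Sum>i. ennreal (\<epsilon> i / 2)))"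
        by (simp add: suminf_add[symmetric] add.assoc)
      also have "(\<Sum>i. ennreal (\<epsilon> i / 2)) + (\<Sum>i. ennreal (\<epsilon> i / 2)) = (\<Sum>i. ennreal (\<epsilon> i))"
        using \<epsilon>0 by (subst suminf_add) (auto simp: less_imp_le simp flip: ennreal_plus)
      finally show ?thesis by (simp add: \<epsilon>sum)
    qed
    show "\<exists>v g. locally_lipschitz U v \<and> upper_gradient U (\<lambda>x. ereal (v x)) g \<and>
        (\<integral>\<^sup>+x\<in>S. ennreal \<bar>v x - u x\<bar> \<partial>M) \<le> ennreal e \<and>
        (\<integral>\<^sup>+x\<in>U. g x \<partial>M) \<le> (\<Sum>i. TV u (D i)) + ennreal e"
      using lip ug dist grad by blast
  qed
qed (simp add: less_top[symmetric])

end

section \<open>The total variation as an outer measure\<close>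

lemma suminf_split_first: "(\<Sum>i. f i) = f 0 + (\<Sum>i. f (Suc i))" for f :: "nat \<Rightarrow> ennreal"
  using suminf_offset[of f 1] by (simp add: add.commute)

lemma ennreal_suminf_tail_small:
  fixes f :: "nat \<Rightarrow> ennreal"
  assumes "(\<Sum>i. f i) < top" "0 < (e::real)"
  obtains N where "(\<Sum>i. f (i + N)) < ennreal e"
proof -
  have fin: "f i < top" for i
    using sum_le_suminf[of f "{i}"] assms(1) by (auto intro: le_less_trans)
  define r where "r i = enn2real (f i)" for i
  have fr: "f i = ennreal (r i)" and r0: "0 \<le> r i" for i
    using fin[of i] by (auto simp: r_def)
  have sr: "summable r"
    using assms(1) r0 unfolding fr by (intro summable_suminf_not_top) auto
  then obtain N where "norm (\<Sum>i. r (i + N)) < e"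
    using suminf_exist_split[OF assms(2)] by blast
  moreover have "(\<Sum>i. ennreal (r (i + N))) = ennreal (\<Sum>i. r (i + N))"
    using sr r0 by (intro suminf_ennreal2) auto
  ultimately have "(\<Sum>i. f (i + N)) < ennreal e"
    unfolding fr using assms(2) by (simp add: ennreal_lessI)
  then show thesis by (rule that)
qed

context doubling_space
begin

lemma sum_annuli_le:
  assumes U: "open U"
  shows "(\<Sum>j. TV u {x \<in> U. real j - 1 < exhaustion U x0 x \<and> exhaustion U x0 x < real j + 1}) \<le> 2 * TV u U"
proof (rule suminf_le_const)
  let ?A = "\<lambda>j::nat. {x \<in> U. real j - 1 < exhaustion U x0 x \<and> exhaustion U x0 x < real j + 1}"
  have half: "(\<Sum>j\<in>{j\<in>{..<n}. even j = b}. TV u (?A j)) \<le> TV u U" for n b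
  proof (rule TV_superadditive_finite)
    show "disjoint_family_on ?A {j\<in>{..<n}. even j = b}"
      unfolding disjoint_family_on_def
    proof (intro ballI impI equals0I)
      fix j k x assume jk: "j \<in> {j\<in>{..<n}. even j = b}" "k \<in> {j\<in>{..<n}. even j = b}" "j \<noteq> k"
        and x: "x \<in> ?A j \<inter> ?A k"
      then have "even j = even k" "j \<noteq> k" by auto
      then have "j + 2 \<le> k \<or> k + 2 \<le> j" by presburger
      then have "real j + 2 \<le> real k \<or> real k + 2 \<le> real j" by linarith
      then show False using x by auto
    qed
    show "open (?A j)" for j
      using compactly_inside_exhaustion(1)[OF U] compactly_inside_open by blast
  qed auto
  fix n
  have "(\<Sum>j<n. TV u (?A j)) = (\<Sum>j\<in>{j\<in>{..<n}. even j = True}. TV u (?A j)) + (\<Sum>j\<in>{j\<in>{..<n}. even j = False}. TV u (?A j))"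
    by (subst sum.union_disjoint[symmetric]) (auto intro!: sum.cong)
  also have "\<dots> \<le> TV u U + TV u U" by (intro add_mono half)
  finally show "(\<Sum>j<n. TV u (?A j)) \<le> 2 * TV u U" by (simp add: mult_2)
qed simp

text \<open>
  The annuli \<open>j - 1 < exhaustion < j + 1\<close> of equal parity are disjoint, so the series of their
  variations converges, and only a tail of it is left outside a large compact set.
\<close>

lemma TV_inner_regular:
  assumes U: "open U" and u: "u \<in> borel_measurable M" and fin: "TV u U < top" and e: "0 < (e::real)"
  obtains W where "compactly_inside W U" "TV u U \<le> TV u W + ennreal e"
proof -
  obtain x0 :: 'a where True by blast
  define \<rho>0 where "\<rho>0 = exhaustion U x0"
  have \<rho>0: "locally_lipschitz U \<rho>0" "\<And>x. x \<in> U \<Longrightarrow> 0 < \<rho>0 x"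
    unfolding \<rho>0_def using locally_lipschitz_exhaustion[OF U] exhaustion_pos[OF U] by auto
  define A where "A a b = {x \<in> U. a < \<rho>0 x \<and> \<rho>0 x < b}" for a b
  have A: "compactly_inside (A a b) U" "closure (A a b) \<subseteq> {x \<in> U. a \<le> \<rho>0 x \<and> \<rho>0 x \<le> b}" for a b
    unfolding A_def \<rho>0_def by (rule compactly_inside_exhaustion[OF U])+
  have "(\<Sum>j. TV u (A (real j - 1) (real j + 1))) \<le> 2 * TV u U"
    unfolding A_def \<rho>0_def by (rule sum_annuli_le[OF U])
  also have "\<dots> < top" using fin by (simp add: ennreal_mult_less_top)
  finally obtain m where m: "(\<Sum>i. TV u (A (real (i + m) - 1) (real (i + m) + 1))) < ennreal e"
    using ennreal_suminf_tail_small[OF _ e] by blast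
  \<comment> \<open>\<open>D 0\<close> is a relatively compact core, later returned as
    \<open>W\<close>; the other \<open>D i\<close> are annuli of the tail chosen above. Shifting
    \<open>\<rho>0\<close> down by \<open>m\<close> and cutting it off at 0 makes the core match
    layer 0.\<close>
  define D where "D i = (if i = 0 then A (-1) (real m + 1) else A (real (i + m) - 1) (real (i + m) + 1))" for i
  define T where "T i = A (real (i + m) + 1/4) (real (i + m) + 3/4)" for i
  have TA: "compactly_inside (T i) U" for i unfolding T_def by (rule A(1))
  have "\<exists>L. L-lipschitz_on (T i) (\<lambda>x. max (\<rho>0 x - m) 0)" for i
  proof -
    have "locally_lipschitz U (\<lambda>x. max (\<rho>0 x - m) 0)"
      by (rule locally_lipschitz_compose[OF \<rho>0(1), where c = 1]) (auto simp: max_def)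
    then show ?thesis using TA[of i] lip_loc_iff[OF U] by (auto simp: lip_loc_def)
  qed
  then obtain L where L: "\<And>i. (L i)-lipschitz_on (T i) (\<lambda>x. max (\<rho>0 x - m) 0)" by metis
  have "TV u U \<le> (\<Sum>i. TV u (D i))"
  proof (rule TV_layered_le[OF U u _ _ _ _ _ L])
    show "locally_lipschitz U (\<lambda>x. max (\<rho>0 x - m) 0)"
      by (rule locally_lipschitz_compose[OF \<rho>0(1), where c = 1]) (auto simp: max_def)
    show "open (D i)" for i unfolding D_def using A(1) compactly_inside_open by auto
    show "x \<in> D i" if "x \<in> U" "real i - 1 < max (\<rho>0 x - m) 0" "max (\<rho>0 x - m) 0 < real i + 1" for i x
      using that \<rho>0(2)[of x] by (cases i) (auto simp: D_def A_def max_def split: if_splits)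
    show "compactly_inside (T i) (D i \<inter> D (Suc i))" for i
    proof -
      have "closure (T i) \<subseteq> {x \<in> U. real (i + m) + 1/4 \<le> \<rho>0 x \<and> \<rho>0 x \<le> real (i + m) + 3/4}"
        unfolding T_def by (rule A(2))
      also have "\<dots> \<subseteq> D i \<inter> D (Suc i)"
        using \<rho>0(2) by (force simp: D_def A_def)
      finally show ?thesis using TA[of i] by (simp add: compactly_inside_def)
    qed
    show "x \<in> T i" if "x \<in> U" "real i + 1/3 \<le> max (\<rho>0 x - m) 0" "max (\<rho>0 x - m) 0 \<le> real i + 2/3" for i x
      using that by (auto simp: T_def A_def max_def split: if_splits)
  qed simp
  also have "\<dots> = TV u (A (-1) (real m + 1)) + (\<Sum>i. TV u (A (real (Suc i + m) - 1) (real (Suc i + m) + 1)))"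
    by (subst suminf_split_first) (simp add: D_def)
  also have "(\<Sum>i. TV u (A (real (Suc i + m) - 1) (real (Suc i + m) + 1)))
      \<le> (\<Sum>i. TV u (A (real (i + m) - 1) (real (i + m) + 1)))"
    by (subst (2) suminf_split_first) simp
  also have "\<dots> \<le> ennreal e" using m by simp
  finally show thesis using that[OF A(1)] by (simp add: add_left_mono)
qed

text \<open>The parts of \<open>closure V\<close> missed by \<open>U2\<close> and by
  \<open>U1\<close> are disjoint compact sets, hence at positive distance \<open>d\<close> if
  neither is empty. The normalized distance from the first runs from 0 there to 1 on the second, and
  gluing with the two layers \<open>U1\<close> and \<open>U2\<close> applies.\<close>

lemma TV_compactly_inside_Un:
  assumes V: "compactly_inside V (U1 \<union> U2)" and o: "open U1" "open U2" and u: "u \<in> borel_measurable M"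
  shows "TV u V \<le> TV u U1 + TV u U2"
proof -
  define K1 where "K1 = closure V - U2"
  define K2 where "K2 = closure V - U1"
  have V': "open V" "compact (closure V)" "closure V \<subseteq> U1 \<union> U2" "V \<subseteq> closure V"
    using V closure_subset by (auto simp: compactly_inside_def)
  show ?thesis
  proof (cases "K1 = {} \<or> K2 = {}")
    case True
    then have "V \<subseteq> U2 \<or> V \<subseteq> U1" using V'(4) by (auto simp: K1_def K2_def)
    then show ?thesis using TV_mono[of V U1] TV_mono[of V U2] by (auto intro: add_increasing add_increasing2)
  next
    case False
    have K: "compact K1" "compact K2" "K1 \<inter> K2 = {}"
      using V' o by (auto simp: K1_def K2_def compact_diff)
    obtain d where d: "0 < d" "\<And>x y. x \<in> K1 \<Longrightarrow> y \<in> K2 \<Longrightarrow> d \<le> dist x y"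
    proof -
      have "continuous_on K1 (\<lambda>x. infdist x K2)" by (intro continuous_intros)
      then obtain z where z: "z \<in> K1" "\<And>x. x \<in> K1 \<Longrightarrow> infdist z K2 \<le> infdist x K2"
        using continuous_attains_inf[OF K(1)] False by blast
      have "z \<notin> K2" using z(1) K(3) by blast
      then have "0 < infdist z K2"
        using infdist_pos_not_in_closed[OF compact_imp_closed[OF K(2)]] False by blast
      then show thesis
        using that[of "infdist z K2"] z(2) infdist_le order_trans by meson
    qed
    define \<rho> where "\<rho> x = min 1 (infdist x K1 / d)" for x
    have lip: "(1 / d)-lipschitz_on S \<rho>" for S
    proof (rule lipschitz_onI)
      fix x y
      have "\<bar>\<rho> x - \<rho> y\<bar> \<le> \<bar>infdist x K1 / d - infdist y K1 / d\<bar>" by (auto simp: \<rho>_def min_def)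
      also have "\<dots> = \<bar>infdist x K1 - infdist y K1\<bar> / d" using d by (simp add: diff_divide_distrib[symmetric])
      also have "\<dots> \<le> dist x y / d" using d infdist_triangle_abs by (intro divide_right_mono) auto
      finally show "dist (\<rho> x) (\<rho> y) \<le> 1 / d * dist x y" by (simp add: dist_real_def)
    qed (use d in simp)
    have r1: "\<rho> x = 1" if "x \<in> K2" for x
    proof -
      have "d \<le> infdist x K1"
      proof -
        have "K1 \<noteq> {}" using False by blast
        then show ?thesis
          unfolding infdist_notempty[OF \<open>K1 \<noteq> {}\<close>]
          using d(2)[OF _ that] by (intro cINF_greatest) (auto simp: dist_commute)
      qed
      then show ?thesis using d(1) by (simp add: \<rho>_def)
    qed
    have r0: "\<rho> x = 0" if "x \<in> K1" for x using that by (simp add: \<rho>_def)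
    have rr: "0 \<le> \<rho> x" "\<rho> x \<le> 1" for x using d(1) infdist_nonneg[of x K1] by (simp_all add: \<rho>_def)
    have \<rho>c: "continuous_on UNIV \<rho>" by (rule lipschitz_on_continuous_on[OF lip])
    define D where "D i = (if i = 0 then U1 else if i = 1 then U2 else {})" for i :: nat
    define T where "T i = (if i = 0 then V \<inter> \<rho> -` {1/4<..<3/4} else {})" for i :: nat
    have "TV u V \<le> (\<Sum>i. TV u (D i))"
    proof (rule TV_layered_le[OF V'(1) u])
      show "locally_lipschitz V \<rho>" by (rule locally_lipschitz_lipschitz[OF lip])
      show "0 \<le> \<rho> x" for x by (rule rr)
      show "open (D i)" for i using o by (simp add: D_def)
      show "(1/d)-lipschitz_on (T i) \<rho>" for i by (rule lip)
      show "x \<in> D i" if "x \<in> V" "real i - 1 < \<rho> x" "\<rho> x < real i + 1" for i x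
      proof -
        have x: "x \<in> closure V" using that V' by blast
        consider "i = 0" | "i = 1" | "i \<ge> 2" by linarith
        then show ?thesis
        proof cases
          case 1
          then have "x \<notin> K2" using that r1[of x] by auto
          then show ?thesis using x V'(3) 1 by (auto simp: K2_def D_def)
        next
          case 2
          then have "x \<notin> K1" using that r0[of x] by auto
          then show ?thesis using x V'(3) 2 by (auto simp: K1_def D_def)
        next
          case 3
          then show ?thesis using that rr(2)[of x] by auto
        qed
      qed
      show "compactly_inside (T i) (D i \<inter> D (Suc i))" for i
      proof (cases "i = 0")
        case True
        have "closed (closure V \<inter> \<rho> -` {1/4..3/4})"
          by (rule continuous_closed_preimage[OF continuous_on_subset[OF \<rho>c]]) auto
        then have "closure (T i) \<subseteq> closure V \<inter> \<rho> -` {1/4..3/4}"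
          using True V'(4) by (intro closure_minimal) (auto simp: T_def)
        moreover have "closure V \<inter> \<rho> -` {1/4..3/4} \<subseteq> D i \<inter> D (Suc i)"
          using V'(3) r0 r1 True by (force simp: D_def K1_def K2_def)
        moreover have "open (T i)"
          unfolding T_def using continuous_open_preimage[OF continuous_on_subset[OF \<rho>c] V'(1), of "{1/4<..<3/4}"] by simp
        moreover have "compact (closure (T i))"
          using compact_Int_closed[OF V'(2), of "closure (T i)"] calculation(1) by (simp add: Int_absorb1)
        ultimately show ?thesis by (auto simp: compactly_inside_def)
      qed (simp add: T_def compactly_inside_empty)
      show "x \<in> T i" if "x \<in> V" "real i + 1/3 \<le> \<rho> x" "\<rho> x \<le> real i + 2/3" for i x
      proof -
        have "i = 0" using that rr(2)[of x] by (cases i) auto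
        then show ?thesis using that by (auto simp: T_def)
      qed
    qed
    also have "\<dots> = (\<Sum>i\<in>{0, 1}. TV u (D i))"
      by (rule suminf_finite) (auto simp: D_def)
    finally show ?thesis by (simp add: D_def)
  qed
qed

text \<open>Inner regularity reduces the union to a set compactly inside it, where the two
  exceptional parts are compact.\<close>

lemma TV_Un:
  assumes o: "open U1" "open U2" and u: "u \<in> borel_measurable M" and fin: "TV u UNIV < top"
  shows "TV u (U1 \<union> U2) \<le> TV u U1 + TV u U2"
proof (rule ennreal_le_epsilon)
  fix e :: real assume e: "0 < e"
  have "TV u (U1 \<union> U2) < top" using TV_mono[of "U1 \<union> U2" UNIV u] fin by (auto intro: le_less_trans)
  then obtain W where "compactly_inside W (U1 \<union> U2)" "TV u (U1 \<union> U2) \<le> TV u W + ennreal e"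
    using TV_inner_regular[of "U1 \<union> U2" u e] o u e by auto
  then show "TV u (U1 \<union> U2) \<le> TV u U1 + TV u U2 + ennreal e"
    using TV_compactly_inside_Un[OF _ o u] by (meson add_right_mono order_trans)
qed

lemma TV_UN_finite:
  assumes "finite I" "\<And>i. i \<in> I \<Longrightarrow> open (A i)" and u: "u \<in> borel_measurable M" and fin: "TV u UNIV < top"
  shows "TV u (\<Union>i\<in>I. A i) \<le> (\<Sum>i\<in>I. TV u (A i))"
  using assms(1,2)
proof (induction I)
  case (insert j J)
  have "TV u (\<Union>i\<in>insert j J. A i) \<le> TV u (A j) + TV u (\<Union>i\<in>J. A i)"
    using insert by (simp add: TV_Un[OF _ _ u fin] open_UN)
  also have "\<dots> \<le> TV u (A j) + (\<Sum>i\<in>J. TV u (A i))"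
    using insert by (intro add_left_mono) auto
  finally show ?case using insert by simp
qed simp

text \<open>The closure of a set compactly inside the union is covered by finitely many
  \<open>A i\<close>, which brings back the finite case.\<close>

lemma TV_UN_countable:
  fixes A :: "nat \<Rightarrow> 'a set"
  assumes o: "\<And>i. open (A i)" and u: "u \<in> borel_measurable M" and fin: "TV u UNIV < top"
  shows "TV u (\<Union>i. A i) \<le> (\<Sum>i. TV u (A i))"
proof (rule ennreal_le_epsilon)
  fix e :: real assume e: "0 < e"
  have "TV u (\<Union>i. A i) < top" using TV_mono[of "\<Union>i. A i" UNIV u] fin by (auto intro: le_less_trans)
  then obtain W where W: "compactly_inside W (\<Union>i. A i)" "TV u (\<Union>i. A i) \<le> TV u W + ennreal e"
    using TV_inner_regular[of "\<Union>i. A i" u e] o u e by auto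
  then obtain I where I: "finite I" "closure W \<subseteq> (\<Union>i\<in>I. A i)"
    using compactE_image[of "closure W" UNIV A] o by (auto simp: compactly_inside_def)
  have "TV u W \<le> TV u (\<Union>i\<in>I. A i)" using I(2) closure_subset by (intro TV_mono) blast
  also have "\<dots> \<le> (\<Sum>i\<in>I. TV u (A i))" by (rule TV_UN_finite[OF I(1) o u fin])
  also have "\<dots> \<le> (\<Sum>i. TV u (A i))" by (rule sum_le_suminf) (use I in auto)
  finally show "TV u (\<Union>i. A i) \<le> (\<Sum>i. TV u (A i)) + ennreal e"
    using W(2) by (meson add_right_mono order_trans)
qed

lemma total_variation_mono: "A \<subseteq> B \<Longrightarrow> total_variation \<mu> u A \<le> total_variation \<mu> u B"
  unfolding total_variation_def by (rule INF_superset_mono) auto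

lemma total_variation_outer_open:
  assumes "total_variation \<mu> u A < top" "0 < (e::real)"
  obtains U where "open U" "A \<subseteq> U" "TV u U \<le> total_variation \<mu> u A + ennreal e"
proof -
  have "total_variation \<mu> u A < total_variation \<mu> u A + ennreal e"
    using assms ennreal_add_left_cancel_less[of "total_variation \<mu> u A" 0 "ennreal e"] by simp
  then show thesis
    unfolding total_variation_def[of \<mu> u A] INF_less_iff using that
    by (auto simp: total_variation_def[of \<mu> u A] less_imp_le)
qed

lemma total_variation_finite:
  assumes "TV u UNIV < top"
  shows "total_variation \<mu> u A < top"
  using total_variation_mono[of A UNIV u] assms total_variation_open_eq[of UNIV u] by (auto intro: le_less_trans)

lemma outer_measure_total_variation:
  assumes u: "u \<in> borel_measurable M" and fin: "TV u UNIV < top"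
  shows "outer_measure_space UNIV (total_variation \<mu> u)"
  unfolding outer_measure_space_def
proof (intro conjI)
  show "positive UNIV (total_variation \<mu> u)"
    unfolding positive_def using total_variation_open_eq[of "{}" u] by simp
  show "increasing UNIV (total_variation \<mu> u)"
    by (simp add: increasing_def total_variation_mono)
  show "countably_subadditive UNIV (total_variation \<mu> u)"
    unfolding countably_subadditive_def
  proof (intro allI impI)
    fix A :: "nat \<Rightarrow> 'a set"
    show "total_variation \<mu> u (\<Union>i. A i) \<le> (\<Sum>i. total_variation \<mu> u (A i))"
    proof (rule ennreal_le_epsilon)
      fix e :: real assume e: "0 < e"
      define \<epsilon> where "\<epsilon> i = e * (1/2) ^ Suc i" for i :: nat
      have \<epsilon>0: "0 < \<epsilon> i" for i using e by (simp add: \<epsilon>_def)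
      have \<epsilon>sum: "(\<Sum>i. ennreal (\<epsilon> i)) = ennreal e"
        unfolding \<epsilon>_def using e by (intro suminf_half_powers) simp
      have "\<exists>U. open U \<and> A i \<subseteq> U \<and> TV u U \<le> total_variation \<mu> u (A i) + ennreal (\<epsilon> i)" for i
        by (rule total_variation_outer_open[OF total_variation_finite[OF fin] \<epsilon>0]) blast
      then obtain U where U: "\<And>i. open (U i)" "\<And>i. A i \<subseteq> U i"
          "\<And>i. TV u (U i) \<le> total_variation \<mu> u (A i) + ennreal (\<epsilon> i)"
        by metis
      have "total_variation \<mu> u (\<Union>i. A i) \<le> total_variation \<mu> u (\<Union>i. U i)"
        using U(2) by (intro total_variation_mono) blast
      also have "\<dots> = TV u (\<Union>i. U i)" using U(1) by (intro total_variation_open_eq) auto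
      also have "\<dots> \<le> (\<Sum>i. TV u (U i))" by (rule TV_UN_countable[OF U(1) u fin])
      also have "\<dots> \<le> (\<Sum>i. total_variation \<mu> u (A i) + ennreal (\<epsilon> i))"
        by (rule suminf_le) (use U(3) in auto)
      also have "\<dots> = (\<Sum>i. total_variation \<mu> u (A i)) + ennreal e"
        by (simp add: suminf_add[symmetric] \<epsilon>sum)
      finally show "total_variation \<mu> u (\<Union>i. A i) \<le> (\<Sum>i. total_variation \<mu> u (A i)) + ennreal e" .
    qed
  qed
qed

lemma total_variation_Un:
  assumes u: "u \<in> borel_measurable M" and fin: "TV u UNIV < top"
  shows "total_variation \<mu> u (A \<union> B) \<le> total_variation \<mu> u A + total_variation \<mu> u B"
proof (rule ennreal_le_epsilon)
  fix e :: real assume e: "0 < e"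
  obtain U where U: "open U" "A \<subseteq> U" "TV u U \<le> total_variation \<mu> u A + ennreal (e/2)"
    using total_variation_outer_open[OF total_variation_finite[OF fin], of "e/2" A] e by auto
  obtain V where V: "open V" "B \<subseteq> V" "TV u V \<le> total_variation \<mu> u B + ennreal (e/2)"
    using total_variation_outer_open[OF total_variation_finite[OF fin], of "e/2" B] e by auto
  have "total_variation \<mu> u (A \<union> B) \<le> TV u (U \<union> V)"
    unfolding total_variation_def by (rule INF_lower) (use U V in auto)
  also have "\<dots> \<le> TV u U + TV u V" by (rule TV_Un[OF U(1) V(1) u fin])
  also have "\<dots> \<le> (total_variation \<mu> u A + ennreal (e/2)) + (total_variation \<mu> u B + ennreal (e/2))"
    by (rule add_mono[OF U(3) V(3)])
  also have "\<dots> = total_variation \<mu> u A + total_variation \<mu> u B + (ennreal (e/2) + ennreal (e/2))"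
    by (simp add: ac_simps)
  also have "ennreal (e/2) + ennreal (e/2) = ennreal e" using e by (simp flip: ennreal_plus)
  finally show "total_variation \<mu> u (A \<union> B) \<le> total_variation \<mu> u A + total_variation \<mu> u B + ennreal e" .
qed

text \<open>\<open>A\<close> is enclosed in an open \<open>U\<close>, and \<open>W\<close> carries
  the variation on \<open>U \<inter> V\<close> up to a small error. As the closure of
  \<open>W\<close> lies in \<open>V\<close>, the set \<open>U - closure W\<close> is open, disjoint
  from \<open>W\<close> and still contains \<open>A - V\<close>; superadditivity concludes.\<close>

lemma open_caratheodory_total_variation:
  assumes u: "u \<in> borel_measurable M" and fin: "TV u UNIV < top" and V: "open V"
  shows "V \<in> lambda_system UNIV UNIV (total_variation \<mu> u)"
  unfolding lambda_system_def
proof (intro CollectI conjI ballI UNIV_I)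
  fix A :: "'a set"
  let ?P = "total_variation \<mu> u"
  show "?P (V \<inter> A) + ?P ((UNIV - V) \<inter> A) = ?P A"
  proof (rule antisym)
    show "?P (V \<inter> A) + ?P ((UNIV - V) \<inter> A) \<le> ?P A"
    proof (rule ennreal_le_epsilon)
      fix e :: real assume e: "0 < e"
      obtain U where U: "open U" "A \<subseteq> U" "TV u U \<le> ?P A + ennreal (e/2)"
        using total_variation_outer_open[OF total_variation_finite[OF fin], of "e/2" A] e by auto
      have UV: "open (U \<inter> V)" "TV u (U \<inter> V) < top"
        using U V TV_mono[of "U \<inter> V" UNIV u] fin by (auto intro: le_less_trans)
      obtain W where W: "compactly_inside W (U \<inter> V)" "TV u (U \<inter> V) \<le> TV u W + ennreal (e/2)"
        using TV_inner_regular[OF UV(1) u UV(2), of "e/2"] e by auto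
      have "?P (V \<inter> A) \<le> TV u (U \<inter> V)"
        unfolding total_variation_def by (rule INF_lower) (use U V in auto)
      moreover have "?P ((UNIV - V) \<inter> A) \<le> TV u (U - closure W)"
        unfolding total_variation_def
        by (rule INF_lower) (use U W(1) in \<open>auto simp: compactly_inside_def\<close>)
      ultimately have "?P (V \<inter> A) + ?P ((UNIV - V) \<inter> A) \<le> TV u W + ennreal (e/2) + TV u (U - closure W)"
        using W(2) by (meson add_mono order_trans)
      also have "\<dots> = TV u W + TV u (U - closure W) + ennreal (e/2)" by (simp add: ac_simps)
      also have "TV u W + TV u (U - closure W) \<le> TV u U"
        by (rule TV_superadditive)
           (use U W(1) compactly_inside_subset[OF W(1)] closure_subset in \<open>auto simp: compactly_inside_def\<close>)
      also note U(3)
      finally have "?P (V \<inter> A) + ?P ((UNIV - V) \<inter> A) \<le> ?P A + ennreal (e/2) + ennreal (e/2)"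
        by (simp add: add_right_mono)
      moreover have "ennreal (e/2) + ennreal (e/2) = ennreal e" using e by (simp flip: ennreal_plus)
      ultimately show "?P (V \<inter> A) + ?P ((UNIV - V) \<inter> A) \<le> ?P A + ennreal e"
        by (simp add: add.assoc)
    qed
    show "?P A \<le> ?P (V \<inter> A) + ?P ((UNIV - V) \<inter> A)"
      using total_variation_Un[OF u fin, of "V \<inter> A" "(UNIV - V) \<inter> A"] by (simp add: Int_Un_distrib2[symmetric])
  qed
qed

lemma borel_caratheodory_total_variation:
  assumes u: "u \<in> borel_measurable M" and fin: "TV u UNIV < top" and A: "A \<in> sets borel"
  shows "A \<in> lambda_system UNIV UNIV (total_variation \<mu> u)"
proof -
  interpret sigma_algebra UNIV "lambda_system UNIV UNIV (total_variation \<mu> u)"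
    using sigma_algebra.caratheodory_lemma[OF sigma_algebra_Pow[of UNIV, simplified] outer_measure_total_variation[OF u fin]]
    by (simp add: measure_space_def)
  have "sigma_sets UNIV {S. open S} \<subseteq> lambda_system UNIV UNIV (total_variation \<mu> u)"
    by (rule sigma_sets_subset) (use open_caratheodory_total_variation[OF u fin] in auto)
  then show ?thesis using A by (auto simp: borel_def)
qed

end

section \<open>Sets of zero codimension one Hausdorff measure\<close>

lemma locally_lipschitz_sum:
  assumes "finite I" "\<And>i. i \<in> I \<Longrightarrow> locally_lipschitz U (h i)"
  shows "locally_lipschitz U (\<lambda>x. \<Sum>i\<in>I. h i x)"
  using assms
proof (induction I)
  case empty
  show ?case using locally_lipschitz_lipschitz[OF lipschitz_on_constant[of UNIV "0::real"]] by simp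
next
  case (insert j J)
  then show ?case using locally_lipschitz_add[of U "h j" "\<lambda>x. \<Sum>i\<in>J. h i x"] by simp
qed

lemma upper_gradient_sum:
  assumes "finite I" "\<And>i. i \<in> I \<Longrightarrow> upper_gradient U (\<lambda>x. ereal (h i x)) (g i)"
  shows "upper_gradient U (\<lambda>x. ereal (\<Sum>i\<in>I. h i x)) (\<lambda>x. \<Sum>i\<in>I. g i x)"
  using assms
proof (induction I)
  case empty
  show ?case using upper_gradient_lipschitz[OF lipschitz_on_constant[of U "0::real"]] by simp
next
  case (insert j J)
  then show ?case
    using upper_gradient_add[of U "h j" "g j" "\<lambda>x. \<Sum>i\<in>J. h i x" "\<lambda>x. \<Sum>i\<in>J. g i x"] by simp
qed

definition bump :: "'a::metric_space \<times> real \<Rightarrow> 'a \<Rightarrow> real" where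
  "bump b y = max 0 (min 1 (2 - dist (fst b) y / snd b))"

lemma bump_range: "bump b y \<in> {0..1}"
  by (auto simp: bump_def)

lemma bump_inside: "0 < r \<Longrightarrow> y \<in> ball x r \<Longrightarrow> bump (x, r) y = 1"
proof -
  assume "0 < r" "y \<in> ball x r"
  then have "dist x y / r \<le> 1" by simp
  then show ?thesis unfolding bump_def by (simp add: min_def)
qed

lemma bump_outside: "0 < r \<Longrightarrow> 2 * r \<le> dist x y \<Longrightarrow> bump (x, r) y = 0"
proof -
  assume "0 < r" "2 * r \<le> dist x y"
  then have "2 \<le> dist x y / r" by (simp add: field_simps)
  then show ?thesis unfolding bump_def by (simp add: min_def)
qed

lemma bump_lipschitz:
  assumes "0 < r"
  shows "(1 / r)-lipschitz_on S (bump (x, r))"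
proof (rule lipschitz_onI)
  fix y z
  have "\<bar>bump (x, r) y - bump (x, r) z\<bar> \<le> \<bar>(2 - dist x y / r) - (2 - dist x z / r)\<bar>"
    unfolding bump_def fst_conv snd_conv using clamp_unit_lipschitz by simp
  also have "\<dots> = \<bar>dist x z - dist x y\<bar> / r"
    using assms by (simp add: diff_divide_distrib[symmetric])
  also have "\<dots> \<le> dist y z / r"
    using abs_dist_diff_le[of z x y] assms by (intro divide_right_mono) (auto simp: dist_commute)
  finally show "dist (bump (x, r) y) (bump (x, r) z) \<le> 1 / r * dist y z"
    by (simp add: dist_real_def)
qed (use assms in simp)

text \<open>The radius \<open>3 * r\<close> instead of \<open>2 * r\<close> makes the open sets
  \<open>ball x (3 * r)\<close> and \<open>- cball x (2 * r)\<close> cover the space, as the local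
  criterion demands.\<close>

lemma bump_upper_gradient:
  assumes "0 < r"
  shows "upper_gradient UNIV (\<lambda>y. ereal (bump (x, r) y)) (\<lambda>y. ennreal (1 / r) * indicator (ball x (3 * r)) y)"
    (is "upper_gradient _ _ ?g")
proof (rule upper_gradientI_local)
  show g: "?g \<in> borel_measurable (restrict_space borel UNIV)"
    by (intro measurable_restrict_space1 borel_measurable_times_ennreal borel_measurable_const
        borel_measurable_indicator borel_open open_ball)
  fix y
  show "\<exists>N. open N \<and> y \<in> N \<and> upper_gradient (N \<inter> UNIV) (\<lambda>y. ereal (bump (x, r) y)) ?g"
  proof (cases "y \<in> ball x (3 * r)")
    case True
    have "upper_gradient (ball x (3 * r)) (\<lambda>y. ereal (bump (x, r) y)) ?g"
      by (rule upper_gradient_mono[OF upper_gradient_lipschitz[OF bump_lipschitz[OF assms]]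
            borel_measurable_restrict_subset[OF g]]) auto
    then show ?thesis using True by (intro exI[of _ "ball x (3 * r)"]) simp
  next
    case False
    then have "y \<in> - cball x (2 * r)" using assms by auto
    moreover have "upper_gradient (- cball x (2 * r)) (\<lambda>y. ereal (bump (x, r) y)) ?g"
    proof (rule upper_gradient_mono[OF upper_gradient_lipschitz[OF lipschitz_on_constant]
          borel_measurable_restrict_subset[OF g]])
      show "0 = bump (x, r) y" if "y \<in> - cball x (2 * r)" for y
        using bump_outside[OF assms, of x y] that by simp
    qed auto
    moreover have "open (- cball x (2 * r))" by (simp add: open_Compl)
    ultimately show ?thesis by (intro exI[of _ "- cball x (2 * r)"]) simp
  qed
qed

text \<open>With radii at most 1, \<open>\<mu> (ball x r)\<close> is at most
  \<open>\<mu> (ball x r) / r\<close>, so a small sum controls both the measure of the balls and the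
  gradients of cutoffs on them.\<close>

definition codim1_cover :: "('a::metric_space set \<Rightarrow> ennreal) \<Rightarrow> real \<Rightarrow> 'a set \<Rightarrow> ('a \<times> real) set \<Rightarrow> bool" where
  "codim1_cover \<mu> e A \<B> \<longleftrightarrow> countable \<B> \<and> (\<forall>(x, r)\<in>\<B>. 0 < r \<and> r \<le> 1) \<and>
     A \<subseteq> (\<Union>(x, r)\<in>\<B>. ball x r) \<and> (\<Sum>\<^sub>\<infinity>(x, r)\<in>\<B>. \<mu> (ball x r) / ennreal r) < ennreal e"

definition codim1_small_covers :: "('a::metric_space set \<Rightarrow> ennreal) \<Rightarrow> 'a set \<Rightarrow> bool" where
  "codim1_small_covers \<mu> A \<longleftrightarrow> (\<forall>e>0. \<exists>\<B>. codim1_cover \<mu> e A \<B>)"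

lemma codim1_hausdorff_eq_SUP:
  "codim1_hausdorff \<mu> A = (SUP R\<in>{0<..}. codim1_hausdorff_content \<mu> R A)"
proof -
  let ?c = "\<lambda>R. codim1_hausdorff_content \<mu> R A"
  have anti: "?c R' \<le> ?c R" if "R \<le> R'" for R R'
    unfolding codim1_hausdorff_content_def by (rule INF_superset_mono) (use that in force)+
  have "(?c \<longlongrightarrow> (SUP R\<in>{0<..}. ?c R)) (at_right 0)"
  proof (rule order_tendstoI)
    fix a assume "a < (SUP R\<in>{0<..}. ?c R)"
    then obtain R0 where R0: "0 < R0" "a < ?c R0" by (auto simp: less_SUP_iff)
    have "\<forall>\<^sub>F R in at_right 0. R < R0"
      using R0(1) by (auto simp: eventually_at_right_field)
    then show "\<forall>\<^sub>F R in at_right 0. a < ?c R"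
    proof eventually_elim
      case (elim R)
      then show ?case using anti[of R R0] R0(2) by (auto intro: less_le_trans)
    qed
  next
    fix a assume a: "(SUP R\<in>{0<..}. ?c R) < a"
    have "\<forall>\<^sub>F R::real in at_right 0. 0 < R" by (simp add: eventually_at_right_less)
    then show "\<forall>\<^sub>F R in at_right 0. ?c R < a"
    proof eventually_elim
      case (elim R)
      then have "?c R \<le> (SUP R\<in>{0<..}. ?c R)" by (intro SUP_upper) auto
      then show ?case using a by (rule le_less_trans)
    qed
  qed
  then show ?thesis unfolding codim1_hausdorff_def by (intro tendsto_Lim) auto
qed

lemma codim1_small_coversI:
  assumes "codim1_hausdorff \<mu> A = 0"
  shows "codim1_small_covers \<mu> A"
  unfolding codim1_small_covers_def
proof (intro allI impI)
  fix e :: real assume e: "0 < e"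
  have "codim1_hausdorff_content \<mu> 1 A \<le> 0"
    using assms unfolding codim1_hausdorff_eq_SUP by (metis SUP_upper greaterThan_iff zero_less_one)
  then have "codim1_hausdorff_content \<mu> 1 A < ennreal e" using e by (auto intro: le_less_trans)
  then show "\<exists>\<B>. codim1_cover \<mu> e A \<B>"
    unfolding codim1_cover_def codim1_hausdorff_content_def INF_less_iff by blast
qed

lemma codim1_small_covers_subset: "codim1_small_covers \<mu> A \<Longrightarrow> B \<subseteq> A \<Longrightarrow> codim1_small_covers \<mu> B"
proof -
  assume *: "codim1_small_covers \<mu> A" "B \<subseteq> A"
  have "codim1_cover \<mu> e A \<B> \<Longrightarrow> codim1_cover \<mu> e B \<B>" for e \<B>
    using subset_trans[OF *(2)] unfolding codim1_cover_def by simp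
  then show "codim1_small_covers \<mu> B" using *(1) unfolding codim1_small_covers_def by blast
qed

text \<open>The unions of ever better coverings are open and intersect in a Borel set that they
  still cover. A Borel hull is wanted because additivity of the total variation is available for
  Borel sets.\<close>

lemma codim1_small_covers_borel_hull:
  assumes "codim1_small_covers \<mu> A"
  obtains A' where "A \<subseteq> A'" "A' \<in> sets borel" "codim1_small_covers \<mu> A'"
proof -
  have "\<exists>\<B>. codim1_cover \<mu> (inverse (Suc n)) A \<B>" for n
    using assms unfolding codim1_small_covers_def by simp
  then obtain \<B> where \<B>: "\<And>n. codim1_cover \<mu> (inverse (Suc n)) A (\<B> n)"
    by metis
  define A' where "A' = (\<Inter>n. \<Union>(x, r)\<in>\<B> n. ball x r)"
  show thesis
  proof (rule that)
    show "A \<subseteq> A'" using \<B> unfolding A'_def codim1_cover_def by blast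
    have "open (\<Union>(x, r)\<in>\<B> n. ball x r)" for n by auto
    then show "A' \<in> sets borel" unfolding A'_def by (intro sets.countable_INT) auto
    show "codim1_small_covers \<mu> A'"
      unfolding codim1_small_covers_def
    proof (intro allI impI)
      fix e :: real assume "0 < e"
      then obtain n where n: "inverse (Suc n) < e" using reals_Archimedean by blast
      then have "ennreal (inverse (Suc n)) \<le> ennreal e" by (intro ennreal_leI) simp
      then have "codim1_cover \<mu> e A' (\<B> n)"
        using \<B>[of n] unfolding codim1_cover_def A'_def by (auto intro: less_le_trans)
      then show "\<exists>\<B>. codim1_cover \<mu> e A' \<B>" ..
    qed
  qed
qed

context doubling_space
begin

lemma finite_small_cover:
  assumes "codim1_small_covers \<mu> K" "compact K" "0 < (e::real)"
  obtains F where "finite F" "\<forall>(x, r)\<in>F. 0 < r \<and> r \<le> 1" "K \<subseteq> (\<Union>(x, r)\<in>F. ball x r)"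
    "(\<Sum>(x, r)\<in>F. \<mu> (ball x r) / ennreal r) \<le> ennreal e"
proof -
  obtain \<B> where "codim1_cover \<mu> e K \<B>"
    using assms(1,3) unfolding codim1_small_covers_def by blast
  then have \<B>: "\<And>x r. (x, r) \<in> \<B> \<Longrightarrow> 0 < r \<and> r \<le> 1" "K \<subseteq> (\<Union>b\<in>\<B>. ball (fst b) (snd b))"
    "(\<Sum>\<^sub>\<infinity>(x, r)\<in>\<B>. \<mu> (ball x r) / ennreal r) < ennreal e"
    unfolding codim1_cover_def by (auto simp: case_prod_beta)
  obtain F where F: "F \<subseteq> \<B>" "finite F" "K \<subseteq> (\<Union>b\<in>F. ball (fst b) (snd b))"
    by (rule compactE_image[OF assms(2) _ \<B>(2)]) auto
  have "(\<Sum>(x, r)\<in>F. \<mu> (ball x r) / ennreal r) = (\<Sum>\<^sub>\<infinity>(x, r)\<in>F. \<mu> (ball x r) / ennreal r)"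
    using F(2) by simp
  also have "\<dots> \<le> (\<Sum>\<^sub>\<infinity>(x, r)\<in>\<B>. \<mu> (ball x r) / ennreal r)"
    by (rule infsum_mono_neutral) (use F(1) in \<open>auto simp: nonneg_summable_on_complete\<close>)
  also note less_imp_le[OF \<B>(3)]
  finally have "(\<Sum>(x, r)\<in>F. \<mu> (ball x r) / ennreal r) \<le> ennreal e" .
  moreover have "K \<subseteq> (\<Union>(x, r)\<in>F. ball x r)" using F(3) by (auto simp: case_prod_beta)
  moreover have "\<forall>(x, r)\<in>F. 0 < r \<and> r \<le> 1" using F(1) \<B>(1) by blast
  ultimately show thesis using that[of F] F(2) by blast
qed

lemma ball3_le:
  obtains C :: real where "C \<ge> 1" "\<And>x r. 0 < r \<Longrightarrow> \<mu> (ball x (3 * r)) \<le> ennreal C * \<mu> (ball x r)"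
proof -
  obtain C :: real where C: "C \<ge> 1" "\<And>x r. r > 0 \<Longrightarrow> \<mu> (ball x (2 ^ 2 * r)) \<le> ennreal C * \<mu> (ball x r)"
    using doubling_iterate by metis
  show thesis
  proof (rule that[OF C(1)])
    fix x :: 'a and r :: real assume r: "0 < r"
    have "\<mu> (ball x (3 * r)) \<le> \<mu> (ball x (2 ^ 2 * r))"
      using emeasure_mono[of "ball x (3 * r)" "ball x (2 ^ 2 * r)" M] r by (simp add: open_sets_M subset_ball)
    then show "\<mu> (ball x (3 * r)) \<le> ennreal C * \<mu> (ball x r)" using C(2)[OF r] order_trans by blast
  qed
qed

text \<open>
  Cutting \<open>u\<close> off near \<open>K\<close> by balls with small \<open>\<Sum> \<mu>(B) / r\<close> costs almost nothing.
\<close>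

lemma TV_remove_compact:
  fixes u :: "'a \<Rightarrow> real"
  assumes u: "u \<in> borel_measurable M" "\<And>x. u x \<in> {0..1}" and K: "compact K" "codim1_small_covers \<mu> K"
  shows "TV u UNIV \<le> TV u (- K)"
proof (cases "TV u (- K) < top")
  case True
  obtain C :: real where C: "C \<ge> 1" "\<And>x r. 0 < r \<Longrightarrow> \<mu> (ball x (3 * r)) \<le> ennreal C * \<mu> (ball x r)"
    using ball3_le by blast
  have oK: "open (- K)" using K(1) by (simp add: compact_imp_closed open_Compl)
  show ?thesis
  proof (rule TV_lower_semicontinuous[OF open_UNIV u(1)])
    fix T and e :: real assume T: "compactly_inside T (UNIV :: 'a set)" and e: "0 < e"
    \<comment> \<open>\<open>C\<close> absorbs the passage to balls of triple radius, and the factor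
      2 is the coefficient of \<open>g\<psi>\<close> in \<open>H\<close> below.\<close>
    define \<delta> where "\<delta> = e / (2 * C)"
    have \<delta>: "0 < \<delta>" using e C(1) by (simp add: \<delta>_def)
    obtain F where F': "finite F" "\<forall>(x, r)\<in>F. 0 < r \<and> r \<le> 1" "K \<subseteq> (\<Union>(x, r)\<in>F. ball x r)"
        "(\<Sum>(x, r)\<in>F. \<mu> (ball x r) / ennreal r) \<le> ennreal \<delta>"
      by (rule finite_small_cover[OF K(2,1) \<delta>])
    then have F: "finite F" "\<And>x r. (x, r) \<in> F \<Longrightarrow> 0 < r \<and> r \<le> 1" "K \<subseteq> (\<Union>(x, r)\<in>F. ball x r)"
        "(\<Sum>(x, r)\<in>F. \<mu> (ball x r) / ennreal r) \<le> ennreal \<delta>"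
      by auto
    define G where "G = (\<Union>(x, r)\<in>F. ball x r)"
    have G: "open G" "K \<subseteq> G" using F(3) by (auto simp: G_def)
    define \<psi> where "\<psi> y = min 1 (\<Sum>b\<in>F. bump b y)" for y
    define g\<psi> where "g\<psi> y = (\<Sum>b\<in>F. ennreal (1 / snd b) * indicator (ball (fst b) (3 * snd b)) y)" for y
    have \<psi>01: "0 \<le> \<psi> y" "\<psi> y \<le> 1" for y
      using bump_range by (auto simp: \<psi>_def intro!: sum_nonneg)
    have \<psi>1: "\<psi> y = 1" if y: "y \<in> G" for y
    proof -
      obtain x r where xr: "(x, r) \<in> F" "y \<in> ball x r" using y by (auto simp: G_def)
      then have "1 = bump (x, r) y" using bump_inside[OF _ xr(2)] F(2)[OF xr(1)] by simp
      also have "\<dots> \<le> (\<Sum>b\<in>F. bump b y)" using xr(1) F(1) bump_range by (intro member_le_sum) auto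
      finally show ?thesis by (simp add: \<psi>_def)
    qed
    have \<psi>supp: "\<exists>(x, r)\<in>F. y \<in> ball x (3 * r)" if "\<psi> y \<noteq> 0" for y
    proof (rule ccontr)
      assume *: "\<not> ?thesis"
      have "bump b y = 0" if "b \<in> F" for b
      proof (cases b)
        case (Pair x r)
        then have "0 < r" "y \<notin> ball x (3 * r)" using F(2)[of x r] * that by auto
        then show ?thesis using bump_outside[of r x y] Pair by auto
      qed
      then show False using that by (simp add: \<psi>_def)
    qed
    have lipsum: "locally_lipschitz UNIV (\<lambda>y. \<Sum>b\<in>F. bump b y)"
    proof (rule locally_lipschitz_sum[OF F(1)])
      fix b assume "b \<in> F"
      then show "locally_lipschitz UNIV (bump b)"
        using F(2) locally_lipschitz_lipschitz[OF bump_lipschitz] by (cases b) blast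
    qed
    have clip: "\<bar>(1 - min 1 s) - (1 - min 1 t)\<bar> \<le> 1 * \<bar>s - t\<bar>" for s t :: real by (auto simp: min_def)
    have lip\<psi>: "locally_lipschitz UNIV (\<lambda>y. 1 - \<psi> y)"
      unfolding \<psi>_def by (rule locally_lipschitz_compose[OF lipsum clip])
    have ugsum: "upper_gradient UNIV (\<lambda>y. ereal (\<Sum>b\<in>F. bump b y)) g\<psi>"
      unfolding g\<psi>_def
    proof (rule upper_gradient_sum[OF F(1)])
      fix b assume "b \<in> F"
      then show "upper_gradient UNIV (\<lambda>x. ereal (bump b x)) (\<lambda>x. ennreal (1 / snd b) * indicator (ball (fst b) (3 * snd b)) x)"
        using F(2) bump_upper_gradient by (cases b) auto
    qed
    have ug\<psi>: "upper_gradient UNIV (\<lambda>y. ereal (1 - \<psi> y)) g\<psi>"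
      using upper_gradient_compose[OF ugsum clip] by (simp add: \<psi>_def)
    have g\<psi>m: "g\<psi> \<in> borel_measurable borel" unfolding g\<psi>_def
      by (intro borel_measurable_sum borel_measurable_times_ennreal borel_measurable_const
          borel_measurable_indicator borel_open open_ball)
    have \<psi>m: "(\<lambda>y. 1 - \<psi> y) \<in> borel_measurable M"
      using locally_lipschitz_continuous[OF lip\<psi>] by (intro borel_measurable_M borel_measurable_continuous_onI)
    \<comment> \<open>This competitor for \<open>u\<close> vanishes on the neighbourhood
      \<open>G\<close> of \<open>K\<close>, so approximations of \<open>u\<close> off
      \<open>K\<close> suffice to approximate it on the whole space.\<close>
    define w where "w y = u y * (1 - \<psi> y)" for y
    have wm: "w \<in> borel_measurable M" unfolding w_def using u(1) \<psi>m by measurable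
    \<comment> \<open>Used with \<open>c b = 1 / snd b\<close> for the integral of
      \<open>g\<psi>\<close>, and with \<open>c b = 1\<close> for the measure of the set where
      \<open>w\<close> differs from \<open>u\<close>.\<close>
    have \<mu>3: "(\<Sum>b\<in>F. c b * \<mu> (ball (fst b) (3 * snd b))) \<le> ennreal (C * \<delta>)"
      if c: "\<And>b. b \<in> F \<Longrightarrow> c b \<le> ennreal (1 / snd b)" for c
    proof -
      have "(\<Sum>b\<in>F. c b * \<mu> (ball (fst b) (3 * snd b))) \<le> (\<Sum>b\<in>F. ennreal C * (\<mu> (ball (fst b) (snd b)) / ennreal (snd b)))"
      proof (rule sum_mono)
        fix b assume b: "b \<in> F"
        then have r: "0 < snd b" using F(2)[of "fst b" "snd b"] by simp
        have "c b * \<mu> (ball (fst b) (3 * snd b)) \<le> ennreal (1 / snd b) * (ennreal C * \<mu> (ball (fst b) (snd b)))"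
          using c[OF b] C(2)[OF r] by (intro mult_mono) auto
        also have "\<dots> = ennreal C * (\<mu> (ball (fst b) (snd b)) / ennreal (snd b))"
          using r by (simp add: divide_ennreal_def inverse_ennreal divide_inverse ac_simps)
        finally show "c b * \<mu> (ball (fst b) (3 * snd b)) \<le> \<dots>" .
      qed
      also have "\<dots> = ennreal C * (\<Sum>(x, r)\<in>F. \<mu> (ball x r) / ennreal r)"
        by (simp add: sum_distrib_left case_prod_beta)
      also have "\<dots> \<le> ennreal C * ennreal \<delta>" by (rule mult_left_mono[OF F(4)]) simp
      finally show ?thesis using C(1) \<delta> by (simp add: ennreal_mult)
    qed
    have dist: "(\<integral>\<^sup>+x\<in>T. ennreal \<bar>w x - u x\<bar> \<partial>M) \<le> ennreal e"
    proof -
      have "(\<integral>\<^sup>+x\<in>T. ennreal \<bar>w x - u x\<bar> \<partial>M) \<le> (\<integral>\<^sup>+y. (\<Sum>b\<in>F. indicator (ball (fst b) (3 * snd b)) y) \<partial>M)"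
      proof (rule nn_integral_mono)
        fix y
        have "\<bar>w y - u y\<bar> = u y * \<psi> y"
          using u(2)[of y] \<psi>01[of y] by (simp add: w_def algebra_simps)
        also have "\<dots> \<le> 1" using u(2)[of y] \<psi>01[of y] by (intro mult_le_one) auto
        finally have le1: "\<bar>w y - u y\<bar> \<le> 1" .
        show "ennreal \<bar>w y - u y\<bar> * indicator T y \<le> (\<Sum>b\<in>F. indicator (ball (fst b) (3 * snd b)) y)"
        proof (cases "\<psi> y = 0")
          case True
          then show ?thesis by (simp add: w_def)
        next
          case False
          then obtain b where b: "b \<in> F" "y \<in> ball (fst b) (3 * snd b)" using \<psi>supp by force
          have "ennreal \<bar>w y - u y\<bar> * indicator T y \<le> 1"
            using le1 by (auto simp: indicator_def)
          also have "1 = (indicator (ball (fst b) (3 * snd b)) y :: ennreal)" using b(2) by simp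
          also have "\<dots> \<le> (\<Sum>b\<in>F. indicator (ball (fst b) (3 * snd b)) y)"
            using b(1) F(1) by (intro member_le_sum) auto
          finally show ?thesis .
        qed
      qed
      also have "\<dots> = (\<Sum>b\<in>F. 1 * \<mu> (ball (fst b) (3 * snd b)))"
        by (subst nn_integral_sum) (auto simp: open_sets_M)
      also have "\<dots> \<le> ennreal (C * \<delta>)"
      proof (rule \<mu>3)
        fix b assume "b \<in> F"
        then have "0 < snd b" "snd b \<le> 1" using F(2)[of "fst b" "snd b"] by auto
        then show "1 \<le> ennreal (1 / snd b)" by simp
      qed
      also have "\<dots> \<le> ennreal e" using C(1) e by (intro ennreal_leI) (simp add: \<delta>_def)
      finally show ?thesis .
    qed
    have "TV w UNIV \<le> TV u (- K) + ennreal e"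
    proof (rule TV_leI[OF open_UNIV])
      fix T' and e' :: real assume T': "compactly_inside T' (UNIV :: 'a set)" and e': "0 < e'"
      \<comment> \<open>On \<open>G\<close> both \<open>h\<close> and \<open>w\<close> vanish, so
        \<open>v\<close> has to be accurate only on \<open>closure T' - G\<close>, a compact subset
        of \<open>- K\<close>.\<close>
      have "compact (closure T' - G)"
        using T' G(1) by (auto simp: compactly_inside_def compact_diff)
      then obtain S where S: "compactly_inside S (- K)" "closure T' - G \<subseteq> S"
        using compactly_inside_superset[OF oK, of "closure T' - G"] G(2) by blast
      obtain v g where v: "locally_lipschitz (- K) v" "upper_gradient (- K) (\<lambda>x. ereal (v x)) g"
        "(\<integral>\<^sup>+x\<in>S. ennreal \<bar>v x - u x\<bar> \<partial>M) \<le> ennreal e'" "(\<integral>\<^sup>+x\<in>- K. g x \<partial>M) \<le> TV u (- K) + ennreal e'"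
        by (rule TV_approx[OF True oK S(1) e'])
      \<comment> \<open>Clamping moves \<open>v\<close> no further from \<open>u\<close>, whose
        values lie in \<open>[0, 1]\<close>, and bounds the Leibniz term: with slack 1 the
        coefficient of \<open>g\<psi>\<close> is at most 2.\<close>
      define v' where "v' x = max 0 (min 1 (v x))" for x
      have v'lip: "locally_lipschitz (- K) v'"
        unfolding v'_def by (rule locally_lipschitz_compose[OF v(1) clamp_unit_lipschitz])
      have v'ug: "upper_gradient (- K) (\<lambda>x. ereal (v' x)) g"
        using upper_gradient_compose[OF v(2) clamp_unit_lipschitz] by (simp add: v'_def)
      have v'u: "\<bar>v' x - u x\<bar> \<le> \<bar>v x - u x\<bar>" for x
      proof -
        have "max 0 (min 1 (u x)) = u x" using u(2)[of x] by simp
        then show ?thesis using clamp_unit_lipschitz[of "v x" "u x"] by (simp add: v'_def)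
      qed
      have v'01: "0 \<le> v' x" "v' x \<le> 1" for x by (auto simp: v'_def)
      define h where "h x = (1 - \<psi> x) * v' x" for x
      define H where "H x = g x * indicator (- K) x + 2 * g\<psi> x" for x
      have Hm: "H \<in> borel_measurable borel"
        unfolding H_def
        by (intro borel_measurable_add[OF ennreal_restrict_borel[OF upper_gradientD(1)[OF v(2)] oK]]
            borel_measurable_times_ennreal[OF borel_measurable_const g\<psi>m])
      have hG: "h x = 0" if "x \<in> G" for x using \<psi>1[OF that] by (simp add: h_def)
      have cover: "x \<in> - K \<or> x \<in> G" for x using G(2) by blast
      have lip: "locally_lipschitz UNIV h"
      proof (rule locally_lipschitz_cong_local)
        fix x
        have "locally_lipschitz (- K) h"
          unfolding h_def by (rule locally_lipschitz_mult[OF locally_lipschitz_subset[OF lip\<psi>] v'lip]) simp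
        moreover have "locally_lipschitz G (\<lambda>x. 0)" by (rule locally_lipschitz_lipschitz[OF lipschitz_on_constant])
        ultimately show "\<exists>N h'. open N \<and> x \<in> N \<and> locally_lipschitz N h' \<and> (\<forall>y\<in>N. h y = h' y)"
          using cover[of x] oK G(1) hG by blast
      qed
      have ug: "upper_gradient UNIV (\<lambda>x. ereal (h x)) H"
      proof (rule upper_gradientI_local)
        show "H \<in> borel_measurable (restrict_space borel UNIV)" using Hm by (rule measurable_restrict_space1)
        fix x
        have "upper_gradient (- K) (\<lambda>x. ereal (h x)) H"
        proof (rule upper_gradient_mono)
          show "upper_gradient (- K) (\<lambda>x. ereal ((1 - \<psi> x) * v' x + (1 - (1 - \<psi> x)) * 0))
              (\<lambda>x. g x + ennreal 0 + ennreal (\<bar>v' x - 0\<bar> + 1) * g\<psi> x)"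
          proof (rule upper_gradient_leibniz[OF v'ug locally_lipschitz_continuous[OF v'lip]
                upper_gradient_lipschitz[OF lipschitz_on_constant] continuous_on_const])
            show "upper_gradient (- K) (\<lambda>x. ereal (1 - \<psi> x)) g\<psi>"
              by (rule upper_gradient_subset[OF ug\<psi>]) simp
          qed (use \<psi>01 in simp_all)
          show "H \<in> borel_measurable (restrict_space borel (- K))" using Hm by (rule measurable_restrict_space1)
          show "g x + ennreal 0 + ennreal (\<bar>v' x - 0\<bar> + 1) * g\<psi> x \<le> H x" if "x \<in> - K" for x
          proof -
            have "ennreal (\<bar>v' x - 0\<bar> + 1) \<le> ennreal 2" using v'01[of x] by (intro ennreal_leI) simp
            then show ?thesis using that by (auto simp: H_def intro!: add_left_mono mult_right_mono)
          qed
        qed (simp add: h_def)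
        moreover have "upper_gradient G (\<lambda>x. ereal (h x)) H"
        proof (rule upper_gradient_mono[OF upper_gradient_lipschitz[OF lipschitz_on_constant]])
          show "H \<in> borel_measurable (restrict_space borel G)" using Hm by (rule measurable_restrict_space1)
        qed (use hG in auto)
        ultimately show "\<exists>N. open N \<and> x \<in> N \<and> upper_gradient (N \<inter> UNIV) (\<lambda>x. ereal (h x)) H"
          using cover[of x] oK G(1) by auto
      qed
      have hdist: "(\<integral>\<^sup>+x\<in>T'. ennreal \<bar>h x - w x\<bar> \<partial>M) \<le> ennreal e'"
      proof -
        have "(\<integral>\<^sup>+x\<in>T'. ennreal \<bar>h x - w x\<bar> \<partial>M) \<le> (\<integral>\<^sup>+x\<in>S. ennreal \<bar>v x - u x\<bar> \<partial>M)"
        proof (rule nn_integral_mono)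
          fix x
          have hw: "h x - w x = (1 - \<psi> x) * (v' x - u x)" by (simp add: h_def w_def algebra_simps)
          show "ennreal \<bar>h x - w x\<bar> * indicator T' x \<le> ennreal \<bar>v x - u x\<bar> * indicator S x"
          proof (cases "x \<in> T' \<and> x \<notin> G")
            case True
            then have "x \<in> S" using S(2) closure_subset by blast
            moreover have "\<bar>h x - w x\<bar> \<le> 1 * \<bar>v x - u x\<bar>"
              unfolding hw abs_mult using \<psi>01[of x] v'u[of x] by (intro mult_mono) auto
            ultimately show ?thesis using True by (simp add: ennreal_leI)
          next
            case False
            then show ?thesis using \<psi>1[of x] by (auto simp: hw)
          qed
        qed
        then show ?thesis using v(3) order_trans by blast
      qed
      have "(\<integral>\<^sup>+x\<in>UNIV. H x \<partial>M) = (\<integral>\<^sup>+x\<in>- K. g x \<partial>M) + 2 * (\<integral>\<^sup>+x. g\<psi> x \<partial>M)"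
        unfolding H_def
        using borel_measurable_M[OF ennreal_restrict_borel[OF upper_gradientD(1)[OF v(2)] oK]] borel_measurable_M[OF g\<psi>m]
        by (simp add: nn_integral_add nn_integral_cmult)
      also have "(\<integral>\<^sup>+x. g\<psi> x \<partial>M) = (\<Sum>b\<in>F. ennreal (1 / snd b) * \<mu> (ball (fst b) (3 * snd b)))"
        unfolding g\<psi>_def by (subst nn_integral_sum) (auto simp: open_sets_M nn_integral_cmult)
      also have "\<dots> \<le> ennreal (C * \<delta>)" by (rule \<mu>3) simp
      finally have "(\<integral>\<^sup>+x\<in>UNIV. H x \<partial>M) \<le> (\<integral>\<^sup>+x\<in>- K. g x \<partial>M) + 2 * ennreal (C * \<delta>)"
        by (simp add: add_left_mono mult_left_mono)
      also have "2 * ennreal (C * \<delta>) = ennreal e"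
      proof -
        have "2 * ennreal (C * \<delta>) = ennreal (2 * (C * \<delta>))" using C(1) \<delta> by (simp add: ennreal_mult)
        also have "2 * (C * \<delta>) = e" using C(1) by (simp add: \<delta>_def)
        finally show ?thesis .
      qed
      also have "(\<integral>\<^sup>+x\<in>- K. g x \<partial>M) + ennreal e \<le> TV u (- K) + ennreal e' + ennreal e"
        by (rule add_right_mono[OF v(4)])
      finally have "(\<integral>\<^sup>+x\<in>UNIV. H x \<partial>M) \<le> TV u (- K) + ennreal e + ennreal e'" by (simp add: ac_simps)
      then show "\<exists>v g. locally_lipschitz UNIV v \<and> upper_gradient UNIV (\<lambda>x. ereal (v x)) g \<and>
          (\<integral>\<^sup>+x\<in>T'. ennreal \<bar>v x - w x\<bar> \<partial>M) \<le> ennreal e' \<and>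
          (\<integral>\<^sup>+x\<in>UNIV. g x \<partial>M) \<le> TV u (- K) + ennreal e + ennreal e'"
        using lip ug hdist by blast
    qed
    then show "\<exists>w\<in>borel_measurable M. (\<integral>\<^sup>+x\<in>T. ennreal \<bar>w x - u x\<bar> \<partial>M) \<le> ennreal e \<and>
        TV w UNIV \<le> TV u (- K) + ennreal e"
      using wm dist by blast
  qed
qed (simp add: less_top[symmetric])

text \<open>Outer regularity and \<open>TV_remove_compact\<close> show that the complement of a
  Borel hull of \<open>A\<close> already carries the whole perimeter; additivity and finiteness
  leave zero for the hull.\<close>

lemma perimeter_codim1_null:
  assumes \<Omega>: "bounded \<Omega>" "open \<Omega>" and fin: "perimeter \<mu> \<Omega> UNIV < top" and A: "codim1_hausdorff \<mu> A = 0"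
  shows "perimeter \<mu> \<Omega> A = 0"
proof -
  let ?u = "indicator \<Omega> :: 'a \<Rightarrow> real"
  have u: "?u \<in> borel_measurable M" using \<Omega>(2) open_sets_M by measurable
  have fin': "TV ?u UNIV < top" using fin total_variation_open_eq[of UNIV ?u] by (simp add: perimeter_def)
  obtain A' where A': "A \<subseteq> A'" "A' \<in> sets borel" "codim1_small_covers \<mu> A'"
    using codim1_small_covers_borel_hull[OF codim1_small_coversI[OF A]] by blast
  let ?P = "total_variation \<mu> ?u"
  have "?P UNIV \<le> ?P (- A')"
  proof (rule ennreal_le_epsilon)
    fix e :: real assume e: "0 < e"
    obtain W where W: "open W" "- A' \<subseteq> W" "TV ?u W \<le> ?P (- A') + ennreal e"
      using total_variation_outer_open[OF total_variation_finite[OF fin'] e] by blast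
    \<comment> \<open>The complement of \<open>W\<close> need not be compact, but off
      \<open>closure \<Omega>\<close> the indicator is constant, and boundedness of
      \<open>\<Omega>\<close> makes the remaining part compact.\<close>
    define K where "K = closure \<Omega> - W"
    have K: "compact K" "K \<subseteq> A'"
      using compact_diff[OF compact_closed_bounded[OF closed_closure bounded_closure[OF \<Omega>(1)]] W(1)] W(2)
      by (auto simp: K_def)
    have "?P UNIV = TV ?u UNIV" by (rule total_variation_open_eq) simp
    also have "\<dots> \<le> TV ?u (- K)"
      by (rule TV_remove_compact[OF u _ K(1) codim1_small_covers_subset[OF A'(3) K(2)]]) (simp add: indicator_def)
    also have "- K = W \<union> (- closure \<Omega>)" by (auto simp: K_def)
    also have "TV ?u (W \<union> (- closure \<Omega>)) \<le> TV ?u W + TV ?u (- closure \<Omega>)"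
      using W(1) by (intro TV_Un[OF _ _ u fin']) auto
    also have "TV ?u (- closure \<Omega>) = TV (\<lambda>_. 0) (- closure \<Omega>)"
      by (rule TV_cong) (use closure_subset in \<open>auto simp: indicator_def\<close>)
    also have "\<dots> = 0" by (rule TV_const) auto
    finally show "?P UNIV \<le> ?P (- A') + ennreal e" using W(3) by simp
  qed
  moreover have "?P A' + ?P (- A') = ?P UNIV"
    using borel_caratheodory_total_variation[OF u fin' A'(2)] by (auto simp: lambda_system_def Compl_eq_Diff_UNIV dest: spec[where x = UNIV])
  moreover have "?P (- A') < top" by (rule total_variation_finite[OF fin'])
  ultimately have "?P (- A') + ?P A' \<le> ?P (- A') + 0" "?P (- A') \<noteq> top"
    by (simp_all add: add.commute)
  then have "?P A' = 0" unfolding ennreal_add_left_cancel_le by simp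
  then show ?thesis
    unfolding perimeter_def using total_variation_mono[OF A'(1)] by (metis le_zero_eq)
qed

end

section \<open>The coarea inequality\<close>

context doubling_space
begin

text \<open>\<open>min (u x) (t + h)\<close> is truncated at level \<open>t\<close>; its part above
  \<open>t\<close>, shifted down by \<open>t\<close>, is the slab function of height
  \<open>h\<close>.\<close>

lemma TV_truncate_increment:
  assumes U: "open U" and u: "u \<in> borel_measurable M" and "0 \<le> t" "0 \<le> h"
  shows "TV (\<lambda>x. min (u x) t) U + TV (\<lambda>x. min (max (u x - t) 0) h) U \<le> TV (\<lambda>x. min (u x) (t + h)) U"
proof -
  define w where "w x = min (u x) (t + h)" for x
  have wm: "(\<lambda>x. max (w x) t) \<in> borel_measurable M" unfolding w_def using u by measurable
  have "TV (\<lambda>x. max (w x) t - t) U \<le> ennreal 1 * TV (\<lambda>x. max (w x) t) U"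
    by (rule TV_compose[OF U wm]) auto
  moreover have "max (w x) t - t = min (max (u x - t) 0) h" for x using assms(4) by (auto simp: w_def)
  moreover have "min (w x) t = min (u x) t" for x using assms(4) by (auto simp: w_def)
  ultimately have "TV (\<lambda>x. min (u x) t) U + TV (\<lambda>x. min (max (u x - t) 0) h) U
      \<le> TV (\<lambda>x. min (w x) t) U + TV (\<lambda>x. max (w x) t) U"
    by (simp add: add_left_mono)
  also have "\<dots> \<le> TV w U" by (rule TV_truncate[OF U])
  finally show ?thesis by (simp add: w_def[abs_def])
qed

text \<open>
  The approximations \<open>min ((u - t)\<^sup>+) h / h\<close> of the indicator of the superlevel set have total
  variation at most a difference quotient of the monotone function \<open>t \<mapsto> TV (min u t)\<close>.
\<close>

lemma TV_superlevel_le: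
  assumes U: "open U" and u: "u \<in> borel_measurable M"
    and q: "\<And>n::nat. ennreal (real (Suc n)) * TV (\<lambda>x. min (max (u x - t) 0) (1 / Suc n)) U \<le> q n"
  shows "TV (indicator {x. t < u x}) U \<le> liminf q"
proof (cases "liminf q < top")
  case True
  define w where "w n x = real (Suc n) * min (max (u x - t) 0) (1 / Suc n)" for n :: nat and x
  have wm: "w n \<in> borel_measurable M" for n unfolding w_def using u by measurable
  have Em: "(indicator {x. t < u x} :: 'a \<Rightarrow> real) \<in> borel_measurable M" using u by measurable
  have TVw: "TV (w n) U \<le> q n" for n
  proof -
    have m: "(\<lambda>x. min (max (u x - t) 0) (1 / Suc n)) \<in> borel_measurable M" using u by measurable
    have "TV (w n) U \<le> ennreal (real (Suc n)) * TV (\<lambda>x. min (max (u x - t) 0) (1 / Suc n)) U"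
      unfolding w_def
      by (rule TV_compose[where f = "\<lambda>s. real (Suc n) * s", OF U m])
         (auto simp: abs_mult right_diff_distrib[symmetric])
    then show ?thesis using q order_trans by blast
  qed
  have w01: "0 \<le> w n x" "w n x \<le> 1" for n x
  proof -
    show "0 \<le> w n x" by (simp add: w_def)
    have "w n x \<le> real (Suc n) * (1 / Suc n)" unfolding w_def by (intro mult_left_mono) auto
    then show "w n x \<le> 1" by simp
  qed
  have wlim: "(\<lambda>n. w n x) \<longlonglongrightarrow> indicator {x. t < u x} x" for x
  proof (cases "t < u x")
    case True
    then obtain N where N: "inverse (real (Suc N)) < u x - t" using reals_Archimedean[of "u x - t"] by auto
    have "w n x = 1" if "N \<le> n" for n
    proof -
      have "1 / real (Suc n) \<le> inverse (real (Suc N))" using that by (simp add: divide_simps)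
      then have "min (max (u x - t) 0) (1 / Suc n) = 1 / Suc n" using N by auto
      then show ?thesis unfolding w_def by simp
    qed
    then have "\<forall>\<^sub>F n in sequentially. w n x = 1" unfolding eventually_sequentially by blast
    then show ?thesis using True by (simp add: tendsto_eventually)
  next
    case False
    then have "w n x = 0" for n by (auto simp: w_def)
    then show ?thesis using False by simp
  qed
  show ?thesis
  proof (rule TV_lower_semicontinuous[OF U Em])
    fix T and e :: real assume T: "compactly_inside T U" and e: "0 < e"
    have Tm: "T \<in> sets M" using open_sets_M[OF compactly_inside_open[OF T]] .
    have Tfin: "emeasure M T < top" by (rule compactly_inside_finite[OF T])
    have "(\<lambda>n. \<integral>\<^sup>+x\<in>T. ennreal \<bar>w n x - indicator {x. t < u x} x\<bar> \<partial>M) \<longlonglongrightarrow> (\<integral>\<^sup>+x. 0 \<partial>M)"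
    proof (rule nn_integral_dominated_convergence[where w = "indicator T"])
      show "(\<integral>\<^sup>+x. indicator T x \<partial>M) < \<infinity>" using Tm Tfin by simp
      show "AE x in M. ennreal \<bar>w n x - indicator {x. t < u x} x\<bar> * indicator T x \<le> indicator T x" for n
      proof (rule AE_I2)
        fix x
        have "\<bar>w n x - indicator {x. t < u x} x\<bar> \<le> 1" using w01[of n x] by (auto simp: indicator_def)
        then show "ennreal \<bar>w n x - indicator {x. t < u x} x\<bar> * indicator T x \<le> indicator T x"
          by (auto simp: indicator_def)
      qed
      show "AE x in M. (\<lambda>n. ennreal \<bar>w n x - indicator {x. t < u x} x\<bar> * indicator T x) \<longlonglongrightarrow> 0"
      proof (rule AE_I2)
        fix x
        have "(\<lambda>n. \<bar>w n x - indicator {x. t < u x} x\<bar>) \<longlonglongrightarrow> 0"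
          using tendsto_rabs_zero[OF LIM_zero[OF wlim]] .
        then have "(\<lambda>n. ennreal \<bar>w n x - indicator {x. t < u x} x\<bar>) \<longlonglongrightarrow> 0"
          using tendsto_ennrealI by fastforce
        then show "(\<lambda>n. ennreal \<bar>w n x - indicator {x. t < u x} x\<bar> * indicator T x) \<longlonglongrightarrow> 0"
          by (cases "x \<in> T") auto
      qed
    qed (use wm Em Tm in measurable)
    then have "\<forall>\<^sub>F n in sequentially. (\<integral>\<^sup>+x\<in>T. ennreal \<bar>w n x - indicator {x. t < u x} x\<bar> \<partial>M) < ennreal e"
      using e by (intro order_tendstoD) auto
    moreover have "\<exists>\<^sub>F n in sequentially. q n < liminf q + ennreal e"
    proof (rule ccontr)
      assume "\<not> ?thesis"
      then have "liminf q + ennreal e \<le> liminf q"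
        by (intro Liminf_bounded) (simp add: frequently_def not_less)
      then show False
        using True e ennreal_add_left_cancel_le[of "liminf q" "ennreal e" 0] by (simp add: less_top)
    qed
    ultimately have "\<exists>\<^sub>F n in sequentially. (\<integral>\<^sup>+x\<in>T. ennreal \<bar>w n x - indicator {x. t < u x} x\<bar> \<partial>M) < ennreal e
        \<and> q n < liminf q + ennreal e"
      by (rule frequently_eventually_conj[rotated])
    then obtain n where "(\<integral>\<^sup>+x\<in>T. ennreal \<bar>w n x - indicator {x. t < u x} x\<bar> \<partial>M) < ennreal e"
      "q n < liminf q + ennreal e"
      by (auto dest: frequently_ex)
    then show "\<exists>w\<in>borel_measurable M. (\<integral>\<^sup>+x\<in>T. ennreal \<bar>w x - indicator {x. t < u x} x\<bar> \<partial>M) \<le> ennreal e \<and>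
        TV w U \<le> liminf q + ennreal e"
      using wm TVw[of n] by (intro bexI[of _ "w n"]) auto
  qed
qed (simp add: less_top[symmetric])

text \<open>A telescoping argument: translation by \<open>h\<close> turns the integral of
  \<open>V (t + h)\<close> into one over \<open>(h, 1 + h)\<close>, which exceeds that of
  \<open>V\<close> over \<open>(0, 1)\<close> by at most \<open>h * c\<close>.\<close>

lemma nn_integral_increment_le:
  fixes V :: "real \<Rightarrow> real"
  assumes V: "mono V" "\<And>t. 0 \<le> V t" "\<And>t. V t \<le> c" and h: "0 < h"
  shows "(\<integral>\<^sup>+t\<in>{0<..<1}. ennreal (V (t + h) - V t) \<partial>lborel) \<le> ennreal (h * c)"
proof -
  have c0: "0 \<le> c" using V(2,3) order_trans by blast
  have [measurable]: "V \<in> borel_measurable borel" by (rule borel_measurable_mono[OF V(1)])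
  let ?b = "\<integral>\<^sup>+t\<in>{0<..<1}. ennreal (V t) \<partial>lborel"
  have "?b \<le> (\<integral>\<^sup>+t\<in>{0<..<1::real}. ennreal c \<partial>lborel)"
    using V(3) by (intro nn_integral_mono) (auto simp: indicator_def ennreal_leI)
  also have "\<dots> < top" by (simp add: nn_integral_cmult_indicator)
  finally have bfin: "?b \<noteq> top" by simp
  have "?b + (\<integral>\<^sup>+t\<in>{0<..<1}. ennreal (V (t + h) - V t) \<partial>lborel)
      = (\<integral>\<^sup>+t. ennreal (V t) * indicator {0<..<1} t + ennreal (V (t + h) - V t) * indicator {0<..<1} t \<partial>lborel)"
    by (subst nn_integral_add) auto
  also have "\<dots> = (\<integral>\<^sup>+t. ennreal (V (h + 1 * t)) * indicator {h<..<1 + h} (h + 1 * t) \<partial>lborel)"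
  proof (rule nn_integral_cong)
    fix t
    have "V t \<le> V (t + h)" using V(1) h by (simp add: monoD)
    then show "ennreal (V t) * indicator {0<..<1} t + ennreal (V (t + h) - V t) * indicator {0<..<1} t
        = ennreal (V (h + 1 * t)) * indicator {h<..<1 + h} (h + 1 * t)"
      using V(2)[of t] by (auto simp: indicator_def add.commute simp flip: ennreal_plus)
  qed
  also have "\<dots> = (\<integral>\<^sup>+t\<in>{h<..<1 + h}. ennreal (V t) \<partial>lborel)"
    by (subst (2) nn_integral_real_affine[of _ 1 h]) auto
  also have "\<dots> \<le> (\<integral>\<^sup>+t. ennreal (V t) * indicator {0<..<1} t + ennreal c * indicator {1..1 + h} t \<partial>lborel)"
    using V(3) h by (intro nn_integral_mono) (auto simp: indicator_def ennreal_leI)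
  also have "\<dots> = ?b + ennreal (h * c)"
    using h c0 by (subst nn_integral_add) (auto simp: nn_integral_cmult_indicator ennreal_mult mult.commute)
  finally show ?thesis using bfin unfolding ennreal_add_left_cancel_le by simp
qed

text \<open>Fatou's lemma for the difference quotients of the variation of the truncations. The
  Borel majorant \<open>q\<close> stands in for the perimeter of the superlevel sets, whose
  measurability in \<open>t\<close> is left open.\<close>

lemma coarea_le:
  assumes U: "open U" and u: "u \<in> borel_measurable M" and fin: "TV (\<lambda>x. max (u x) 0) U < top"
  obtains q :: "real \<Rightarrow> ennreal" where "q \<in> borel_measurable borel"
    "\<And>t. 0 \<le> t \<Longrightarrow> TV (indicator {x. t < u x}) U \<le> q t"
    "(\<integral>\<^sup>+t\<in>{0<..<1}. q t \<partial>lborel) \<le> TV (\<lambda>x. max (u x) 0) U"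
proof -
  define p where "p x = max (u x) 0" for x
  have pm: "p \<in> borel_measurable M" unfolding p_def using u by measurable
  have pfin: "TV p U < top" using fin by (simp add: p_def[abs_def])
  \<comment> \<open>The value 0 at negative levels makes \<open>V\<close> monotone on the whole
    line, hence Borel.\<close>
  define V where "V t = (if 0 \<le> t then enn2real (TV (\<lambda>x. min (p x) t) U) else 0)" for t :: real
  have trunc: "TV (\<lambda>x. min (p x) t) U \<le> TV p U" for t
    using TV_truncate[OF U, of p t] by (rule order_trans[rotated]) (simp add: add_increasing2)
  have Veq: "ennreal (V t) = TV (\<lambda>x. min (p x) t) U" if "0 \<le> t" for t
    using trunc[of t] pfin that by (auto simp: V_def intro: le_less_trans)
  define c where "c = enn2real (TV p U)"
  have ceq: "ennreal c = TV p U" using pfin by (simp add: c_def)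
  have V0: "0 \<le> V t" for t by (simp add: V_def)
  have Vc: "V t \<le> c" for t
    using trunc[of t] pfin by (auto simp: V_def c_def intro: enn2real_mono)
  have inc: "TV (\<lambda>x. min (max (p x - t) 0) h) U \<le> ennreal (V (t + h) - V t)" "V t \<le> V (t + h)"
    if "0 \<le> t" "0 \<le> h" for t h
  proof -
    have *: "ennreal (V t) + TV (\<lambda>x. min (max (p x - t) 0) h) U \<le> ennreal (V (t + h))"
      using TV_truncate_increment[OF U pm that] that by (simp add: Veq)
    then have "ennreal (V t) \<le> ennreal (V (t + h))" by (rule order_trans[rotated]) (simp add: add_increasing2)
    then show "V t \<le> V (t + h)" using V0 by (simp add: ennreal_le_iff)
    then have "ennreal (V (t + h)) = ennreal (V t) + ennreal (V (t + h) - V t)"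
      using V0 by (simp flip: ennreal_plus)
    then show "TV (\<lambda>x. min (max (p x - t) 0) h) U \<le> ennreal (V (t + h) - V t)"
      using * by (simp add: ennreal_add_left_cancel_le)
  qed
  have Vmono: "mono V"
  proof (rule monoI)
    fix s t :: real assume "s \<le> t"
    then show "V s \<le> V t" using inc(2)[of s "t - s"] V0[of t] by (cases "0 \<le> s") (auto simp: V_def[of s])
  qed
  have [measurable]: "V \<in> borel_measurable borel" by (rule borel_measurable_mono[OF Vmono])
  define qn where "qn n t = ennreal (real (Suc n)) * ennreal (V (t + 1 / Suc n) - V t)" for n :: nat and t
  define q where "q t = liminf (\<lambda>n. qn n t)" for t
  have qnm [measurable]: "qn n \<in> borel_measurable borel" for n unfolding qn_def by measurable
  show thesis
  proof (rule that)
    show "q \<in> borel_measurable borel" unfolding q_def by measurable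
    fix t :: real assume t: "0 \<le> t"
    have "TV (indicator {x. t < p x}) U \<le> q t"
      unfolding q_def
      by (rule TV_superlevel_le[OF U pm])
         (use inc(1)[OF t] in \<open>auto simp: qn_def intro!: mult_left_mono\<close>)
    moreover have "{x. t < p x} = {x. t < u x}" using t by (auto simp: p_def)
    ultimately show "TV (indicator {x. t < u x}) U \<le> q t" by simp
  next
    have "(\<integral>\<^sup>+t\<in>{0<..<1}. q t \<partial>lborel) = (\<integral>\<^sup>+t. liminf (\<lambda>n. qn n t * indicator {0<..<1} t) \<partial>lborel)"
      unfolding q_def by (intro nn_integral_cong) (auto simp: indicator_def Liminf_const)
    also have "\<dots> \<le> liminf (\<lambda>n. \<integral>\<^sup>+t\<in>{0<..<1}. qn n t \<partial>lborel)"
      by (rule nn_integral_liminf) measurable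
    also have "\<dots> \<le> liminf (\<lambda>n. TV p U)"
    proof (intro Liminf_mono always_eventually allI)
      fix n
      have "(\<integral>\<^sup>+t\<in>{0<..<1}. qn n t \<partial>lborel)
          = ennreal (real (Suc n)) * (\<integral>\<^sup>+t\<in>{0<..<1}. ennreal (V (t + 1 / Suc n) - V t) \<partial>lborel)"
        unfolding qn_def mult.assoc by (rule nn_integral_cmult) measurable
      also have "\<dots> \<le> ennreal (real (Suc n)) * ennreal (1 / Suc n * c)"
        by (intro mult_left_mono nn_integral_increment_le[OF Vmono V0 Vc]) auto
      also have "\<dots> = ennreal (real (Suc n) * (1 / Suc n * c))"
        by (rule ennreal_mult'[symmetric]) simp
      also have "\<dots> = TV p U" by (simp add: ceq)
      finally show "(\<integral>\<^sup>+t\<in>{0<..<1}. qn n t \<partial>lborel) \<le> TV p U" .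
    qed
    also have "\<dots> = TV (\<lambda>x. max (u x) 0) U" by (simp add: Liminf_const p_def[abs_def])
    finally show "(\<integral>\<^sup>+t\<in>{0<..<1}. q t \<partial>lborel) \<le> TV (\<lambda>x. max (u x) 0) U" .
  qed
qed

end

section \<open>Traces\<close>

text \<open>On the boundary \<open>bv_trace\<close> is only known to agree almost everywhere with a
  measurable function; completeness of the perimeter measure makes the boundary integrands
  measurable.\<close>

lemma (in complete_measure) borel_measurable_cong_AE:
  fixes f g :: "'a \<Rightarrow> 'b::topological_space"
  assumes g: "g \<in> borel_measurable M" and ae: "AE x in M. f x = g x"
  shows "f \<in> borel_measurable M"
proof (rule measurableI)
  fix A :: "'b set" assume A: "A \<in> sets borel"
  have "AE x in M. x \<in> g -` A \<inter> space M \<longleftrightarrow> x \<in> f -` A \<inter> space M"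
    using ae by eventually_elim simp
  then show "f -` A \<inter> space M \<in> sets M"
    using measurable_sets[OF g A] in_sets_AE by blast
qed simp

context doubling_space
begin

text \<open>The integral over \<open>ball x r\<close> is lower semicontinuous in \<open>x\<close>, because the balls are open.\<close>

lemma ball_integral_borel_measurable:
  assumes k: "k \<in> borel_measurable M"
  shows "(\<lambda>x. \<integral>\<^sup>+y\<in>ball x r. k y \<partial>M) \<in> borel_measurable borel"
proof (rule borel_measurableI_greater)
  fix a
  have "open {x. a < (\<integral>\<^sup>+y\<in>ball x r. k y \<partial>M)}"
    unfolding open_contains_ball
  proof (intro ballI, clarify)
    fix x assume "a < (\<integral>\<^sup>+y\<in>ball x r. k y \<partial>M)"
    also have "(\<integral>\<^sup>+y\<in>ball x r. k y \<partial>M) = (\<integral>\<^sup>+y. (SUP n. k y * indicator (ball x (r - inverse (Suc n))) y) \<partial>M)"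
    proof (rule nn_integral_cong)
      fix y
      have "(SUP n. indicator (ball x (r - inverse (Suc n))) y :: ennreal) = indicator (ball x r) y"
      proof (cases "y \<in> ball x r")
        case True
        then obtain n where n: "inverse (real (Suc n)) < r - dist x y" using reals_Archimedean[of "r - dist x y"] by auto
        show ?thesis
        proof (rule antisym)
          show "(SUP n. indicator (ball x (r - inverse (Suc n))) y :: ennreal) \<le> indicator (ball x r) y"
            using True by (intro SUP_least) (auto simp: indicator_def)
          show "indicator (ball x r) y \<le> (SUP n. indicator (ball x (r - inverse (Suc n))) y :: ennreal)"
            using n by (intro SUP_upper2[of n]) (auto simp: indicator_def)
        qed
      next
        case False
        have "y \<notin> ball x (r - inverse (Suc n))" for n
        proof -
          have "0 < inverse (real (Suc n))" by simp
          then show ?thesis using False unfolding mem_ball by linarith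
        qed
        then show ?thesis using False by simp
      qed
      then show "k y * indicator (ball x r) y = (SUP n. k y * indicator (ball x (r - inverse (Suc n))) y)"
        by (simp add: SUP_mult_left_ennreal[symmetric])
    qed
    also have "\<dots> = (SUP n. \<integral>\<^sup>+y\<in>ball x (r - inverse (Suc n)). k y \<partial>M)"
    proof (rule nn_integral_monotone_convergence_SUP)
      show "incseq (\<lambda>n y. k y * indicator (ball x (r - inverse (Suc n))) y)"
      proof (intro incseq_SucI le_funI mult_left_mono)
        fix n y
        have "inverse (real (Suc (Suc n))) \<le> inverse (real (Suc n))" by (simp add: divide_simps)
        then show "(indicator (ball x (r - inverse (Suc n))) y :: ennreal) \<le> indicator (ball x (r - inverse (Suc (Suc n)))) y"
        proof (cases "y \<in> ball x (r - inverse (Suc n))")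
          case True
          then have "y \<in> ball x (r - inverse (Suc (Suc n)))"
            using \<open>inverse _ \<le> inverse _\<close> unfolding mem_ball by linarith
          then show ?thesis by (simp add: indicator_def)
        qed simp
      qed simp
      show "(\<lambda>y. k y * indicator (ball x (r - inverse (Suc n))) y) \<in> borel_measurable M" for n
        using k open_sets_M[OF open_ball] by measurable
    qed
    finally obtain n where n: "a < (\<integral>\<^sup>+y\<in>ball x (r - inverse (Suc n)). k y \<partial>M)"
      by (auto simp: less_SUP_iff)
    have "ball x (inverse (Suc n)) \<subseteq> {x. a < (\<integral>\<^sup>+y\<in>ball x r. k y \<partial>M)}"
    proof clarify
      fix z assume z: "z \<in> ball x (inverse (Suc n))"
      have "ball x (r - inverse (Suc n)) \<subseteq> ball z r"
      proof
        fix y assume "y \<in> ball x (r - inverse (Suc n))"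
        then show "y \<in> ball z r" using z dist_triangle[of z y x] by (simp add: dist_commute)
      qed
      then have "(\<integral>\<^sup>+y\<in>ball x (r - inverse (Suc n)). k y \<partial>M) \<le> (\<integral>\<^sup>+y\<in>ball z r. k y \<partial>M)"
        by (intro nn_integral_mono) (auto simp: indicator_def)
      then show "a < (\<integral>\<^sup>+y\<in>ball z r. k y \<partial>M)" using n by (rule less_le_trans[rotated])
    qed
    then show "\<exists>e>0. ball x e \<subseteq> {x. a < (\<integral>\<^sup>+y\<in>ball x r. k y \<partial>M)}"
      by (intro exI[of _ "inverse (Suc n)"]) simp
  qed
  then show "{x \<in> space borel. a < (\<integral>\<^sup>+y\<in>ball x r. k y \<partial>M)} \<in> sets borel" by simp
qed

text \<open>The open set \<open>\<Omega>\<close> contains a small ball inside every ball about a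
  frontier point, so averages there have a positive denominator.\<close>

lemma measure_ball_domain:
  assumes "open \<Omega>" "x \<in> frontier \<Omega>" "0 < r"
  shows "\<mu> (ball x r \<inter> \<Omega>) \<noteq> 0" "\<mu> (ball x r \<inter> \<Omega>) \<noteq> top"
    "emeasure M (ball x r \<inter> \<Omega>) = \<mu> (ball x r \<inter> \<Omega>)" "ball x r \<inter> \<Omega> \<in> sets M"
proof -
  show s: "ball x r \<inter> \<Omega> \<in> sets M" using assms(1) by (intro open_sets_M) auto
  then show e: "emeasure M (ball x r \<inter> \<Omega>) = \<mu> (ball x r \<inter> \<Omega>)" by (rule emeasure_M)
  have "x \<in> closure \<Omega>" using assms(2) by (simp add: frontier_def)
  then obtain y where "y \<in> \<Omega>" "dist y x < r" using assms(3) closure_approachable by blast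
  then have "y \<in> ball x r \<inter> \<Omega>" by (simp add: dist_commute)
  then obtain \<rho> where \<rho>: "0 < \<rho>" "ball y \<rho> \<subseteq> ball x r \<inter> \<Omega>"
    using assms(1) by (metis open_Int open_ball openE)
  have "\<mu> (ball y \<rho>) \<le> \<mu> (ball x r \<inter> \<Omega>)" using emeasure_mono[OF \<rho>(2) s] e by simp
  then show "\<mu> (ball x r \<inter> \<Omega>) \<noteq> 0" using ball_positive[OF \<rho>(1), of y] by auto
  show "\<mu> (ball x r \<inter> \<Omega>) \<noteq> top" using bounded_finite[of "ball x r \<inter> \<Omega>"] e by (auto simp: bounded_Int)
qed

definition domain_average :: "'a set \<Rightarrow> ('a \<Rightarrow> ennreal) \<Rightarrow> 'a \<Rightarrow> real \<Rightarrow> ennreal" where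
  "domain_average \<Omega> h x r = (\<integral>\<^sup>+y\<in>ball x r \<inter> \<Omega>. h y \<partial>M) / \<mu> (ball x r \<inter> \<Omega>)"

lemma is_trace_iff_average:
  "is_trace \<mu> \<Omega> u x c \<longleftrightarrow> x \<in> frontier \<Omega> \<and> ((\<lambda>r. domain_average \<Omega> (\<lambda>y. ennreal \<bar>u y - c\<bar>) x r) \<longlongrightarrow> 0) (at_right 0)"
  by (simp add: is_trace_def domain_average_def)

lemma domain_average_borel_measurable:
  assumes "open \<Omega>" "h \<in> borel_measurable M"
  shows "(\<lambda>x. domain_average \<Omega> h x r) \<in> borel_measurable borel"
proof -
  have *: "(\<lambda>x. \<integral>\<^sup>+y\<in>ball x r \<inter> \<Omega>. k y \<partial>M) \<in> borel_measurable borel" if "k \<in> borel_measurable M" for k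
  proof -
    have "(\<lambda>y. k y * indicator \<Omega> y) \<in> borel_measurable M" using that open_sets_M[OF assms(1)] by measurable
    from ball_integral_borel_measurable[OF this, of r] show ?thesis
      by (simp add: indicator_inter_arith mult.assoc mult.commute[of "indicator \<Omega> _"])
  qed
  have "\<mu> (ball x r \<inter> \<Omega>) = (\<integral>\<^sup>+y\<in>ball x r \<inter> \<Omega>. 1 \<partial>M)" for x
  proof -
    have "ball x r \<inter> \<Omega> \<in> sets M" using assms(1) by (intro open_sets_M) auto
    then show ?thesis by (simp add: emeasure_M)
  qed
  then show ?thesis
    unfolding domain_average_def using *[OF assms(2)] *[of "\<lambda>_. 1"] by simp
qed

lemma domain_average_le_add:
  assumes \<Omega>: "open \<Omega>" "x \<in> frontier \<Omega>" "0 < r" and m: "h \<in> borel_measurable M" "k \<in> borel_measurable M"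
    and le: "\<And>y. y \<in> \<Omega> \<Longrightarrow> g y \<le> h y + k y"
  shows "domain_average \<Omega> g x r \<le> domain_average \<Omega> h x r + domain_average \<Omega> k x r"
proof -
  note [measurable] = m measure_ball_domain(4)[OF \<Omega>]
  have "(\<integral>\<^sup>+y\<in>ball x r \<inter> \<Omega>. g y \<partial>M)
      \<le> (\<integral>\<^sup>+y. h y * indicator (ball x r \<inter> \<Omega>) y + k y * indicator (ball x r \<inter> \<Omega>) y \<partial>M)"
    using le by (intro nn_integral_mono) (auto simp: indicator_def)
  also have "\<dots> = (\<integral>\<^sup>+y\<in>ball x r \<inter> \<Omega>. h y \<partial>M) + (\<integral>\<^sup>+y\<in>ball x r \<inter> \<Omega>. k y \<partial>M)"
    by (rule nn_integral_add) measurable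
  finally show ?thesis
    unfolding domain_average_def by (simp add: divide_right_mono_ennreal flip: add_divide_distrib_ennreal)
qed

lemma domain_average_const:
  assumes \<Omega>: "open \<Omega>" "x \<in> frontier \<Omega>" "0 < r"
  shows "domain_average \<Omega> (\<lambda>_. c) x r = c"
  unfolding domain_average_def
  using measure_ball_domain[OF \<Omega>] by (simp add: nn_integral_cmult_indicator mult_divide_eq_ennreal)

text \<open>\<open>ennreal\<close> sends negative numbers to 0, so both sides speak of positive
  parts; taking the positive part does not increase distances, whence the sandwich between
  \<open>c\<close> minus and plus the defining average.\<close>

lemma domain_average_positive_part_tendsto:
  assumes \<Omega>: "open \<Omega>" and u: "u \<in> borel_measurable M" and tr: "is_trace \<mu> \<Omega> u x c"
  shows "((\<lambda>r. domain_average \<Omega> (\<lambda>y. ennreal (u y)) x r) \<longlongrightarrow> ennreal c) (at_right 0)"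
proof -
  have x: "x \<in> frontier \<Omega>" using tr by (simp add: is_trace_def)
  let ?d = "domain_average \<Omega> (\<lambda>y. ennreal \<bar>u y - c\<bar>) x" and ?a = "domain_average \<Omega> (\<lambda>y. ennreal (u y)) x"
  have d: "(?d \<longlongrightarrow> 0) (at_right 0)" using tr by (simp add: is_trace_iff_average)
  have dm: "(\<lambda>y. ennreal \<bar>u y - c\<bar>) \<in> borel_measurable M" "(\<lambda>y. ennreal (u y)) \<in> borel_measurable M"
    using u by measurable
  have tri: "ennreal s \<le> ennreal \<bar>s - t\<bar> + ennreal t" for s t :: real
  proof (cases "0 \<le> t")
    case True
    then show ?thesis by (simp flip: ennreal_plus)
  next
    case False
    then show ?thesis by (simp add: ennreal_neg ennreal_leI)
  qed
  have upper: "?a r \<le> ?d r + ennreal c" if "0 < r" for r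
    using domain_average_le_add[OF \<Omega> x that dm(1) borel_measurable_const tri] domain_average_const[OF \<Omega> x that] by simp
  have lower: "ennreal c - ?d r \<le> ?a r" if "0 < r" for r
  proof -
    have "ennreal c \<le> ennreal \<bar>u y - c\<bar> + ennreal (u y)" for y
      using tri[of c "u y"] by (simp add: abs_minus_commute)
    then have "ennreal c \<le> ?d r + ?a r"
      using domain_average_le_add[OF \<Omega> x that dm(1) dm(2), of "\<lambda>_. ennreal c"] domain_average_const[OF \<Omega> x that] by simp
    then show ?thesis by (simp add: ennreal_minus_le_iff)
  qed
  have pos: "\<forall>\<^sub>F r::real in at_right 0. 0 < r" by (simp add: eventually_at_right_less)
  show ?thesis
  proof (rule tendsto_sandwich)
    show "\<forall>\<^sub>F r in at_right 0. ennreal c - ?d r \<le> ?a r" using pos by eventually_elim (rule lower)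
    show "\<forall>\<^sub>F r in at_right 0. ?a r \<le> ?d r + ennreal c" using pos by eventually_elim (rule upper)
    show "((\<lambda>r. ennreal c - ?d r) \<longlongrightarrow> ennreal c) (at_right 0)"
      using tendsto_diff_ennreal[OF tendsto_const d] by simp
    show "((\<lambda>r. ?d r + ennreal c) \<longlongrightarrow> ennreal c) (at_right 0)"
      using tendsto_add[OF d tendsto_const] by simp
  qed
qed

text \<open>A pointwise bound linear in \<open>\<bar>u y - c\<bar>\<close> passes to the averages.
  Its constant may depend on \<open>c\<close>, which admits functions of \<open>u\<close> that are
  discontinuous away from \<open>c\<close>.\<close>

lemma is_trace_transfer:
  assumes \<Omega>: "open \<Omega>" and u: "u \<in> borel_measurable M" and tr: "is_trace \<mu> \<Omega> u x c"
    and w: "\<And>y. y \<in> \<Omega> \<Longrightarrow> \<bar>w y - d\<bar> \<le> K * \<bar>u y - c\<bar>" and K: "0 \<le> K"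
  shows "is_trace \<mu> \<Omega> w x d"
proof -
  have x: "x \<in> frontier \<Omega>" using tr by (simp add: is_trace_def)
  let ?d = "domain_average \<Omega> (\<lambda>y. ennreal \<bar>u y - c\<bar>) x"
  have d: "(?d \<longlongrightarrow> 0) (at_right 0)" using tr by (simp add: is_trace_iff_average)
  have le: "domain_average \<Omega> (\<lambda>y. ennreal \<bar>w y - d\<bar>) x r \<le> ennreal K * ?d r" if "0 < r" for r
  proof -
    note [measurable] = u measure_ball_domain(4)[OF \<Omega> x that]
    have "(\<integral>\<^sup>+y\<in>ball x r \<inter> \<Omega>. ennreal \<bar>w y - d\<bar> \<partial>M) \<le> (\<integral>\<^sup>+y. ennreal K * (ennreal \<bar>u y - c\<bar> * indicator (ball x r \<inter> \<Omega>) y) \<partial>M)"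
      using w K by (intro nn_integral_mono) (auto simp: indicator_def ennreal_leI simp flip: ennreal_mult)
    also have "\<dots> = ennreal K * (\<integral>\<^sup>+y\<in>ball x r \<inter> \<Omega>. ennreal \<bar>u y - c\<bar> \<partial>M)"
      by (rule nn_integral_cmult) measurable
    finally show ?thesis
      unfolding domain_average_def by (simp add: divide_right_mono_ennreal ennreal_times_divide)
  qed
  have pos: "\<forall>\<^sub>F r::real in at_right 0. 0 < r" by (simp add: eventually_at_right_less)
  have "((\<lambda>r. domain_average \<Omega> (\<lambda>y. ennreal \<bar>w y - d\<bar>) x r) \<longlongrightarrow> 0) (at_right 0)"
  proof (rule tendsto_sandwich[OF _ _ tendsto_const])
    show "\<forall>\<^sub>F r in at_right 0. domain_average \<Omega> (\<lambda>y. ennreal \<bar>w y - d\<bar>) x r \<le> ennreal K * ?d r"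
      using pos by eventually_elim (rule le)
    show "((\<lambda>r. ennreal K * ?d r) \<longlongrightarrow> 0) (at_right 0)"
      using ennreal_tendsto_cmult[OF _ d, of "ennreal K"] by simp
  qed simp
  then show ?thesis using x by (simp add: is_trace_iff_average)
qed

lemma is_trace_abs_le_1:
  assumes \<Omega>: "open \<Omega>" and u: "u \<in> borel_measurable M" and tr: "is_trace \<mu> \<Omega> u x c"
    and ae: "AE y in M. y \<in> \<Omega> \<longrightarrow> \<bar>u y\<bar> \<le> 1"
  shows "\<bar>c\<bar> \<le> 1"
proof (rule ccontr)
  assume c: "\<not> ?thesis"
  have x: "x \<in> frontier \<Omega>" using tr by (simp add: is_trace_def)
  let ?d = "domain_average \<Omega> (\<lambda>y. ennreal \<bar>u y - c\<bar>) x"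
  have d: "(?d \<longlongrightarrow> 0) (at_right 0)" using tr by (simp add: is_trace_iff_average)
  have "ennreal (\<bar>c\<bar> - 1) \<le> ?d r" if "0 < r" for r
  proof -
    have "(\<integral>\<^sup>+y\<in>ball x r \<inter> \<Omega>. ennreal (\<bar>c\<bar> - 1) \<partial>M) \<le> (\<integral>\<^sup>+y\<in>ball x r \<inter> \<Omega>. ennreal \<bar>u y - c\<bar> \<partial>M)"
    proof (rule nn_integral_mono_AE)
      show "AE y in M. ennreal (\<bar>c\<bar> - 1) * indicator (ball x r \<inter> \<Omega>) y \<le> ennreal \<bar>u y - c\<bar> * indicator (ball x r \<inter> \<Omega>) y"
        using ae by eventually_elim (auto simp: indicator_def intro!: ennreal_leI)
    qed
    then have "domain_average \<Omega> (\<lambda>_. ennreal (\<bar>c\<bar> - 1)) x r \<le> ?d r"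
      unfolding domain_average_def by (rule divide_right_mono_ennreal)
    then show ?thesis using domain_average_const[OF \<Omega> x that] by simp
  qed
  then have "\<forall>\<^sub>F r in at_right 0. ennreal (\<bar>c\<bar> - 1) \<le> ?d r"
    by (auto simp: eventually_at_right_field intro!: exI[of _ 1])
  then have "ennreal (\<bar>c\<bar> - 1) \<le> 0" by (rule tendsto_lowerbound[OF d]) simp
  then show False using c by simp
qed

text \<open>Where the trace exists it is a limit of averages over radii \<open>1 / (n + 1)\<close>,
  which are Borel in \<open>x\<close>; positive and negative parts are treated apart to stay in
  \<open>ennreal\<close>. The second property also yields uniqueness of the trace, used for
  \<open>bv_trace_eq\<close>.\<close>

lemma trace_borel_measurable:
  assumes \<Omega>: "open \<Omega>" and u: "u \<in> borel_measurable M"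
  obtains \<tau> :: "'a \<Rightarrow> real" where "\<tau> \<in> borel_measurable borel" "\<And>x c. is_trace \<mu> \<Omega> u x c \<Longrightarrow> \<tau> x = c"
proof -
  define a where "a w x = liminf (\<lambda>n. domain_average \<Omega> (\<lambda>y. ennreal (w y)) x (inverse (Suc n)))" for w x
  have am: "a w \<in> borel_measurable borel" if "w \<in> borel_measurable M" for w
    unfolding a_def using domain_average_borel_measurable[OF \<Omega>, of "\<lambda>y. ennreal (w y)"] that by measurable
  have alim: "a w x = ennreal c" if "w \<in> borel_measurable M" "is_trace \<mu> \<Omega> w x c" for w x c
  proof -
    have "filterlim (\<lambda>n. inverse (real (Suc n))) (at_right 0) sequentially"
      unfolding filterlim_at using LIMSEQ_inverse_real_of_nat by (auto simp: eventually_sequentially)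
    from filterlim_compose[OF domain_average_positive_part_tendsto[OF \<Omega> that] this]
    show ?thesis unfolding a_def by (intro lim_imp_Liminf) (auto simp: comp_def)
  qed
  define \<tau> where "\<tau> x = enn2real (a u x) - enn2real (a (\<lambda>y. - u y) x)" for x
  show thesis
  proof (rule that)
    have um: "(\<lambda>y. - u y) \<in> borel_measurable M" using u by measurable
    show "\<tau> \<in> borel_measurable borel" unfolding \<tau>_def using am[OF u] am[OF um] by measurable
    fix x c assume tr: "is_trace \<mu> \<Omega> u x c"
    then have "is_trace \<mu> \<Omega> (\<lambda>y. - u y) x (- c)" by (rule is_trace_transfer[OF \<Omega> u, where K = 1]) auto
    then have "a u x = ennreal c" "a (\<lambda>y. - u y) x = ennreal (- c)" using alim[OF u tr] alim[OF um] by auto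
    then show "\<tau> x = c" by (cases "0 \<le> c") (auto simp: \<tau>_def ennreal_neg)
  qed
qed

lemma bv_trace_eq:
  assumes "open \<Omega>" "u \<in> borel_measurable M" "is_trace \<mu> \<Omega> u x c"
  shows "bv_trace \<mu> \<Omega> u x = c"
  unfolding bv_trace_def using trace_borel_measurable[OF assms(1,2)] assms(3) by (intro the_equality) metis+

end

section \<open>Averaging over levels\<close>

lemma AE_eq_of_integral_le:
  fixes \<phi> :: "real \<Rightarrow> real"
  assumes "set_integrable lborel {0<..<1} \<phi>" "(LINT t:{0<..<1}|lborel. \<phi> t) \<le> A"
    and "AE t in lborel. t \<in> {0<..<1} \<longrightarrow> A \<le> \<phi> t"
  shows "AE t in lborel. t \<in> {0<..<1} \<longrightarrow> \<phi> t = A"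
proof -
  define \<psi> where "\<psi> t = indicator {0<..<1} t * (\<phi> t - A)" for t
  have A: "set_integrable lborel {0<..<1} (\<lambda>_::real. A)"
    unfolding set_integrable_def by (intro integrable_scaleR_left integrable_real_indicator) auto
  have int: "integrable lborel \<psi>"
    using set_integral_diff(1)[OF assms(1) A] unfolding \<psi>_def set_integrable_def by simp
  have "(LINT t|lborel. \<psi> t) = (LINT t:{0<..<1}|lborel. \<phi> t) - A"
    using set_integral_diff(2)[OF assms(1) A] by (simp add: \<psi>_def set_lebesgue_integral_def)
  then have le0: "(LINT t|lborel. \<psi> t) \<le> 0" using assms(2) by simp
  have nn: "AE t in lborel. 0 \<le> \<psi> t"
    using assms(3) by eventually_elim (auto simp: \<psi>_def indicator_def)
  then have "(LINT t|lborel. \<psi> t) = 0" using le0 integral_nonneg_AE[OF nn] by simp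
  then have "AE t in lborel. \<psi> t = 0"
    using integral_nonneg_eq_0_iff_AE[OF int nn] by simp
  then show ?thesis by eventually_elim (auto simp: \<psi>_def)
qed

text \<open>Otherwise \<open>\<phi>\<close> exceeds \<open>A\<close> at almost all levels and, by
  \<open>AE_eq_of_integral_le\<close>, also equals \<open>A\<close> there; but \<open>(0, 1)\<close>
  is not a null set.\<close>

lemma exists_le_of_integral_le:
  fixes \<phi> :: "real \<Rightarrow> real"
  assumes "set_integrable lborel {0<..<1} \<phi>" "(LINT t:{0<..<1}|lborel. \<phi> t) \<le> A"
    and P: "AE t in lborel. t \<in> {0<..<1} \<longrightarrow> P t"
  shows "\<exists>t\<in>{0<..<1}. P t \<and> \<phi> t \<le> A"
proof (rule ccontr)
  assume no: "\<not> ?thesis"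
  have "AE t in lborel. t \<in> {0<..<1} \<longrightarrow> A \<le> \<phi> t"
    using P by eventually_elim (use no in force)
  from AE_eq_of_integral_le[OF assms(1,2) this] P
  have "AE t in lborel. t \<notin> {0<..<1::real}"
    by eventually_elim (use no in force)
  then have "emeasure lborel {t \<in> space lborel. \<not> t \<notin> {0<..<1::real}} = 0"
    by (subst (asm) AE_iff_measurable[OF _ refl]) auto
  moreover have "{t \<in> space lborel. \<not> t \<notin> {0<..<1::real}} = {0<..<1}" by auto
  ultimately show False by simp
qed

text \<open>Fubini for the kernel \<open>F x\<close> on the region \<open>0 < t < 1\<close>,
  \<open>t < \<tau> x\<close>: for fixed \<open>x\<close> the admissible levels form an interval of
  length \<open>min (max (\<tau> x) 0) 1\<close>.\<close>

lemma layer_cake_superlevel: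
  fixes \<tau> F :: "'a \<Rightarrow> real"
  assumes "finite_measure N" and \<tau>[measurable]: "\<tau> \<in> borel_measurable N" and F: "integrable N F"
  shows "set_integrable lborel {0<..<1} (\<lambda>t. LINT x|N. indicator {x. t < \<tau> x} x * F x)"
    and "(LINT t:{0<..<1}|lborel. LINT x|N. indicator {x. t < \<tau> x} x * F x)
           = (LINT x|N. min (max (\<tau> x) 0) 1 * F x)"
proof -
  interpret finite_measure N by fact
  interpret pair_sigma_finite N lborel ..
  have [measurable]: "F \<in> borel_measurable N" using F by simp
  define k :: "'a \<times> real \<Rightarrow> real" where
    "k = (\<lambda>(x, t). indicator {0<..<1} t * (if t < \<tau> x then F x else 0))"
  have km [measurable]: "k \<in> borel_measurable (N \<Otimes>\<^sub>M lborel)"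
    unfolding k_def by measurable
  have inner: "has_bochner_integral lborel (\<lambda>t. k (x, t)) (min (max (\<tau> x) 0) 1 * F x)" for x
  proof -
    have eq: "k (x, t) = indicator ({0<..<1} \<inter> {..<\<tau> x}) t *\<^sub>R F x" for t by (auto simp: k_def indicator_def)
    have S: "{0<..<1} \<inter> {..<\<tau> x} = {0<..<min (max (\<tau> x) 0) 1}" by (auto simp: min_def max_def)
    have "has_bochner_integral lborel (\<lambda>t. indicator {0<..<min (max (\<tau> x) 0) 1} t *\<^sub>R F x)
        (measure lborel {0<..<min (max (\<tau> x) 0) 1} *\<^sub>R F x)"
      by (rule has_bochner_integral_scaleR_left, rule has_bochner_integral_real_indicator) auto
    then show ?thesis unfolding eq S by simp
  qed
  \<comment> \<open>For fixed \<open>x\<close> the kernel never has the sign opposite to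
    \<open>F x\<close>, so multiplication by \<open>sgn (F x)\<close> turns the integral already
    computed into that of the norm.\<close>
  have innern: "(\<integral>t. norm (k (x, t)) \<partial>lborel) = \<bar>min (max (\<tau> x) 0) 1 * F x\<bar>" for x
  proof -
    have "has_bochner_integral lborel (\<lambda>t. sgn (F x) * k (x, t)) (sgn (F x) * (min (max (\<tau> x) 0) 1 * F x))"
      by (rule has_bochner_integral_mult_right) (rule inner)
    moreover have "sgn (F x) * k (x, t) = norm (k (x, t))" for t
      by (auto simp: k_def indicator_def sgn_if)
    moreover have "sgn (F x) * (min (max (\<tau> x) 0) 1 * F x) = \<bar>min (max (\<tau> x) 0) 1 * F x\<bar>"
      by (auto simp: sgn_if abs_mult)
    ultimately show ?thesis by (simp add: has_bochner_integral_iff)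
  qed
  have "integrable N (\<lambda>x. min (max (\<tau> x) 0) 1 * F x)"
    by (rule Bochner_Integration.integrable_bound[OF F])
       (auto simp: abs_mult intro!: mult_left_le_one_le)
  then have "integrable N (\<lambda>x. \<bar>min (max (\<tau> x) 0) 1 * F x\<bar>)" by (rule integrable_abs)
  then have kint: "integrable (N \<Otimes>\<^sub>M lborel) k"
  proof (intro Fubini_integrable[OF km])
    show "AE x in N. integrable lborel (\<lambda>t. k (x, t))" using inner by (simp add: has_bochner_integral_iff)
  qed (simp only: innern)
  have slice: "(LINT x|N. k (x, t)) = indicator {0<..<1} t *\<^sub>R (LINT x|N. indicator {x. t < \<tau> x} x * F x)" for t
  proof -
    have "k (x, t) = indicator {0<..<1} t * (indicator {x. t < \<tau> x} x * F x)" for x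
      by (auto simp: k_def indicator_def)
    then show ?thesis by simp
  qed
  have ki: "integrable (N \<Otimes>\<^sub>M lborel) (case_prod (\<lambda>x t. k (x, t)))" using kint by simp
  show "set_integrable lborel {0<..<1} (\<lambda>t. LINT x|N. indicator {x. t < \<tau> x} x * F x)"
    unfolding set_integrable_def slice[symmetric] by (rule integrable_snd[OF ki])
  have "(LINT t:{0<..<1}|lborel. LINT x|N. indicator {x. t < \<tau> x} x * F x) = (LINT t|lborel. LINT x|N. k (x, t))"
    unfolding set_lebesgue_integral_def slice ..
  also have "\<dots> = (LINT x|N. LINT t|lborel. k (x, t))" by (rule Fubini_integral[OF ki])
  also have "\<dots> = (LINT x|N. min (max (\<tau> x) 0) 1 * F x)"
    using inner by (simp add: has_bochner_integral_iff)
  finally show "(LINT t:{0<..<1}|lborel. LINT x|N. indicator {x. t < \<tau> x} x * F x)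
           = (LINT x|N. min (max (\<tau> x) 0) 1 * F x)" .
qed

text \<open>Levels taken with positive mass are atoms of the distribution of \<open>\<tau>\<close>,
  and a finite measure has at most countably many.\<close>

lemma finite_measure_countable_levels:
  fixes \<tau> :: "'a \<Rightarrow> real"
  assumes "finite_measure N" "\<tau> \<in> borel_measurable N"
  obtains C where "countable C" "\<And>t. t \<notin> C \<Longrightarrow> AE x in N. \<tau> x \<noteq> t"
proof -
  interpret finite_measure N by fact
  interpret D: finite_measure "distr N borel \<tau>" by (rule finite_measure_distr[OF assms(2)])
  show thesis
  proof (rule that[OF D.countable_support])
    fix t assume "t \<notin> {x. measure (distr N borel \<tau>) {x} \<noteq> 0}"
    then have "measure N {x \<in> space N. \<tau> x = t} = 0"
      using assms(2) by (simp add: measure_distr vimage_def Int_def conj_commute)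
    then have "emeasure N {x \<in> space N. \<tau> x = t} = 0" by (simp add: emeasure_eq_measure)
    then show "AE x in N. \<tau> x \<noteq> t"
      using assms(2) by (subst AE_iff_measurable[OF _ refl]) auto
  qed
qed

context doubling_space
begin

text \<open>Used for \<open>w\<close>, \<open>\<tau>\<close>, \<open>F\<close> and again for
  \<open>- w\<close>, \<open>- \<tau>\<close>, \<open>- F\<close>. The function obtained is an
  integrable majorant of the energy of the level sets rather than that energy itself, because it is
  built from the majorant of \<open>coarea_le\<close>.\<close>

lemma superlevel_energy_bound:
  fixes \<tau> F :: "'a \<Rightarrow> real"
  assumes \<Omega>: "open \<Omega>" and u: "u \<in> borel_measurable M" and fin: "TV (\<lambda>x. max (u x) 0) \<Omega> < top"
    and N: "finite_measure N" and \<tau>: "\<tau> \<in> borel_measurable N" and F: "integrable N F"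
  obtains \<phi> :: "real \<Rightarrow> real" where "set_integrable lborel {0<..<1} \<phi>"
    "(LINT t:{0<..<1}|lborel. \<phi> t)
      \<le> enn2real (TV (\<lambda>x. max (u x) 0) \<Omega>) + (LINT x|N. min (max (\<tau> x) 0) 1 * F x)"
    "AE t in lborel. t \<in> {0<..<1} \<longrightarrow> TV (indicator {x. t < u x}) \<Omega> < top \<and>
       enn2real (TV (indicator {x. t < u x}) \<Omega>) + (LINT x|N. indicator {x. t < \<tau> x} x * F x) \<le> \<phi> t"
proof -
  obtain q :: "real \<Rightarrow> ennreal" where q: "q \<in> borel_measurable borel"
    "\<And>t. 0 \<le> t \<Longrightarrow> TV (indicator {x. t < u x}) \<Omega> \<le> q t"
    "(\<integral>\<^sup>+t\<in>{0<..<1}. q t \<partial>lborel) \<le> TV (\<lambda>x. max (u x) 0) \<Omega>"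
    using coarea_le[OF \<Omega> u fin] by blast
  note [measurable] = q(1)
  define a where "a t = (LINT x|N. indicator {x. t < \<tau> x} x * F x)" for t
  define r where "r t = enn2real (q t)" for t
  have qfin: "(\<integral>\<^sup>+t\<in>{0<..<1}. q t \<partial>lborel) \<noteq> \<infinity>" using q(3) fin by (auto simp: top_unique)
  have "AE t in lborel. q t * indicator {0<..<1} t \<noteq> \<infinity>"
    by (rule nn_integral_PInf_AE[OF _ qfin]) measurable
  then have qae: "AE t in lborel. t \<in> {0<..<1} \<longrightarrow> q t < top"
    by eventually_elim (auto simp: less_top)
  have rq: "(\<integral>\<^sup>+t. ennreal (indicator {0<..<1} t * r t) \<partial>lborel) = (\<integral>\<^sup>+t\<in>{0<..<1}. q t \<partial>lborel)"
    by (rule nn_integral_cong_AE) (use qae in eventually_elim, auto simp: indicator_def r_def)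
  have rint: "set_integrable lborel {0<..<1} r"
    unfolding set_integrable_def real_scaleR_def
  proof (rule integrableI_nonneg)
    show "(\<integral>\<^sup>+t. ennreal (indicator {0<..<1} t * r t) \<partial>lborel) < \<infinity>"
      unfolding rq using qfin by (simp add: less_top)
  qed (auto simp: r_def)
  have "(LINT t:{0<..<1}|lborel. r t) = enn2real (\<integral>\<^sup>+t\<in>{0<..<1}. q t \<partial>lborel)"
    unfolding set_lebesgue_integral_def real_scaleR_def rq[symmetric]
    by (rule integral_eq_nn_integral) (auto simp: r_def)
  also have "\<dots> \<le> enn2real (TV (\<lambda>x. max (u x) 0) \<Omega>)"
    by (rule enn2real_mono[OF q(3) fin])
  finally have rle: "(LINT t:{0<..<1}|lborel. r t) \<le> enn2real (TV (\<lambda>x. max (u x) 0) \<Omega>)" .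
  note a = layer_cake_superlevel[OF N \<tau> F, folded a_def]
  show thesis
  proof (rule that[of "\<lambda>t. r t + a t"])
    show "set_integrable lborel {0<..<1} (\<lambda>t. r t + a t)" by (rule set_integral_add(1)[OF rint a(1)])
    show "(LINT t:{0<..<1}|lborel. r t + a t)
      \<le> enn2real (TV (\<lambda>x. max (u x) 0) \<Omega>) + (LINT x|N. min (max (\<tau> x) 0) 1 * F x)"
      using set_integral_add(2)[OF rint a(1)] rle a(2) by simp
    show "AE t in lborel. t \<in> {0<..<1} \<longrightarrow> TV (indicator {x. t < u x}) \<Omega> < top \<and>
       enn2real (TV (indicator {x. t < u x}) \<Omega>) + (LINT x|N. indicator {x. t < \<tau> x} x * F x) \<le> r t + a t"
      using qae
    proof eventually_elim
      case (elim t)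
      show ?case
      proof
        assume t: "t \<in> {0<..<1}"
        then have "TV (indicator {x. t < u x}) \<Omega> \<le> q t" "q t < top" using q(2)[of t] elim by auto
        then show "TV (indicator {x. t < u x}) \<Omega> < top \<and>
          enn2real (TV (indicator {x. t < u x}) \<Omega>) + (LINT x|N. indicator {x. t < \<tau> x} x * F x) \<le> r t + a t"
          by (auto simp: r_def a_def intro: enn2real_mono le_less_trans)
      qed
    qed
  qed
qed

end

section \<open>The restricted Neumann problem\<close>

context doubling_space
begin

lemma perimeter_eq_total_variation: "perimeter \<mu> \<Omega> = total_variation \<mu> (indicator \<Omega>)"
  by (simp add: perimeter_def fun_eq_iff)

text \<open>Completeness comes from the Caratheodory construction: a set of outer measure zero
  splits every set additively, so it and all its subsets are measurable.\<close>

lemma perimeter_measure_facts: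
  assumes "open \<Omega>" and fin: "perimeter \<mu> \<Omega> UNIV < top"
  shows "outer_measure_space UNIV (perimeter \<mu> \<Omega>)"
    and "finite_measure (perimeter_measure \<mu> \<Omega>)"
    and "complete_measure (perimeter_measure \<mu> \<Omega>)"
    and "h \<in> borel_measurable borel \<Longrightarrow> h \<in> borel_measurable (perimeter_measure \<mu> \<Omega>)"
    and "perimeter \<mu> \<Omega> Z = 0 \<Longrightarrow> Z \<in> null_sets (perimeter_measure \<mu> \<Omega>)"
proof -
  let ?\<chi> = "indicator \<Omega> :: 'a \<Rightarrow> real" and ?P = "perimeter \<mu> \<Omega>" and ?N = "perimeter_measure \<mu> \<Omega>"
  have \<chi>: "?\<chi> \<in> borel_measurable M" using open_sets_M[OF assms(1)] by simp
  have fin': "TV ?\<chi> UNIV < top"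
    using fin total_variation_open_eq[of UNIV ?\<chi>] by (simp add: perimeter_eq_total_variation)
  show outer: "outer_measure_space UNIV ?P"
    unfolding perimeter_eq_total_variation by (rule outer_measure_total_variation[OF \<chi> fin'])
  note N = space_caratheodory_measure[OF outer] sets_caratheodory_measure[OF outer]
    emeasure_caratheodory_measure[OF outer]
  have U: "UNIV \<in> lambda_system UNIV UNIV ?P"
    unfolding perimeter_eq_total_variation by (rule borel_caratheodory_total_variation[OF \<chi> fin']) simp
  show "finite_measure ?N"
    by (rule finite_measureI) (use fin U in \<open>simp add: perimeter_measure_def N less_top\<close>)
  have null: "Z \<in> lambda_system UNIV UNIV ?P" if "?P Z = 0" for Z
    unfolding lambda_system_def
  proof (intro CollectI conjI ballI UNIV_I)
    fix A
    have le: "?P X \<le> ?P Y" if "X \<subseteq> Y" for X Y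
      using total_variation_mono[OF that] by (simp add: perimeter_eq_total_variation)
    have "?P (Z \<inter> A) = 0" using le[of "Z \<inter> A" Z] that by simp
    moreover have "?P ((UNIV - Z) \<inter> A) \<le> ?P A" by (rule le) blast
    moreover have "?P A \<le> ?P (Z \<inter> A) + ?P ((UNIV - Z) \<inter> A)"
      using total_variation_Un[OF \<chi> fin', of "Z \<inter> A" "(UNIV - Z) \<inter> A"]
      by (simp add: perimeter_eq_total_variation Int_Un_distrib2[symmetric])
    ultimately show "?P (Z \<inter> A) + ?P ((UNIV - Z) \<inter> A) = ?P A" by simp
  qed
  show zero: "Z \<in> null_sets ?N" if "?P Z = 0" for Z
    using null[OF that] that by (simp add: null_sets_def perimeter_measure_def N)
  show "complete_measure ?N"
  proof
    fix A B assume "B \<subseteq> A" "A \<in> null_sets ?N"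
    then have "?P A = 0" by (auto simp: null_sets_def perimeter_measure_def N)
    moreover have "?P B \<le> ?P A"
      using total_variation_mono[OF \<open>B \<subseteq> A\<close>] by (simp add: perimeter_eq_total_variation)
    ultimately show "B \<in> sets ?N" using zero[of B] by (simp add: null_setsD2)
  qed
  show "h \<in> borel_measurable ?N" if "h \<in> borel_measurable borel"
  proof (rule measurableI)
    fix A :: "'b set" assume "A \<in> sets borel"
    then have "h -` A \<in> sets borel" using measurable_sets[OF that] by simp
    then show "h -` A \<inter> space ?N \<in> sets ?N"
      using borel_caratheodory_total_variation[OF \<chi> fin', folded perimeter_eq_total_variation]
      by (simp add: perimeter_measure_def N)
  qed simp
qed

lemma is_trace_cong:
  assumes "\<And>y. y \<in> \<Omega> \<Longrightarrow> u y = w y"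
  shows "is_trace \<mu> \<Omega> u = is_trace \<mu> \<Omega> w"
proof -
  have "(\<integral>\<^sup>+y\<in>ball x r \<inter> \<Omega>. ennreal \<bar>u y - c\<bar> \<partial>M) = (\<integral>\<^sup>+y\<in>ball x r \<inter> \<Omega>. ennreal \<bar>w y - c\<bar> \<partial>M)" for x r c
    using assms by (intro nn_integral_cong) (auto simp: indicator_def)
  then show ?thesis by (simp add: is_trace_def fun_eq_iff)
qed

text \<open>A threshold at \<open>s\<close> changes only across \<open>s\<close>. If the trace value
  \<open>b\<close> differs from \<open>s\<close>, a value \<open>a\<close> on the other side is at
  least \<open>\<bar>b - s\<bar>\<close> away from \<open>b\<close>, which gives the linear bound
  asked for by \<open>is_trace_transfer\<close>.\<close>

lemma is_trace_threshold:
  assumes \<Omega>: "open \<Omega>" and u: "u \<in> borel_measurable M" and tr: "is_trace \<mu> \<Omega> u x c"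
    and t: "c \<noteq> t1" "- c \<noteq> t2"
  shows "is_trace \<mu> \<Omega> (\<lambda>y. indicator {y. t1 < u y} y - indicator {y. t2 < - u y} y) x
           (of_bool (t1 < c) - of_bool (t2 < - c))"
proof (rule is_trace_transfer[OF \<Omega> u tr])
  have jump: "\<bar>of_bool (s < a) - of_bool (s < b)\<bar> \<le> 1 / \<bar>b - s\<bar> * \<bar>a - b\<bar>" if "b \<noteq> s" for a b s :: real
    using that by (auto simp: of_bool_def field_simps)
  fix y
  have "\<bar>indicator {y. t1 < u y} y - indicator {y. t2 < - u y} y - (of_bool (t1 < c) - of_bool (t2 < - c))\<bar>
      \<le> \<bar>of_bool (t1 < u y) - of_bool (t1 < c)\<bar> + \<bar>of_bool (t2 < - u y) - of_bool (t2 < - c) :: real\<bar>"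
    by (simp add: indicator_def of_bool_def)
  also have "\<dots> \<le> 1 / \<bar>c - t1\<bar> * \<bar>u y - c\<bar> + 1 / \<bar>- c - t2\<bar> * \<bar>- u y - - c\<bar>"
    by (rule add_mono[OF jump[OF t(1)] jump[OF t(2)]])
  also have "\<dots> = (1 / \<bar>c - t1\<bar> + 1 / \<bar>- c - t2\<bar>) * \<bar>u y - c\<bar>"
    by (simp add: distrib_right abs_minus_commute)
  finally show "\<bar>indicator {y. t1 < u y} y - indicator {y. t2 < - u y} y - (of_bool (t1 < c) - of_bool (t2 < - c))\<bar>
      \<le> (1 / \<bar>c - t1\<bar> + 1 / \<bar>- c - t2\<bar>) * \<bar>u y - c\<bar>" .
qed simp

lemma TV_difference_le:
  assumes U: "open U" and m: "u \<in> borel_measurable M" "w \<in> borel_measurable M"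
  shows "TV (\<lambda>x. u x - w x) U \<le> TV u U + TV w U"
proof -
  have "TV (\<lambda>x. u x + - w x) U \<le> TV u U + TV (\<lambda>x. - w x) U"
    using m by (intro TV_add[OF U]) auto
  also have "TV (\<lambda>x. - w x) U \<le> ennreal 1 * TV w U" by (rule TV_compose[OF U m(2)]) auto
  finally show ?thesis by (simp add: add_left_mono)
qed

end

theorem proposition3p8:
  fixes \<mu> :: "'a::complete_space set \<Rightarrow> ennreal"
    and \<Omega> :: "'a set"
    and f u :: "'a \<Rightarrow> real"
  assumes two_points: "\<exists>x y :: 'a. x \<noteq> y"
    and regular: "borel_regular_outer_measure \<mu>"
    and doubling: "doubling \<mu>"
    and poincare: "poincare_1_1 \<mu>"
    and domain: "\<Omega> \<noteq> {}" "bounded \<Omega>" "open \<Omega>"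
    and finite_perimeter: "perimeter \<mu> \<Omega> UNIV < \<infinity>"
    and traces: "\<And>v. v \<in> BV \<mu> \<Omega> \<Longrightarrow>
      codim1_hausdorff \<mu> {x \<in> measure_theoretic_boundary \<mu> \<Omega>. \<not> (\<exists>c. is_trace \<mu> \<Omega> v x c)} = 0"
    and f_integrable:
      "set_integrable (perimeter_measure \<mu> \<Omega>) (measure_theoretic_boundary \<mu> \<Omega>) f"
    and f_mean_zero: "(LINT x:measure_theoretic_boundary \<mu> \<Omega>|perimeter_measure \<mu> \<Omega>. f x) = 0"
    and u: "u \<in> restricted_BV \<mu> \<Omega>"
  shows "(\<exists>E\<^sub>1 E\<^sub>2. E\<^sub>1 \<in> sets (caratheodory_measure \<mu>) \<and> E\<^sub>2 \<in> sets (caratheodory_measure \<mu>) \<and>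
            E\<^sub>1 \<subseteq> \<Omega> \<and> E\<^sub>2 \<subseteq> \<Omega> \<and> E\<^sub>1 \<inter> E\<^sub>2 = {} \<and>
            (\<lambda>x. indicator E\<^sub>1 x - indicator E\<^sub>2 x) \<in> BV \<mu> \<Omega> \<and>
            neumann_functional \<mu> \<Omega> f (\<lambda>x. indicator E\<^sub>1 x - indicator E\<^sub>2 x)
              \<le> neumann_functional \<mu> \<Omega> f u) \<and>
         (solves_restricted_neumann \<mu> \<Omega> f u \<longrightarrow>
            (\<exists>N\<in>null_sets lborel. \<forall>t\<^sub>1\<in>{0<..<1} - N. \<forall>t\<^sub>2\<in>{0<..<1} - N.
               solves_restricted_neumann \<mu> \<Omega> f
                 (\<lambda>x. indicator {x \<in> \<Omega>. u x > t\<^sub>1} x - indicator {x \<in> \<Omega>. u x < - t\<^sub>2} x)))"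
proof -
  interpret doubling_space \<mu> by unfold_locales (rule regular, rule doubling)

  \<comment> \<open>Traces and boundary integrals on the perimeter measure\<close>
  define S where "S = measure_theoretic_boundary \<mu> \<Omega>"
  define N where "N = perimeter_measure \<mu> \<Omega>"
  \<comment> \<open>Extension by zero turns integrals over the boundary into integrals over the
    whole space.\<close>
  define F where "F x = indicator S x * f x" for x
  have fp: "perimeter \<mu> \<Omega> UNIV < top" using finite_perimeter by simp
  note Nf = perimeter_measure_facts[OF domain(3) fp, folded N_def]
  interpret N: complete_measure N by (rule Nf(3))
  have F: "integrable N F"
    using f_integrable by (simp add: F_def[abs_def] set_integrable_def S_def N_def)
  have uBV: "u \<in> BV \<mu> \<Omega>" and uae: "AE x in M. x \<in> \<Omega> \<longrightarrow> -1 \<le> u x \<and> u x \<le> 1"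
    using u by (auto simp: restricted_BV_def)
  \<comment> \<open>\<open>u\<close> is controlled only on \<open>\<Omega>\<close>; its extension by
    zero is measurable everywhere and has the same variation on \<open>\<Omega>\<close> and the same
    traces.\<close>
  define w where "w x = indicator \<Omega> x * u x" for x
  have wm: "w \<in> borel_measurable M"
    using uBV borel_measurable_integrable by (fastforce simp: BV_def set_integrable_def w_def[abs_def])
  have wu: "u x = w x" if "x \<in> \<Omega>" for x using that by (simp add: w_def)
  have TVu: "TV u \<Omega> = TV w \<Omega>" by (rule TV_cong) (rule wu)
  have TVfin: "TV w \<Omega> < top" using uBV by (simp add: BV_def TVu[symmetric])
  have tru: "is_trace \<mu> \<Omega> u = is_trace \<mu> \<Omega> w" by (rule is_trace_cong) (rule wu)
  obtain \<tau> where \<tau>: "\<tau> \<in> borel_measurable borel" "\<And>x c. is_trace \<mu> \<Omega> w x c \<Longrightarrow> \<tau> x = c"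
    using trace_borel_measurable[OF domain(3) wm] by blast
  have \<tau>N [measurable]: "\<tau> \<in> borel_measurable N" by (rule Nf(4)[OF \<tau>(1)])
  have "perimeter \<mu> \<Omega> {x \<in> S. \<not> (\<exists>c. is_trace \<mu> \<Omega> w x c)} = 0"
    using perimeter_codim1_null[OF domain(2,3) fp traces[OF uBV]] by (simp add: S_def tru)
  then have "AE x in N. x \<notin> {x \<in> S. \<not> (\<exists>c. is_trace \<mu> \<Omega> w x c)}"
    by (rule AE_not_in[OF Nf(5)])
  then have trw: "AE x in N. x \<in> S \<longrightarrow> is_trace \<mu> \<Omega> w x (\<tau> x)"
    by eventually_elim (use \<tau>(2) in blast)
  have "AE y in M. y \<in> \<Omega> \<longrightarrow> \<bar>w y\<bar> \<le> 1"
    using uae by eventually_elim (auto simp: w_def)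
  then have \<tau>1: "AE x in N. x \<in> S \<longrightarrow> \<bar>\<tau> x\<bar> \<le> 1"
    using trw is_trace_abs_le_1[OF domain(3) wm] by (auto elim: AE_mp)
  have boundary: "(LINT x:S|N. bv_trace \<mu> \<Omega> v x * f x) = (LINT x|N. \<sigma> x * F x)"
    if \<sigma>: "\<sigma> \<in> borel_measurable N" and v: "AE x in N. x \<in> S \<longrightarrow> bv_trace \<mu> \<Omega> v x = \<sigma> x" for v \<sigma>
  proof -
    have Fm: "(\<lambda>x. \<sigma> x * F x) \<in> borel_measurable N" using \<sigma> F by simp
    have ae: "AE x in N. indicator S x *\<^sub>R (bv_trace \<mu> \<Omega> v x * f x) = \<sigma> x * F x"
      using v by eventually_elim (auto simp: F_def indicator_def)
    show ?thesis
      unfolding set_lebesgue_integral_def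
      by (rule integral_cong_AE[OF N.borel_measurable_cong_AE[OF Fm ae] Fm ae])
  qed
  define J where "J = enn2real (TV w \<Omega>) + (LINT x|N. \<tau> x * F x)"
  have Iu: "neumann_functional \<mu> \<Omega> f u = ereal J"
  proof -
    have "bv_trace \<mu> \<Omega> u = bv_trace \<mu> \<Omega> w" by (simp add: bv_trace_def fun_eq_iff tru)
    then have "AE x in N. x \<in> S \<longrightarrow> bv_trace \<mu> \<Omega> u x = \<tau> x"
      using trw bv_trace_eq[OF domain(3) wm] by (auto elim!: eventually_mono)
    then show ?thesis
      using boundary[OF \<tau>N] TVfin
      by (simp add: neumann_functional_def S_def[symmetric] N_def[symmetric] TVu J_def)
         (metis enn2ereal_ennreal ennreal_enn2real enn2real_nonneg plus_ereal.simps(1))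
  qed

  \<comment> \<open>Splitting into positive and negative parts\<close>
  define p1 where "p1 = TV (\<lambda>x. max (w x) 0) \<Omega>"
  define p2 where "p2 = TV (\<lambda>x. max (- w x) 0) \<Omega>"
  have p: "p1 + p2 \<le> TV w \<Omega>"
  proof -
    have m: "(\<lambda>x. min (w x) 0) \<in> borel_measurable M" using wm by measurable
    have "p2 = TV (\<lambda>x. - min (w x) 0) \<Omega>" unfolding p2_def by (rule TV_cong) auto
    also have "\<dots> \<le> ennreal 1 * TV (\<lambda>x. min (w x) 0) \<Omega>" by (rule TV_compose[OF domain(3) m]) auto
    finally have "p1 + p2 \<le> TV (\<lambda>x. min (w x) 0) \<Omega> + TV (\<lambda>x. max (w x) 0) \<Omega>"
      by (simp add: p1_def add.commute add_left_mono)
    also have "\<dots> \<le> TV w \<Omega>" by (rule TV_truncate[OF domain(3)])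
    finally show ?thesis .
  qed
  have pfin: "p1 < top" "p2 < top"
    using le_less_trans[OF p TVfin] by simp_all
  define A where "A = enn2real p1 + (LINT x|N. min (max (\<tau> x) 0) 1 * F x)"
  define B where "B = enn2real p2 + (LINT x|N. min (max (- \<tau> x) 0) 1 * - F x)"
  \<comment> \<open>The variation splits by truncation at 0. On \<open>S\<close> the bound
    \<open>\<bar>\<tau> x\<bar> \<le> 1\<close> makes the truncation at 1 in the layer cake
    integrals invisible, so the two boundary terms recombine to the one with
    \<open>\<tau>\<close>.\<close>
  have AB: "A + B \<le> J"
  proof -
    have "integrable N (\<lambda>x. min (max (\<tau> x) 0) 1 * F x)" "integrable N (\<lambda>x. min (max (- \<tau> x) 0) 1 * - F x)"
      by (rule Bochner_Integration.integrable_bound[OF F]; use F in \<open>auto simp: abs_mult intro!: mult_left_le_one_le\<close>)+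
    then have "(LINT x|N. min (max (\<tau> x) 0) 1 * F x) + (LINT x|N. min (max (- \<tau> x) 0) 1 * - F x)
        = (LINT x|N. min (max (\<tau> x) 0) 1 * F x + min (max (- \<tau> x) 0) 1 * - F x)"
      by (rule Bochner_Integration.integral_add[symmetric])
    also have "\<dots> = (LINT x|N. \<tau> x * F x)"
    proof (rule integral_cong_AE)
      show "AE x in N. min (max (\<tau> x) 0) 1 * F x + min (max (- \<tau> x) 0) 1 * - F x = \<tau> x * F x"
        using \<tau>1
      proof eventually_elim
        case (elim x)
        then show ?case by (cases "x \<in> S"; cases "0 \<le> \<tau> x") (auto simp: F_def)
      qed
    qed (use F in measurable)
    finally have int: "(LINT x|N. min (max (\<tau> x) 0) 1 * F x) + (LINT x|N. min (max (- \<tau> x) 0) 1 * - F x)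
        = (LINT x|N. \<tau> x * F x)" .
    have "enn2real p1 + enn2real p2 = enn2real (p1 + p2)" using pfin by (simp add: enn2real_plus)
    also have "\<dots> \<le> enn2real (TV w \<Omega>)" by (rule enn2real_mono[OF p TVfin])
    finally show ?thesis using int by (simp add: A_def B_def J_def)
  qed

  \<comment> \<open>Energy of the level sets and good levels\<close>
  obtain \<phi> where \<phi>: "set_integrable lborel {0<..<1} \<phi>" "(LINT t:{0<..<1}|lborel. \<phi> t) \<le> A"
    "AE t in lborel. t \<in> {0<..<1} \<longrightarrow> TV (indicator {x. t < w x}) \<Omega> < top \<and>
       enn2real (TV (indicator {x. t < w x}) \<Omega>) + (LINT x|N. indicator {x. t < \<tau> x} x * F x) \<le> \<phi> t"
    unfolding A_def p1_def
    by (rule superlevel_energy_bound[OF domain(3) wm pfin(1)[unfolded p1_def] Nf(2) \<tau>N F])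
  have wm': "(\<lambda>x. - w x) \<in> borel_measurable M" using wm by measurable
  have \<tau>N': "(\<lambda>x. - \<tau> x) \<in> borel_measurable N" by measurable
  have F': "integrable N (\<lambda>x. - F x)" using F by simp
  obtain \<psi> where \<psi>: "set_integrable lborel {0<..<1} \<psi>" "(LINT t:{0<..<1}|lborel. \<psi> t) \<le> B"
    "AE t in lborel. t \<in> {0<..<1} \<longrightarrow> TV (indicator {x. t < - w x}) \<Omega> < top \<and>
       enn2real (TV (indicator {x. t < - w x}) \<Omega>) + (LINT x|N. indicator {x. t < - \<tau> x} x * - F x) \<le> \<psi> t"
    unfolding B_def p2_def
    by (rule superlevel_energy_bound[OF domain(3) wm' pfin(2)[unfolded p2_def] Nf(2) \<tau>N' F'])
  obtain C1 where C1: "countable C1" "\<And>t. t \<notin> C1 \<Longrightarrow> AE x in N. \<tau> x \<noteq> t"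
    using finite_measure_countable_levels[OF Nf(2) \<tau>N] by blast
  obtain C2 where C2: "countable C2" "\<And>t. t \<notin> C2 \<Longrightarrow> AE x in N. - \<tau> x \<noteq> t"
    using finite_measure_countable_levels[OF Nf(2) \<tau>N'] by blast
  \<comment> \<open>Good levels: the energy bound holds, and the exclusion of \<open>C1\<close>
    ensures that \<open>\<tau>\<close> takes the value \<open>t\<close> only on a null set.\<close>
  define G1 where "G1 t \<longleftrightarrow> t \<in> {0<..<1} \<and> t \<notin> C1 \<and> TV (indicator {x. t < w x}) \<Omega> < top \<and>
       enn2real (TV (indicator {x. t < w x}) \<Omega>) + (LINT x|N. indicator {x. t < \<tau> x} x * F x) \<le> \<phi> t" for t
  define G2 where "G2 t \<longleftrightarrow> t \<in> {0<..<1} \<and> t \<notin> C2 \<and> TV (indicator {x. t < - w x}) \<Omega> < top \<and>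
       enn2real (TV (indicator {x. t < - w x}) \<Omega>) + (LINT x|N. indicator {x. t < - \<tau> x} x * - F x) \<le> \<psi> t" for t
  have G1: "AE t in lborel. t \<in> {0<..<1} \<longrightarrow> G1 t"
    using \<phi>(3) AE_not_in[OF countable_imp_null_set_lborel[OF C1(1)]] by eventually_elim (auto simp: G1_def)
  have G2: "AE t in lborel. t \<in> {0<..<1} \<longrightarrow> G2 t"
    using \<psi>(3) AE_not_in[OF countable_imp_null_set_lborel[OF C2(1)]] by eventually_elim (auto simp: G2_def)

  \<comment> \<open>The competitors and their energy\<close>
  define v where "v t1 t2 = (\<lambda>x. indicator {x \<in> \<Omega>. u x > t1} x - indicator {x \<in> \<Omega>. u x < - t2} x :: real)" for t1 t2
  have v: "v t1 t2 \<in> restricted_BV \<mu> \<Omega>" "neumann_functional \<mu> \<Omega> f (v t1 t2) \<le> ereal (\<phi> t1 + \<psi> t2)"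
    if g: "G1 t1" "G2 t2" for t1 t2
  proof -
    have t: "0 < t1" "0 < t2" using g by (auto simp: G1_def G2_def)
    let ?i1 = "indicator {x. t1 < w x} :: 'a \<Rightarrow> real" and ?i2 = "indicator {x. t2 < - w x} :: 'a \<Rightarrow> real"
    \<comment> \<open>For positive levels the zero extension \<open>w\<close> lies in neither set
      outside \<open>\<Omega>\<close>, so the restriction to \<open>\<Omega>\<close> is
      automatic.\<close>
    have veq: "v t1 t2 = (\<lambda>x. ?i1 x - ?i2 x)"
      unfolding v_def w_def using t by (auto simp: indicator_def fun_eq_iff)
    have im: "?i1 \<in> borel_measurable M" "?i2 \<in> borel_measurable M" using wm by measurable
    then have vm: "v t1 t2 \<in> borel_measurable M" unfolding veq by measurable
    have TVv: "TV (v t1 t2) \<Omega> \<le> TV ?i1 \<Omega> + TV ?i2 \<Omega>"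
      unfolding veq by (rule TV_difference_le[OF domain(3) im])
    have TVi: "TV ?i1 \<Omega> < top" "TV ?i2 \<Omega> < top" using g by (auto simp: G1_def G2_def)
    then have sumfin: "TV ?i1 \<Omega> + TV ?i2 \<Omega> < top" by simp
    have vfin: "TV (v t1 t2) \<Omega> < top" using TVv sumfin by (rule le_less_trans)
    have v1: "\<bar>v t1 t2 x\<bar> \<le> 1" for x by (auto simp: v_def indicator_def)
    have "set_integrable M \<Omega> (v t1 t2)"
      unfolding set_integrable_def
    proof (rule Bochner_Integration.integrable_bound)
      show "integrable M (indicator \<Omega> :: 'a \<Rightarrow> real)"
        using bounded_finite[OF domain(2)] open_sets_M[OF domain(3)] by simp
      show "(\<lambda>x. indicator \<Omega> x *\<^sub>R v t1 t2 x) \<in> borel_measurable M"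
        using vm open_sets_M[OF domain(3)] by measurable
    qed (use v1 in \<open>auto simp: indicator_def\<close>)
    then show "v t1 t2 \<in> restricted_BV \<mu> \<Omega>"
      using vfin v1 by (auto simp: restricted_BV_def BV_def abs_le_iff intro!: AE_I2)
    \<comment> \<open>The trace of the competitor at those points of \<open>S\<close> where the
      trace of \<open>u\<close> exists and avoids both thresholds.\<close>
    define \<sigma> :: "'a \<Rightarrow> real" where "\<sigma> x = of_bool (t1 < \<tau> x) - of_bool (t2 < - \<tau> x)" for x
    have \<sigma>m: "\<sigma> \<in> borel_measurable N" unfolding \<sigma>_def by measurable
    have "AE x in N. x \<in> S \<longrightarrow> bv_trace \<mu> \<Omega> (v t1 t2) x = \<sigma> x"
    proof -
      have "t1 \<notin> C1" "t2 \<notin> C2" using g by (auto simp: G1_def G2_def)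
      from C1(2)[OF this(1)] C2(2)[OF this(2)] trw show ?thesis
      proof eventually_elim
        case (elim x)
        show ?case
        proof
          assume "x \<in> S"
          then have "is_trace \<mu> \<Omega> (v t1 t2) x (\<sigma> x)"
            unfolding veq \<sigma>_def using elim by (intro is_trace_threshold[OF domain(3) wm]) auto
          then show "bv_trace \<mu> \<Omega> (v t1 t2) x = \<sigma> x" by (rule bv_trace_eq[OF domain(3) vm])
        qed
      qed
    qed
    from boundary[OF \<sigma>m this]
    have bint: "(LINT x:S|N. bv_trace \<mu> \<Omega> (v t1 t2) x * f x) = (LINT x|N. \<sigma> x * F x)" .
    have i1: "integrable N (\<lambda>x. indicator {x. t1 < \<tau> x} x * F x)"
      and i2: "integrable N (\<lambda>x. indicator {x. t2 < - \<tau> x} x * - F x)"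
      by (rule Bochner_Integration.integrable_bound[OF F]; use F in \<open>auto simp: indicator_def\<close>)+
    have "(LINT x|N. \<sigma> x * F x) = (LINT x|N. indicator {x. t1 < \<tau> x} x * F x + indicator {x. t2 < - \<tau> x} x * - F x)"
      by (intro Bochner_Integration.integral_cong) (auto simp: \<sigma>_def indicator_def of_bool_def)
    also have "\<dots> = (LINT x|N. indicator {x. t1 < \<tau> x} x * F x) + (LINT x|N. indicator {x. t2 < - \<tau> x} x * - F x)"
      by (rule Bochner_Integration.integral_add[OF i1 i2])
    finally have split: "(LINT x|N. \<sigma> x * F x)
        = (LINT x|N. indicator {x. t1 < \<tau> x} x * F x) + (LINT x|N. indicator {x. t2 < - \<tau> x} x * - F x)" .
    have "enn2real (TV (v t1 t2) \<Omega>) \<le> enn2real (TV ?i1 \<Omega> + TV ?i2 \<Omega>)"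
      by (rule enn2real_mono[OF TVv sumfin])
    also have "\<dots> = enn2real (TV ?i1 \<Omega>) + enn2real (TV ?i2 \<Omega>)" using TVi by (simp add: enn2real_plus)
    finally have "enn2real (TV (v t1 t2) \<Omega>) + (LINT x|N. \<sigma> x * F x) \<le> \<phi> t1 + \<psi> t2"
      using g split by (simp add: G1_def G2_def)
    moreover have "neumann_functional \<mu> \<Omega> f (v t1 t2) = ereal (enn2real (TV (v t1 t2) \<Omega>) + (LINT x|N. \<sigma> x * F x))"
      using vfin bint
      by (simp add: neumann_functional_def S_def[symmetric] N_def[symmetric])
         (metis enn2ereal_ennreal ennreal_enn2real enn2real_nonneg plus_ereal.simps(1))
    ultimately show "neumann_functional \<mu> \<Omega> f (v t1 t2) \<le> ereal (\<phi> t1 + \<psi> t2)" by simp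
  qed

  \<comment> \<open>Choice of levels, and almost all levels for a minimizer\<close>
  obtain s1 where s1: "G1 s1" "\<phi> s1 \<le> A" using exists_le_of_integral_le[OF \<phi>(1,2) G1] by blast
  obtain s2 where s2: "G2 s2" "\<psi> s2 \<le> B" using exists_le_of_integral_le[OF \<psi>(1,2) G2] by blast
  have sets: "{x \<in> \<Omega>. u x > s} \<in> sets M" "{x \<in> \<Omega>. u x < - s} \<in> sets M" if "0 < s" for s
  proof -
    have "{x \<in> \<Omega>. u x > s} = {x \<in> space M. w x > s}" "{x \<in> \<Omega>. u x < - s} = {x \<in> space M. w x < - s}"
      using that by (auto simp: w_def indicator_def split: if_splits)
    moreover have "{x \<in> space M. w x > s} \<in> sets M" "{x \<in> space M. w x < - s} \<in> sets M"
      using wm by measurable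
    ultimately show "{x \<in> \<Omega>. u x > s} \<in> sets M" "{x \<in> \<Omega>. u x < - s} \<in> sets M" by auto
  qed
  have spos: "0 < s1" "0 < s2" using s1 s2 by (auto simp: G1_def G2_def)
  have "neumann_functional \<mu> \<Omega> f (v s1 s2) \<le> ereal (\<phi> s1 + \<psi> s2)" by (rule v(2)[OF s1(1) s2(1)])
  also have "\<dots> \<le> ereal J" using s1(2) s2(2) AB by simp
  finally have "neumann_functional \<mu> \<Omega> f (v s1 s2) \<le> neumann_functional \<mu> \<Omega> f u" by (simp add: Iu)
  then have part1: "\<exists>E\<^sub>1 E\<^sub>2. E\<^sub>1 \<in> sets M \<and> E\<^sub>2 \<in> sets M \<and>
            E\<^sub>1 \<subseteq> \<Omega> \<and> E\<^sub>2 \<subseteq> \<Omega> \<and> E\<^sub>1 \<inter> E\<^sub>2 = {} \<and>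
            (\<lambda>x. indicator E\<^sub>1 x - indicator E\<^sub>2 x) \<in> BV \<mu> \<Omega> \<and>
            neumann_functional \<mu> \<Omega> f (\<lambda>x. indicator E\<^sub>1 x - indicator E\<^sub>2 x)
              \<le> neumann_functional \<mu> \<Omega> f u"
    using sets(1)[OF spos(1)] sets(2)[OF spos(2)] spos v(1)[OF s1(1) s2(1)]
    unfolding v_def restricted_BV_def
    by (intro exI[of _ "{x \<in> \<Omega>. u x > s1}"] exI[of _ "{x \<in> \<Omega>. u x < - s2}"]) auto
  have part2: "\<exists>N\<in>null_sets lborel. \<forall>t\<^sub>1\<in>{0<..<1} - N. \<forall>t\<^sub>2\<in>{0<..<1} - N. solves_restricted_neumann \<mu> \<Omega> f (v t\<^sub>1 t\<^sub>2)"
    if sol: "solves_restricted_neumann \<mu> \<Omega> f u"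
  proof -
    have ge: "J \<le> \<phi> t1 + \<psi> t2" if g: "G1 t1" "G2 t2" for t1 t2
    proof -
      have "ereal J \<le> neumann_functional \<mu> \<Omega> f (v t1 t2)"
        using sol v(1)[OF g] Iu by (simp add: solves_restricted_neumann_def)
      also note v(2)[OF g]
      finally show ?thesis by simp
    qed
    \<comment> \<open>With the second level frozen at \<open>s2\<close>, the chain
      \<open>A + B \<le> J \<le> \<phi> t + \<psi> s2 \<le> \<phi> t + B\<close> gives the
      bound.\<close>
    have "AE t in lborel. t \<in> {0<..<1} \<longrightarrow> A \<le> \<phi> t"
      using G1 by eventually_elim (use ge[OF _ s2(1)] s2(2) AB in fastforce)
    note \<phi>A = AE_eq_of_integral_le[OF \<phi>(1,2) this]
    have "AE t in lborel. t \<in> {0<..<1} \<longrightarrow> B \<le> \<psi> t"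
      using G2 by eventually_elim (use ge[OF s1(1)] s1(2) AB in fastforce)
    note \<psi>B = AE_eq_of_integral_le[OF \<psi>(1,2) this]
    \<comment> \<open>All conditions are imposed on the same level \<open>t\<close>, so that the
      single null set \<open>Z\<close> serves for both thresholds.\<close>
    have "AE t in lborel. t \<in> {0<..<1} \<longrightarrow> G1 t \<and> \<phi> t = A \<and> G2 t \<and> \<psi> t = B"
      using G1 G2 \<phi>A \<psi>B by eventually_elim simp
    then obtain Z where Z: "Z \<in> null_sets lborel"
      "{t \<in> space lborel. \<not> (t \<in> {0<..<1} \<longrightarrow> G1 t \<and> \<phi> t = A \<and> G2 t \<and> \<psi> t = B)} \<subseteq> Z"
      by (rule AE_E) (auto simp: null_sets_def)
    have "solves_restricted_neumann \<mu> \<Omega> f (v t1 t2)" if "t1 \<in> {0<..<1} - Z" "t2 \<in> {0<..<1} - Z" for t1 t2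
    proof -
      have g: "G1 t1" "\<phi> t1 = A" "G2 t2" "\<psi> t2 = B" using Z(2) that by auto
      have "neumann_functional \<mu> \<Omega> f (v t1 t2) \<le> ereal (A + B)" using v(2)[OF g(1,3)] g(2,4) by simp
      also have "\<dots> \<le> neumann_functional \<mu> \<Omega> f u" using AB Iu by simp
      finally have "neumann_functional \<mu> \<Omega> f (v t1 t2) \<le> neumann_functional \<mu> \<Omega> f u" .
      then show ?thesis
        using sol v(1)[OF g(1,3)] unfolding solves_restricted_neumann_def by (meson order_trans)
    qed
    then show ?thesis using Z(1) by blast
  qed
  show ?thesis using part1 part2 unfolding v_def by blast
qed

end
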